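(* Let $H,V,A,A_{\rm rc},\mathcal A_{\rm m},\eta$ and the families $U_M^\diamond$, $K_M^{[\lambda]}$, $W_S^\vee$, $L_S^{[\lambda]}$ be as in the context, and suppose that Assumptions (A1)–(A4) of the context hold. (i) There exists a pair $(M_*,S_* )\in\mathbb N_+\times\mathbb N_+$ such that, for all integers $M\ge M_*$ and $S\ge S_*$, there exist $\lambda_{1*}=\lambda_{1*}(M)\ge0$ and $\lambda_{2*}=\lambda_{2*}(S)\ge0$ such that, for all $\lambda_1\ge\lambda_{1*}$ and all $\lambda_2\ge\lambda_{2*}$, the following holds: there exists a constant $D_1\ge0$ such that, for all $(z_0,y_0)\in H\times H$, the weak solution $(z,y)$ of $$\dot y=-Ay-A_{\rm rc}y-\eta\mathcal A_{\rm m}[y]+U_M^\diamond K_M^{[\lambda_1]}y+U_M^\diamond K_M^{[\lambda_1]}z,\qquad y(0)=y_0,$$ $$\dot z=-Az-A_{\rm rc}z-\eta\mathcal A_{\rm m}[z]+L_S^{[\lambda_2]}W_S^\vee z,\qquad z(0)=z_0,$$ satisfies, for all $t\ge s\ge0$, $$|(z,y)(t)|_{H\times H}^2+\mathfrak M(t)\le(1+D_1)\left(|(z,y)(s)|_{H\times H}^2+\mathfrak M(s)\right),$$ where $\mathfrak M(t):=\mathfrak M_z(t)+\mathfrak M_y(t)$ and $$\mathfrak M_g(t):=2\eta\int_0^t\langle\mathcal A_{\rm m}[g](\tau),g(\tau)\rangle_{V',V}\,d\tau\ge0,\qquad g\in\{z,y\}.$$ (ii) In the particular case where $H=L^2(\Omega)$,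 $V$ is the Sobolev space specified in the context, and the memory term is given by the exponential kernel, that is, for a constant $\gamma>0$, $$\mathcal A_{\rm m}[g](t)=\int_0^t e^{-\gamma(t-s)}(-\Delta)g(s)\,ds,$$ the pair $(M_*,S_* )\in\mathbb N_+\times\mathbb N_+$ can be chosen (larger) so that, with the same order of quantifiers as in (i) (for all $M\ge M_*$, $S\ge S_*$ there exist $\lambda_{1*}(M),\lambda_{2*}(S)\ge0$ such that for all $\lambda_1\ge\lambda_{1*}$, $\lambda_2\ge\lambda_{2*}$ there exists $D_1\ge0$ such that for all $(z_0,y_0)\in H\times H$), the weak solution of the same system satisfies, for all $t\ge s\ge0$, $$e^{2\gamma t}|(z,y)(t)|_{H\times H}^2+\overline{\mathfrak M}(t)\le(1+D_1)\left(e^{2\gamma s}|(z,y)(s)|_{H\times H}^2+\overline{\mathfrak M}(s)\right),$$ where $\overline{\mathfrak M}(t):=\overline{\mathfrak M}_z(t)+\overline{\mathfrak M}_y(t)$ and $$\overline{\mathfrak M}_g(t):=2\eta\int_0^t\left\langle\int_0^\tau(-\Delta)\bigl(e^{\gamma r}g(r)\bigr)\,dr,\;e^{\gamma\tau}g(\tau)\right\rangle_{V',V}d\tau\ge0,\qquad g\in\{z,y\}.$$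
   Context: **Notation.** $\mathbb N_+=\{1,2,\dots\}$, $\mathbb R_+=(0,\infty)$, $\mathcal L(X,Y)$ is the space of bounded linear operators between Banach spaces. $V$ and $H$ are real separable Hilbert spaces; $H$ is the pivot space, identified with its dual, $H=H'$, so $V\subseteq H\subseteq V'$, and $\langle\cdot,\cdot\rangle_{V',V}$ is the duality pairing extending the scalar product of $H$. Norms are denoted $|\cdot|_H$, $|\cdot|_V$, and $|(z,y)|_{H\times H}^2=|z|_H^2+|y|_H^2$. The space $V$ is endowed with the norm $|w|_V^2=\langle Aw,w\rangle_{V',V}$ (see (A1)). $\eta\ge0$ is a constant. **Memory operator.** $\mathcal A_{\rm m}$ is a linear causal operator: for $g\in L^2_{\rm loc}([0,\infty);V)$, $\mathcal A_{\rm m}[g]\in L^2_{\rm loc}([0,\infty);V')$, and $\mathcal A_{\rm m}[g](t)$ depends only on the history $g|_{(0,t)}$. **Control and output operators.** For each $M\in\mathbb N_+$ there are a positive integer $M_\sigma$ (number of actuators), a control operator $U_M^\diamond\in\mathcal L(\mathbb R^{M_\sigma},H)$, and, for each $\lambda\ge0$, a feedback-input operator $K_M^{[\lambda]}\in\mathcal L(H,\mathbb R^{M_\sigma})$. For each $S\in\mathbb N_+$ there are a positive integer $S_\varsigma$ (number of sensors), an output operator $W_S^\vee\in\mathcal L(H,\mathbb R^{S_\varsigma})$, and, for each $\lambda\ge0$, an output-injection operator $L_S^{[\lambda]}\in\mathcal L(\mathbb R^{S_\varsigma},H)$. (For $H=L^2(\Omega)$ with actuators $1_{\omega^j}$ and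 sensors $1_{\omega^i_{\rm m}}$, these are $U_M^\diamond v=\sum_j v_j1_{\omega^j}$ and $W_S^\vee h=((1_{\omega_{\rm m}^i},h)_{L^2(\Omega)})_i$.) **Assumptions.** (A1) The inclusion $V\subseteq H$ is dense, continuous, and compact. The operator $A\in\mathcal L(V,V')$ is symmetric and $(y,z)\mapsto\langle Ay,z\rangle_{V',V}$ is a complete scalar product on $V$. (A2) For almost every $t>0$, $A_{\rm rc}(t)\in\mathcal L(H,V')+\mathcal L(V,H)$, and $|A_{\rm rc}|_{L^\infty(\mathbb R_+,\,\mathcal L(H,V')+\mathcal L(V,H))}=:C_{\rm rc}<+\infty$. (A3) For any given $\varrho>0$: (a) there exists $M_*\in\mathbb N_+$ such that for all $M\ge M_*$ there exists $\lambda_{1*}=\lambda_{1*}(M)\ge0$ such that for all $\lambda_1\ge\lambda_{1*}$, $$2\langle(A-U_M^\diamond K_M^{[\lambda_1]})w,w\rangle_{V',V}\ge|w|_V^2+\varrho|w|_H^2\quad\text{for all }w\in V;$$ (b) there exists $S_*\in\mathbb N_+$ such that for all $S\ge S_*$ there exists $\lambda_{2*}=\lambda_{2*}(S)\ge0$ such that for all $\lambda_2\ge\lambda_{2*}$, $$2\langle(A-L_S^{[\lambda_2]}W_S^\vee)w,w\rangle_{V',V}\ge|w|_V^2+\varrho|w|_H^2\quad\text{for all }w\in V.$$ (A4) For all $t>0$ and all $g\in L^2(0,t;V)$, $\;0\le\int_0^t\langle\mathcal A_{\rm m}[g](s),g(s)\rangle_{V',V}\,ds$. **Weak solution.** A weak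 solution is a pair $(z,y)$ with $z,y\in L^2_{\rm loc}([0,\infty);V)\cap C([0,\infty);H)$ and $\dot z,\dot y\in L^2_{\rm loc}([0,\infty);V')$ satisfying the equations in $V'$ for almost every $t>0$ together with the initial conditions. The theorem concerns the estimates satisfied by such a solution; read "the weak solution satisfies" as "every weak solution satisfies". **Setting for part (ii).** $\Omega\subset\mathbb R^d$ ($d\ge1$) is a bounded open convex polygonal/polyhedral domain, $H=L^2(\Omega)$, and $V=\{h\in W^{1,2}(\Omega)\mid h|_{\partial\Omega}=0\}$ (Dirichlet boundary conditions) or $V=W^{1,2}(\Omega)$ (Neumann boundary conditions). The operator $-\Delta\in\mathcal L(V,V')$ is given by $\langle-\Delta y,w\rangle_{V',V}=(\nabla y,\nabla w)_{L^2(\Omega)^d}$ for $y,w\in V$. *)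

theory Defs
  imports "HOL-Analysis.Analysis"
begin

section \<open>Function spaces\<close>

text \<open>Square integrable functions, as representatives (no quotient is formed). The target is
  often a dual space \<open>'v \<Rightarrow>\<^sub>L real\<close> with \<open>'v\<close> a separable Hilbert space; it is norm separable,
  so Borel measurability is strong measurability there.\<close>

definition square_int_on :: "'a::euclidean_space set \<Rightarrow> ('a \<Rightarrow> 'b::real_normed_vector) \<Rightarrow> bool" where
  "square_int_on S g \<longleftrightarrow>
     set_borel_measurable lebesgue S g \<and> set_integrable lebesgue S (\<lambda>x. (norm (g x))\<^sup>2)"

definition L2_loc :: "(real \<Rightarrow> 'b::real_normed_vector) \<Rightarrow> bool" where
  "L2_loc g \<longleftrightarrow> (\<forall>T>0. square_int_on {0..T} g)"

primrec C_k :: "nat \<Rightarrow> ('a::euclidean_space \<Rightarrow> real) \<Rightarrow> bool" where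
  "C_k 0 f \<longleftrightarrow> continuous_on UNIV f"
| "C_k (Suc k) f \<longleftrightarrow> (\<forall>x. f differentiable (at x)) \<and>
     (\<forall>b\<in>Basis. C_k k (\<lambda>x. frechet_derivative f (at x) b))"

definition test_function :: "'a::euclidean_space set \<Rightarrow> ('a \<Rightarrow> real) \<Rightarrow> bool" where
  "test_function U \<phi> \<longleftrightarrow> (\<forall>k. C_k k \<phi>) \<and>
     compact (closure {x. \<phi> x \<noteq> 0}) \<and> closure {x. \<phi> x \<noteq> 0} \<subseteq> U"

text \<open>Integral of a function with values in the dual: \<open>\<langle>\<integral>\<^sub>S F, w\<rangle> = \<integral>\<^sub>S \<langle>F, w\<rangle>\<close>. It agrees with the
  Bochner integral for Bochner integrable \<open>F\<close>. The library's Bochner integral cannot be used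
  directly, since \<open>'v \<Rightarrow>\<^sub>L real\<close> is not an instance of \<open>second_countable_topology\<close>.\<close>

definition dual_integral ::
    "real set \<Rightarrow> (real \<Rightarrow> 'v::real_normed_vector \<Rightarrow>\<^sub>L real) \<Rightarrow> 'v \<Rightarrow>\<^sub>L real" where
  "dual_integral S F = Blinfun (\<lambda>w. LINT s:S|lebesgue. F s w)"


section \<open>The triple \<open>V \<subseteq> H \<subseteq> V'\<close> and the operators\<close>

text \<open>\<open>V\<close> and \<open>H\<close> are types, the inclusion \<open>V \<subseteq> H\<close> is an injective map \<open>j\<close>, \<open>V'\<close> is \<open>'v \<Rightarrow>\<^sub>L real\<close>
  and \<open>\<langle>f, w\<rangle>\<close> is the application \<open>f w\<close>. The inclusion \<open>H \<subseteq> V'\<close> given by \<open>H = H'\<close> is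
  \<open>pivot j\<close>: \<open>\<langle>pivot j h, w\<rangle> = (h, j w)\<close>.\<close>

definition pivot ::
    "('v::real_inner \<Rightarrow>\<^sub>L 'h::real_inner) \<Rightarrow> 'h \<Rightarrow> 'v \<Rightarrow>\<^sub>L real" where
  "pivot j h = blinfun_inner_right h o\<^sub>L j"

definition complete_scalar_product :: "('v::real_vector \<Rightarrow> 'v \<Rightarrow> real) \<Rightarrow> bool" where
  "complete_scalar_product a \<longleftrightarrow>
     (\<forall>y. linear (a y)) \<and> (\<forall>y z. a y z = a z y) \<and> (\<forall>y. y \<noteq> 0 \<longrightarrow> a y y > 0) \<and>
     (\<forall>X :: nat \<Rightarrow> 'v.
        (\<forall>e>0. \<exists>N. \<forall>m\<ge>N. \<forall>n\<ge>N. sqrt (a (X m - X n) (X m - X n)) < e) \<longrightarrow>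
        (\<exists>l. (\<lambda>n. sqrt (a (X n - l) (X n - l))) \<longlonglongrightarrow> 0))"

text \<open>The last conjunct is the convention that \<open>V\<close> is endowed with the norm
  \<open>|w|\<^sub>V\<^sup>2 = \<langle>A w, w\<rangle>\<close>.\<close>

definition assumption_A1 ::
    "('v::{real_inner,banach,second_countable_topology} \<Rightarrow>\<^sub>L
      'h::{real_inner,banach,second_countable_topology}) \<Rightarrow>
     ('v \<Rightarrow>\<^sub>L 'v \<Rightarrow>\<^sub>L real) \<Rightarrow> bool" where
  "assumption_A1 j A \<longleftrightarrow>
     inj j \<and> closure (range j) = UNIV \<and> compact (closure (j ` cball 0 1)) \<and>
     (\<forall>y z. A y z = A z y) \<and> complete_scalar_product (\<lambda>y z. A y z) \<and>
     (\<forall>w. (norm w)\<^sup>2 = A w w)"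

text \<open>An element of \<open>L(H,V') + L(V,H)\<close> is an operator \<open>R\<close> from \<open>V\<close> to \<open>V'\<close> of the form
  \<open>B + C\<close> (inclusions understood); the norm is the usual norm of a sum of Banach spaces.\<close>

definition rc_split ::
    "('v::real_inner \<Rightarrow>\<^sub>L 'h::real_inner) \<Rightarrow> ('v \<Rightarrow>\<^sub>L 'v \<Rightarrow>\<^sub>L real) \<Rightarrow>
     ('h \<Rightarrow>\<^sub>L 'v \<Rightarrow>\<^sub>L real) \<Rightarrow> ('v \<Rightarrow>\<^sub>L 'h) \<Rightarrow> bool" where
  "rc_split j R B C \<longleftrightarrow> (\<forall>v. R v = B (j v) + pivot j (C v))"

definition rc_norm ::
    "('v::real_inner \<Rightarrow>\<^sub>L 'h::real_inner) \<Rightarrow> ('v \<Rightarrow>\<^sub>L 'v \<Rightarrow>\<^sub>L real) \<Rightarrow> real" where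
  "rc_norm j R = Inf {norm B + norm C | B C. rc_split j R B C}"

definition assumption_A2 ::
    "('v::real_inner \<Rightarrow>\<^sub>L 'h::real_inner) \<Rightarrow> (real \<Rightarrow> 'v \<Rightarrow>\<^sub>L 'v \<Rightarrow>\<^sub>L real) \<Rightarrow> bool" where
  "assumption_A2 j Arc \<longleftrightarrow>
     (\<forall>v w. set_borel_measurable lebesgue {0<..} (\<lambda>t. Arc t v w)) \<and>
     (AE t in lebesgue. 0 < t \<longrightarrow> (\<exists>B C. rc_split j (Arc t) B C)) \<and>
     (\<exists>Crc. AE t in lebesgue. 0 < t \<longrightarrow> rc_norm j (Arc t) \<le> Crc)"

text \<open>The same condition is imposed on the feedback operators, \<open>F M l = U M \<circ> K M l\<close>, and on the
  output injection operators, \<open>F S l = L S l \<circ> W S\<close>.\<close>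

definition assumption_A3 ::
    "('v::real_inner \<Rightarrow>\<^sub>L 'h::real_inner) \<Rightarrow> ('v \<Rightarrow>\<^sub>L 'v \<Rightarrow>\<^sub>L real) \<Rightarrow>
     (nat \<Rightarrow> real \<Rightarrow> 'h \<Rightarrow> 'h) \<Rightarrow> bool" where
  "assumption_A3 j A F \<longleftrightarrow>
     (\<forall>\<rho>>0. \<exists>M\<^sub>0\<ge>1. \<forall>M\<ge>M\<^sub>0. \<exists>l\<^sub>0\<ge>0. \<forall>l\<ge>l\<^sub>0. \<forall>w.
        2 * (A w - pivot j (F M l (j w))) w \<ge> (norm w)\<^sup>2 + \<rho> * (norm (j w))\<^sup>2)"

text \<open>Equalities in \<open>L\<^sup>2\<^sub>l\<^sub>o\<^sub>c\<close> are almost everywhere. The last clause is causality; it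
  also says that the operator respects almost everywhere equality.\<close>

definition memory_operator ::
    "((real \<Rightarrow> 'v::real_normed_vector) \<Rightarrow> real \<Rightarrow> 'v \<Rightarrow>\<^sub>L real) \<Rightarrow> bool" where
  "memory_operator Am \<longleftrightarrow>
     (\<forall>g. L2_loc g \<longrightarrow> L2_loc (Am g)) \<and>
     (\<forall>a b g h. L2_loc g \<and> L2_loc h \<longrightarrow>
        (AE t in lebesgue. 0 < t \<longrightarrow>
           Am (\<lambda>s. a *\<^sub>R g s + b *\<^sub>R h s) t = a *\<^sub>R Am g t + b *\<^sub>R Am h t)) \<and>
     (\<forall>T>0. \<forall>g h. L2_loc g \<and> L2_loc h \<and> (AE s in lebesgue. 0 < s \<and> s < T \<longrightarrow> g s = h s) \<longrightarrow>
        (AE s in lebesgue. 0 < s \<and> s < T \<longrightarrow> Am g s = Am h s))"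

text \<open>A function on \<open>(0,t)\<close> is extended by zero; by causality the extension is immaterial.\<close>

definition assumption_A4 ::
    "((real \<Rightarrow> 'v::real_normed_vector) \<Rightarrow> real \<Rightarrow> 'v \<Rightarrow>\<^sub>L real) \<Rightarrow> bool" where
  "assumption_A4 Am \<longleftrightarrow>
     (\<forall>t>0. \<forall>g. square_int_on {0..t} g \<longrightarrow>
        0 \<le> (LINT s:{0..t}|lebesgue. Am (\<lambda>r. if r \<in> {0..t} then g r else 0) s (g s)))"

text \<open>The dimension of \<open>\<real>\<^sup>m\<close> depends on \<open>M\<close> or \<open>S\<close>, so vectors of \<open>\<real>\<^sup>m\<close> are sequences
  vanishing from index \<open>m\<close> on, with Euclidean norm \<open>L2_set v {..<m}\<close>.\<close>

definition Rvec :: "nat \<Rightarrow> (nat \<Rightarrow> real) set" where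
  "Rvec m = {v. \<forall>i\<ge>m. v i = 0}"

definition bounded_op_from_Rvec :: "nat \<Rightarrow> ((nat \<Rightarrow> real) \<Rightarrow> 'h::real_normed_vector) \<Rightarrow> bool" where
  "bounded_op_from_Rvec m U \<longleftrightarrow>
     (\<forall>a b. \<forall>v\<in>Rvec m. \<forall>w\<in>Rvec m. U (\<lambda>i. a * v i + b * w i) = a *\<^sub>R U v + b *\<^sub>R U w) \<and>
     (\<exists>C. \<forall>v\<in>Rvec m. norm (U v) \<le> C * L2_set v {..<m})"

definition bounded_op_to_Rvec :: "nat \<Rightarrow> ('h::real_normed_vector \<Rightarrow> nat \<Rightarrow> real) \<Rightarrow> bool" where
  "bounded_op_to_Rvec m K \<longleftrightarrow>
     (\<forall>h. K h \<in> Rvec m) \<and>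
     (\<forall>a b h k. K (a *\<^sub>R h + b *\<^sub>R k) = (\<lambda>i. a * K h i + b * K k i)) \<and>
     (\<exists>C. \<forall>h. L2_set (K h) {..<m} \<le> C * norm h)"


section \<open>Weak solutions\<close>

text \<open>\<open>yd\<close> is the derivative of \<open>y\<close> as a \<open>V'\<close>-valued distribution on \<open>(0,\<infinity>)\<close>:
  \<open>\<integral> \<phi>' y dt = - \<integral> \<phi> yd dt\<close> in \<open>V'\<close>, tested against the elements of \<open>V\<close>.\<close>

definition has_time_derivative ::
    "('v::real_inner \<Rightarrow>\<^sub>L 'h::real_inner) \<Rightarrow> (real \<Rightarrow> 'h) \<Rightarrow> (real \<Rightarrow> 'v \<Rightarrow>\<^sub>L real) \<Rightarrow> bool" where
  "has_time_derivative j y yd \<longleftrightarrow>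
     (\<forall>\<phi>. test_function {0<..} \<phi> \<longrightarrow>
        (\<forall>v. (LINT t:{0<..}|lebesgue. deriv \<phi> t * pivot j (y t) v) =
             - (LINT t:{0<..}|lebesgue. \<phi> t * yd t v)))"

text \<open>An element of \<open>L\<^sup>2\<^sub>l\<^sub>o\<^sub>c([0,\<infinity>);V) \<inter> C([0,\<infinity>);H)\<close> with time derivative \<open>yd\<close> in
  \<open>L\<^sup>2\<^sub>l\<^sub>o\<^sub>c([0,\<infinity>);V')\<close> is given by its continuous \<open>H\<close>-valued version \<open>y\<close> and a \<open>V\<close>-valued
  version \<open>yV\<close>, which agree almost everywhere.\<close>

definition energy_space ::
    "('v::real_inner \<Rightarrow>\<^sub>L 'h::real_inner) \<Rightarrow> (real \<Rightarrow> 'v) \<Rightarrow> (real \<Rightarrow> 'h) \<Rightarrow>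
     (real \<Rightarrow> 'v \<Rightarrow>\<^sub>L real) \<Rightarrow> bool" where
  "energy_space j yV y yd \<longleftrightarrow>
     L2_loc yV \<and> continuous_on {0..} y \<and> (AE t in lebesgue. 0 < t \<longrightarrow> j (yV t) = y t) \<and>
     L2_loc yd \<and> has_time_derivative j y yd"

definition weak_solution ::
    "('v::real_inner \<Rightarrow>\<^sub>L 'h::real_inner) \<Rightarrow> ('v \<Rightarrow>\<^sub>L 'v \<Rightarrow>\<^sub>L real) \<Rightarrow>
     (real \<Rightarrow> 'v \<Rightarrow>\<^sub>L 'v \<Rightarrow>\<^sub>L real) \<Rightarrow> ((real \<Rightarrow> 'v) \<Rightarrow> real \<Rightarrow> 'v \<Rightarrow>\<^sub>L real) \<Rightarrow> real \<Rightarrow>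
     ('h \<Rightarrow> 'h) \<Rightarrow> ('h \<Rightarrow> 'h) \<Rightarrow> 'h \<Rightarrow> 'h \<Rightarrow>
     (real \<Rightarrow> 'v) \<Rightarrow> (real \<Rightarrow> 'h) \<Rightarrow> (real \<Rightarrow> 'v) \<Rightarrow> (real \<Rightarrow> 'h) \<Rightarrow> bool" where
  "weak_solution j A Arc Am \<eta> UK LW z\<^sub>0 y\<^sub>0 zV z yV y \<longleftrightarrow>
     (\<exists>zd yd.
        energy_space j zV z zd \<and> energy_space j yV y yd \<and>
        (AE t in lebesgue. 0 < t \<longrightarrow>
           yd t = - A (yV t) - Arc t (yV t) - \<eta> *\<^sub>R Am yV t
                  + pivot j (UK (y t)) + pivot j (UK (z t))) \<and>
        (AE t in lebesgue. 0 < t \<longrightarrow>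
           zd t = - A (zV t) - Arc t (zV t) - \<eta> *\<^sub>R Am zV t + pivot j (LW (z t)))) \<and>
     y 0 = y\<^sub>0 \<and> z 0 = z\<^sub>0"

definition memory_energy ::
    "real \<Rightarrow> ((real \<Rightarrow> 'v::real_normed_vector) \<Rightarrow> real \<Rightarrow> 'v \<Rightarrow>\<^sub>L real) \<Rightarrow>
     (real \<Rightarrow> 'v) \<Rightarrow> real \<Rightarrow> real" where
  "memory_energy \<eta> Am g t = 2 * \<eta> * (LINT \<tau>:{0..t}|lebesgue. Am g \<tau> (g \<tau>))"


section \<open>The setting \<open>H = L\<^sup>2(\<Omega>)\<close> with exponential memory kernel\<close>

definition polytopal_domain :: "'a::euclidean_space set \<Rightarrow> bool" where
  "polytopal_domain \<Omega> \<longleftrightarrow>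
     open \<Omega> \<and> \<Omega> \<noteq> {} \<and> bounded \<Omega> \<and> convex \<Omega> \<and> polytope (closure \<Omega>)"

text \<open>\<open>H = L\<^sup>2(\<Omega>)\<close>: \<open>rep\<close> selects a representative of each class, and this identifies the
  Hilbert space \<open>'h\<close> with the square integrable functions on \<open>\<Omega>\<close> modulo null sets.\<close>

definition is_L2_space ::
    "'a::euclidean_space set \<Rightarrow> ('h::real_inner \<Rightarrow> 'a \<Rightarrow> real) \<Rightarrow> bool" where
  "is_L2_space \<Omega> rep \<longleftrightarrow>
     (\<forall>h. square_int_on \<Omega> (rep h)) \<and>
     (\<forall>f. square_int_on \<Omega> f \<longrightarrow> (\<exists>h. AE x in lebesgue. x \<in> \<Omega> \<longrightarrow> rep h x = f x)) \<and>
     (\<forall>a b h k. AE x in lebesgue. x \<in> \<Omega> \<longrightarrow>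
        rep (a *\<^sub>R h + b *\<^sub>R k) x = a * rep h x + b * rep k x) \<and>
     (\<forall>h k. inner h k = (LINT x:\<Omega>|lebesgue. rep h x * rep k x))"

text \<open>The distributional gradient of \<open>u\<close> exists, is square integrable, and is represented by \<open>G\<close>.\<close>

definition is_weak_grad ::
    "(real^'d) set \<Rightarrow> (real^'d \<Rightarrow> real) \<Rightarrow> (real^'d \<Rightarrow> real^'d) \<Rightarrow> bool" where
  "is_weak_grad \<Omega> u G \<longleftrightarrow>
     square_int_on \<Omega> G \<and>
     (\<forall>\<phi>. test_function \<Omega> \<phi> \<longrightarrow>
        (\<forall>i. (LINT x:\<Omega>|lebesgue. u x * frechet_derivative \<phi> (at x) (axis i 1)) =
             - (LINT x:\<Omega>|lebesgue. G x $ i * \<phi> x)))"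

definition weak_grad :: "(real^'d) set \<Rightarrow> (real^'d \<Rightarrow> real) \<Rightarrow> real^'d \<Rightarrow> real^'d" where
  "weak_grad \<Omega> u = (SOME G. is_weak_grad \<Omega> u G)"

definition W12 :: "(real^'d) set \<Rightarrow> (real^'d \<Rightarrow> real) \<Rightarrow> bool" where
  "W12 \<Omega> u \<longleftrightarrow> square_int_on \<Omega> u \<and> (\<exists>G. is_weak_grad \<Omega> u G)"

definition W12_norm_sq :: "(real^'d) set \<Rightarrow> (real^'d \<Rightarrow> real) \<Rightarrow> real" where
  "W12_norm_sq \<Omega> u =
     (LINT x:\<Omega>|lebesgue. (u x)\<^sup>2) + (LINT x:\<Omega>|lebesgue. (norm (weak_grad \<Omega> u x))\<^sup>2)"

text \<open>Zero boundary values, in the sense of \<open>W\<^sub>0\<^sup>1\<^sup>,\<^sup>2\<close>: the closure of the test functions in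
  \<open>W\<^sup>1\<^sup>,\<^sup>2\<close>.\<close>

definition W12_zero_boundary :: "(real^'d) set \<Rightarrow> (real^'d \<Rightarrow> real) \<Rightarrow> bool" where
  "W12_zero_boundary \<Omega> u \<longleftrightarrow> W12 \<Omega> u \<and>
     (\<exists>\<phi> :: nat \<Rightarrow> real^'d \<Rightarrow> real. (\<forall>n. test_function \<Omega> (\<phi> n)) \<and>
        (\<lambda>n. W12_norm_sq \<Omega> (\<lambda>x. \<phi> n x - u x)) \<longlonglongrightarrow> 0)"

datatype boundary_condition = Dirichlet | Neumann

text \<open>\<open>V\<close> is the Sobolev space belonging to the boundary condition, as a set and with its
  topology (its norm is the one induced by \<open>A\<close>).\<close>

definition is_Sobolev_space ::
    "boundary_condition \<Rightarrow> (real^'d) set \<Rightarrow> ('h::real_inner \<Rightarrow> real^'d \<Rightarrow> real) \<Rightarrow>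
     ('v::real_inner \<Rightarrow>\<^sub>L 'h) \<Rightarrow> bool" where
  "is_Sobolev_space bc \<Omega> rep j \<longleftrightarrow>
     range j = {h. case bc of Dirichlet \<Rightarrow> W12_zero_boundary \<Omega> (rep h)
                            | Neumann \<Rightarrow> W12 \<Omega> (rep h)} \<and>
     (\<exists>c>0. \<exists>C. \<forall>v. c * (norm v)\<^sup>2 \<le> W12_norm_sq \<Omega> (rep (j v)) \<and>
                      W12_norm_sq \<Omega> (rep (j v)) \<le> C * (norm v)\<^sup>2)"

text \<open>The formula determines \<open>D\<close> uniquely as an element of the bounded operators from \<open>V\<close> to \<open>V'\<close>;
  weak gradients are unique up to null sets, so the choice in \<^const>\<open>weak_grad\<close> is immaterial.\<close>

definition is_neg_Laplacian ::
    "(real^'d) set \<Rightarrow> ('h::real_inner \<Rightarrow> real^'d \<Rightarrow> real) \<Rightarrow> ('v::real_inner \<Rightarrow>\<^sub>L 'h) \<Rightarrow>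
     ('v \<Rightarrow>\<^sub>L 'v \<Rightarrow>\<^sub>L real) \<Rightarrow> bool" where
  "is_neg_Laplacian \<Omega> rep j D \<longleftrightarrow>
     (\<forall>y w. D y w =
        (LINT x:\<Omega>|lebesgue. inner (weak_grad \<Omega> (rep (j y)) x) (weak_grad \<Omega> (rep (j w)) x)))"

definition is_exponential_memory ::
    "real \<Rightarrow> ('v::real_normed_vector \<Rightarrow>\<^sub>L 'v \<Rightarrow>\<^sub>L real) \<Rightarrow>
     ((real \<Rightarrow> 'v) \<Rightarrow> real \<Rightarrow> 'v \<Rightarrow>\<^sub>L real) \<Rightarrow> bool" where
  "is_exponential_memory \<gamma> D Am \<longleftrightarrow>
     (\<forall>g. L2_loc g \<longrightarrow>
        (AE t in lebesgue. 0 < t \<longrightarrow>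
           Am g t = dual_integral {0..t} (\<lambda>s. exp (- \<gamma> * (t - s)) *\<^sub>R D (g s))))"

definition exp_memory_energy ::
    "real \<Rightarrow> real \<Rightarrow> ('v::real_normed_vector \<Rightarrow>\<^sub>L 'v \<Rightarrow>\<^sub>L real) \<Rightarrow> (real \<Rightarrow> 'v) \<Rightarrow> real \<Rightarrow> real" where
  "exp_memory_energy \<eta> \<gamma> D g t =
     2 * \<eta> * (LINT \<tau>:{0..t}|lebesgue.
       dual_integral {0..\<tau>} (\<lambda>r. D (exp (\<gamma> * r) *\<^sub>R g r)) (exp (\<gamma> * \<tau>) *\<^sub>R g \<tau>))"

end

theory Submission
  imports Defs "HOL-Computational_Algebra.Polynomial"
begin

text \<open>Write \<open>V\<close>, \<open>H\<close> for the two Hilbert spaces and fix a weight \<open>\<gamma> \<ge> 0\<close>. Testing each equation with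
  its own solution, multiplied by \<open>exp(2\<gamma>t)\<close>, gives an energy balance for
  \<open>exp(2\<gamma>t) |z|\<^sup>2 + M\<^sub>z\<close> and for \<open>exp(2\<gamma>t) |y|\<^sup>2 + M\<^sub>y\<close>, where the memory contributes
  \<open>M\<^sub>g(t) = 2\<eta> \<integral>\<^sub>0\<^sup>t exp(2\<gamma>\<tau>) \<langle>A\<^sub>m[g], g\<rangle> d\<tau>\<close>. For \<open>\<gamma> = 0\<close> this is the memory energy of the first
  part. For the exponential kernel the factor \<open>exp(\<gamma>\<tau>)\<close> turns the kernel \<open>exp(-\<gamma>(\<tau>-s))\<close> into the constant
  kernel acting on \<open>exp(\<gamma>s) g(s)\<close>, and \<open>M\<^sub>g\<close> is the memory energy of the second part
  (\<open>exp_memory_energy_eq\<close>). So both parts are instances of one weighted estimate.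

  The reaction-convection term satisfies \<open>2|\<langle>A\<^sub>r\<^sub>c w, w\<rangle>| \<le> |w|\<^sub>V\<^sup>2 + c\<^sup>2 |w|\<^sub>H\<^sup>2\<close>, and feedback gains are
  chosen with \<open>\<rho> = c\<^sup>2 + 2\<gamma> + 2\<close>: one share absorbs this term, one the derivative of the weight, and
  a dissipation of \<open>2|\<cdot>|\<^sub>H\<^sup>2\<close> is left (\<open>feedback_dissipation\<close>). With
  \<open>Q = \<integral>\<^sub>s\<^sup>t exp(2\<gamma>r) |z|\<^sup>2 dr\<close> and \<open>k\<close> a bound for the feedback, the balance for \<open>z\<close> gains \<open>- 2Q\<close>,
  and the coupling in the equation for \<open>y\<close> costs at most \<open>k\<^sup>2 Q\<close>. Since \<open>z\<close> does not see \<open>y\<close>, the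
  first balance bounds \<open>Q\<close> by the energy of \<open>z\<close> at time \<open>s\<close>, and \<open>D\<^sub>1 = k\<^sup>2\<close> works
  (\<open>closed_loop_estimate\<close>).

  The analytic core is the energy inequality
  \<open>|u(t)|\<^sup>2 - |u(s)|\<^sup>2 \<le> 2 \<integral>\<^sub>s\<^sup>t \<langle>u', u\<rangle>\<close> for \<open>u\<close> with values in \<open>V\<close> whose distributional derivative
  is only \<open>V'\<close>-valued (\<open>energy_inequality\<close>). Smooth cut-offs turn the distributional equation into
  \<open>(u(b) - u(a), v) = \<integral>\<^sub>a\<^sup>b \<langle>u', v\<rangle>\<close> for fixed \<open>v\<close>
  (\<open>weak_derivative_imp_weighted_integral\<close>). With \<open>v = u(r)\<close> and
  \<open>|u(r)|\<^sup>2 - |u(r - h)|\<^sup>2 \<le> 2 (u(r) - u(r - h), u(r))\<close>, integration over \<open>r\<close> and Fubini bound the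
  averaged increments of \<open>|u|\<^sup>2\<close> by the averages over \<open>p \<in> [0, h]\<close> of
  \<open>\<integral> \<langle>u'(q), u(q + p)\<rangle> dq\<close>, which converge as \<open>h\<close> tends to zero because translation is continuous in
  \<open>L\<^sup>2\<close> (\<open>translation_continuous_L2_compact_support\<close>).\<close>


section \<open>Smooth cut-off functions\<close>

text \<open>Peeling off one derivative at a time: every closure property of \<open>C_k\<close> below is an induction over
  this rule and its converse.\<close>

lemma C_k_Suc_realI:
  fixes f :: "real \<Rightarrow> real"
  assumes "\<And>x. (f has_real_derivative f' x) (at x)" "C_k k f'"
  shows "C_k (Suc k) f"
proof -
  have "frechet_derivative f (at x) 1 = f' x" for x
    using assms(1)[of x]
    by (metis frechet_derivative_at has_field_derivative_def mult.right_neutral)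
  moreover have "f differentiable (at x)" for x
    using assms(1)[of x] real_differentiable_def by blast
  ultimately show ?thesis using assms(2) by simp
qed

lemma C_k_Suc_realE:
  fixes f :: "real \<Rightarrow> real"
  assumes "C_k (Suc k) f"
  shows "(f has_real_derivative deriv f x) (at x)" "C_k k (deriv f)"
proof -
  have D: "(f has_real_derivative deriv f x) (at x)" for x
    using assms by (simp add: DERIV_deriv_iff_real_differentiable)
  then show "(f has_real_derivative deriv f x) (at x)" .
  have "frechet_derivative f (at x) 1 = deriv f x" for x
    using D[of x] by (metis frechet_derivative_at has_field_derivative_def mult.right_neutral)
  then show "C_k k (deriv f)" using assms by (simp add: Basis_real_def)
qed

lemma C_k_mono_Suc:
  fixes f :: "real \<Rightarrow> real"
  shows "C_k (Suc k) f \<Longrightarrow> C_k k f"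
proof (induction k arbitrary: f)
  case 0
  then show ?case
    by (auto intro!: continuous_at_imp_continuous_on differentiable_imp_continuous_within)
next
  case (Suc k)
  show ?case
    by (rule C_k_Suc_realI[OF C_k_Suc_realE(1)[OF Suc.prems]])
      (rule Suc.IH, rule C_k_Suc_realE(2)[OF Suc.prems])
qed

lemma C_k_add:
  fixes f g :: "real \<Rightarrow> real"
  shows "C_k k f \<Longrightarrow> C_k k g \<Longrightarrow> C_k k (\<lambda>x. f x + g x)"
proof (induction k arbitrary: f g)
  case 0
  then show ?case by (auto intro: continuous_intros)
next
  case (Suc k)
  show ?case
    by (rule C_k_Suc_realI[where f'="\<lambda>x. deriv f x + deriv g x"])
      (auto intro!: DERIV_add C_k_Suc_realE Suc simp del: C_k.simps)
qed

lemma C_k_mult: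
  fixes f g :: "real \<Rightarrow> real"
  shows "C_k k f \<Longrightarrow> C_k k g \<Longrightarrow> C_k k (\<lambda>x. f x * g x)"
proof (induction k arbitrary: f g)
  case 0
  then show ?case by (auto intro: continuous_intros)
next
  case (Suc k)
  show ?case
    by (rule C_k_Suc_realI[where f'="\<lambda>x. deriv f x * g x + deriv g x * f x"])
      (auto intro!: DERIV_mult C_k_Suc_realE Suc C_k_add C_k_mono_Suc[OF Suc.prems(1)]
         C_k_mono_Suc[OF Suc.prems(2)] simp del: C_k.simps)
qed

lemma C_k_const: "C_k k (\<lambda>x::real. c)"
proof (induction k arbitrary: c)
  case (Suc k)
  show ?case by (rule C_k_Suc_realI[where f'="\<lambda>_. 0"]) (use Suc in \<open>auto simp del: C_k.simps\<close>)
qed auto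

text \<open>The derivative of \<open>1/f\<close> is a product of \<open>f'\<close> with two copies of \<open>1/f\<close>, so smoothness of order \<open>k\<close> of
  \<open>1/f\<close> gives order \<open>k + 1\<close>.\<close>

lemma C_k_inverse:
  fixes f :: "real \<Rightarrow> real"
  assumes nz: "\<And>x. f x \<noteq> 0"
  shows "C_k k f \<Longrightarrow> C_k k (\<lambda>x. inverse (f x))"
proof (induction k)
  case 0
  then show ?case using nz by (auto intro!: continuous_intros)
next
  case (Suc k)
  show ?case
  proof (rule C_k_Suc_realI[where f'="\<lambda>x. (-1) * (inverse (f x) * deriv f x * inverse (f x))"])
    show "((\<lambda>x. inverse (f x)) has_real_derivative
        (-1) * (inverse (f x) * deriv f x * inverse (f x))) (at x)" for x
      using DERIV_inverse'[OF C_k_Suc_realE(1)[OF Suc.prems] nz, of x] by simp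
    show "C_k k (\<lambda>x. (-1) * (inverse (f x) * deriv f x * inverse (f x)))"
      by (intro C_k_mult C_k_const C_k_Suc_realE Suc C_k_mono_Suc[OF Suc.prems])
  qed
qed

lemma C_k_affine:
  fixes f :: "real \<Rightarrow> real"
  shows "C_k k f \<Longrightarrow> C_k k (\<lambda>x. f (a * x + b))"
proof (induction k arbitrary: f)
  case 0
  then show ?case by (auto intro!: continuous_on_compose2[of UNIV f] continuous_intros)
next
  case (Suc k)
  show ?case
  proof (rule C_k_Suc_realI[where f'="\<lambda>x. deriv f (a * x + b) * a"])
    show "((\<lambda>x. f (a * x + b)) has_real_derivative deriv f (a * x + b) * a) (at x)" for x
      by (rule DERIV_chain2[OF C_k_Suc_realE(1)[OF Suc.prems]]) (auto intro!: derivative_eq_intros)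
    show "C_k k (\<lambda>x. deriv f (a * x + b) * a)"
      by (intro C_k_mult C_k_const Suc.IH C_k_Suc_realE Suc.prems)
  qed
qed

lemma C_k_exp: "C_k k (\<lambda>x::real. exp (a * x))"
proof (induction k)
  case 0
  then show ?case by (auto intro!: continuous_intros)
next
  case (Suc k)
  show ?case
    by (rule C_k_Suc_realI[where f'="\<lambda>x. a * exp (a * x)"])
      (auto intro!: derivative_eq_intros C_k_mult C_k_const Suc)
qed

text \<open>The functions \<open>p(1/x) exp(-1/x)\<close> with a polynomial \<open>p\<close>. The family contains \<open>exp(-1/x)\<close> and is closed under
  differentiation, which makes each member smooth, also at \<open>0\<close>.\<close>

definition flat :: "real poly \<Rightarrow> real \<Rightarrow> real" where
  "flat p x = (if x > 0 then poly p (1 / x) * exp (- (1 / x)) else 0)"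

lemma poly_exp_decay: "((\<lambda>y::real. poly p y * exp (- y)) \<longlongrightarrow> 0) at_top"
proof -
  have "((\<lambda>y::real. \<Sum>i\<le>degree p. coeff p i * (y ^ i / exp y)) \<longlongrightarrow>
      (\<Sum>i\<le>degree p. coeff p i * 0)) at_top"
    by (intro tendsto_intros tendsto_power_div_exp_0)
  then show ?thesis
    by (simp add: poly_altdef sum_distrib_right exp_minus divide_inverse mult.assoc)
qed

text \<open>At \<open>0\<close> the right difference quotient is \<open>y p(y) exp(-y)\<close> with \<open>y = 1/h\<close>, and the exponential wins.\<close>

lemma flat_derivative:
  "(flat p has_real_derivative flat ([:0, 0, 1:] * (p - pderiv p)) x) (at x)"
proof -
  consider "x > 0" | "x < 0" | "x = 0" by linarith
  then show ?thesis
  proof cases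
    case 1
    have "((\<lambda>x. poly p (1 / x) * exp (- (1 / x))) has_real_derivative
        flat ([:0, 0, 1:] * (p - pderiv p)) x) (at x)"
      using 1 by (auto intro!: derivative_eq_intros DERIV_chain2[OF poly_DERIV]
          simp: flat_def field_simps power2_eq_square)
    then show ?thesis
      by (rule has_field_derivative_transform_within_open[where S="{0<..}"])
        (use 1 in \<open>auto simp: flat_def\<close>)
  next
    case 2
    have "((\<lambda>x. 0) has_real_derivative flat ([:0, 0, 1:] * (p - pderiv p)) x) (at x)"
      using 2 by (auto simp: flat_def)
    then show ?thesis
      by (rule has_field_derivative_transform_within_open[where S="{..<0}"])
        (use 2 in \<open>auto simp: flat_def\<close>)
  next
    case 3
    have "((\<lambda>h. flat p h / h) \<longlongrightarrow> 0) (at_right 0)"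
    proof -
      have "((\<lambda>y::real. poly ([:0, 1:] * p) y * exp (- y)) \<longlongrightarrow> 0) at_top"
        by (rule poly_exp_decay)
      then have "((\<lambda>h::real. poly ([:0, 1:] * p) (inverse h) * exp (- inverse h)) \<longlongrightarrow> 0) (at_right 0)"
        by (rule filterlim_compose[OF _ filterlim_inverse_at_top_right])
      then show ?thesis
        by (rule Lim_transform_eventually)
          (auto simp: eventually_at_right_field flat_def field_simps intro!: exI[of _ 1])
    qed
    moreover have "((\<lambda>h. flat p h / h) \<longlongrightarrow> 0) (at_left 0)"
      by (rule Lim_transform_eventually[OF tendsto_const])
        (auto simp: eventually_at_left_field flat_def intro!: exI[of _ "-1"])
    ultimately have "((\<lambda>h. flat p h / h) \<longlongrightarrow> 0) (at 0)"
      by (simp add: filterlim_split_at)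
    then show ?thesis using 3
      by (simp add: DERIV_def flat_def)
  qed
qed

lemma C_k_flat: "C_k k (flat p)"
proof (induction k arbitrary: p)
  case 0
  have "isCont (flat p) x" for x using flat_derivative DERIV_isCont by blast
  then show ?case by (simp add: continuous_at_imp_continuous_on)
next
  case (Suc k)
  show ?case by (rule C_k_Suc_realI[OF flat_derivative Suc])
qed

text \<open>With \<open>f(x) = exp(-1/x)\<close> for \<open>x > 0\<close> and \<open>0\<close> otherwise, the step is \<open>f(x) / (f(x) + f(1 - x))\<close>; one of
  the two summands is always positive.\<close>

lemma smooth_step_exists:
  obtains \<sigma> :: "real \<Rightarrow> real" where "\<And>k. C_k k \<sigma>" "\<And>x. 0 \<le> \<sigma> x" "\<And>x. \<sigma> x \<le> 1"
    "\<And>x. x \<le> 0 \<Longrightarrow> \<sigma> x = 0" "\<And>x. x \<ge> 1 \<Longrightarrow> \<sigma> x = 1"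
proof -
  let ?f = "flat 1"
  define d where "d x = ?f x + ?f (1 - x)" for x
  have f: "?f x = (if x > 0 then exp (- (1 / x)) else 0)" for x
    by (simp add: flat_def)
  have d: "d x > 0" for x
    unfolding d_def f by (auto intro: add_pos_pos)
  have "C_k k (\<lambda>x. ?f ((-1) * x + 1))" for k by (intro C_k_affine C_k_flat)
  then have Cd: "C_k k d" for k
    unfolding d_def[abs_def] using C_k_add[OF C_k_flat, of k _ 1] by simp
  show ?thesis
  proof (rule that[of "\<lambda>x. ?f x * inverse (d x)"])
    show "C_k k (\<lambda>x. ?f x * inverse (d x))" for k
      using d by (intro C_k_mult C_k_flat C_k_inverse Cd) (metis less_irrefl)
    show "0 \<le> ?f x * inverse (d x)" for x
      using d[of x] by (auto simp: f)
    show "?f x * inverse (d x) \<le> 1" for x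
      using d[of x] by (simp add: divide_inverse[symmetric] divide_le_eq) (simp add: d_def f)
    show "?f x * inverse (d x) = 0" if "x \<le> 0" for x
      using that by (simp add: f)
    show "?f x * inverse (d x) = 1" if "x \<ge> 1" for x
      using that d[of x] by (simp add: d_def f)
  qed
qed


section \<open>From the weak time derivative to integrals\<close>

lemma integrable_continuous_compact_support:
  fixes f :: "real \<Rightarrow> real"
  assumes "continuous_on UNIV f" "\<And>x. x \<notin> {a..b} \<Longrightarrow> f x = 0"
  shows "integrable lebesgue f"
proof -
  have "integrable lborel (\<lambda>x. indicator {a..b} x *\<^sub>R f x)"
    by (rule borel_integrable_compact) (auto intro: continuous_on_subset[OF assms(1)])
  moreover have "(\<lambda>x. indicator {a..b} x *\<^sub>R f x) = f"
    using assms(2) by (force simp: indicator_def fun_eq_iff)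
  ultimately show ?thesis by (simp add: integrable_completion)
qed

lemma set_integrable_lebesgue_continuous:
  fixes f :: "real \<Rightarrow> 'b::{banach,second_countable_topology}"
  assumes "continuous_on {a..b} f"
  shows "set_integrable lebesgue {a..b} f"
proof -
  have "integrable lborel (\<lambda>x. indicator {a..b} x *\<^sub>R f x)"
    by (rule borel_integrable_compact[OF compact_Icc assms])
  then show ?thesis
    unfolding set_integrable_def by (subst integrable_completion) auto
qed

text \<open>The derivative of a smooth step has integral \<open>1\<close> and lives on \<open>[0, 1]\<close>, so its rescalings
  concentrate at \<open>a\<close>. After substitution the integrands are dominated, as the derivative is bounded.\<close>

lemma step_derivative_approx_identity:
  fixes \<sigma> H :: "real \<Rightarrow> real"
  assumes C1: "C_k 1 \<sigma>" and lo: "\<And>x. x \<le> 0 \<Longrightarrow> \<sigma> x = 0" and hi: "\<And>x. x \<ge> 1 \<Longrightarrow> \<sigma> x = 1"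
    and H: "continuous_on UNIV H"
  shows "(\<lambda>n. LINT t|lebesgue. real (Suc n) * deriv \<sigma> (real (Suc n) * (t - a)) * H t) \<longlonglongrightarrow> H a"
    and "\<And>x. x \<notin> {0..1} \<Longrightarrow> deriv \<sigma> x = 0"
    and "continuous_on UNIV (deriv \<sigma>)"
    and "\<And>n. integrable lebesgue (\<lambda>t. real (Suc n) * deriv \<sigma> (real (Suc n) * (t - a)) * H t)"
proof -
  have D: "(\<sigma> has_real_derivative deriv \<sigma> x) (at x)" for x
    using C_k_Suc_realE(1)[of 0 \<sigma>] C1 by simp
  show cont: "continuous_on UNIV (deriv \<sigma>)"
    using C_k_Suc_realE(2)[of 0 \<sigma>] C1 by simp
  show z: "deriv \<sigma> x = 0" if "x \<notin> {0..1}" for x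
  proof -
    have "(\<sigma> has_real_derivative 0) (at x)"
    proof (cases "x < 0")
      case True
      have "((\<lambda>_. 0) has_real_derivative 0) (at x)" by simp
      then show ?thesis
        by (rule has_field_derivative_transform_within_open[where S="{..<0}"])
          (use True lo in auto)
    next
      case False
      have "((\<lambda>_. 1) has_real_derivative 0) (at x)" by simp
      then show ?thesis
        by (rule has_field_derivative_transform_within_open[where S="{1<..}"])
          (use False that hi in auto)
    qed
    then show ?thesis by (rule DERIV_imp_deriv)
  qed
  have contn: "continuous_on UNIV (\<lambda>t. real (Suc n) * deriv \<sigma> (real (Suc n) * (t - a)) * H t)" for n
    by (intro continuous_intros continuous_on_compose2[OF cont] H) auto
  show "integrable lebesgue (\<lambda>t. real (Suc n) * deriv \<sigma> (real (Suc n) * (t - a)) * H t)" for n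
  proof (rule integrable_continuous_compact_support[where a=a and b="a+1"])
    fix x assume x: "x \<notin> {a..a+1}"
    have "real (Suc n) * (x - a) \<notin> {0..1}"
    proof (cases "x < a")
      case True
      then have "real (Suc n) * (x - a) < 0" by (intro mult_pos_neg) auto
      then show ?thesis by simp
    next
      case False
      then have "x - a > 1" using x by auto
      moreover then have "1 * (x - a) \<le> real (Suc n) * (x - a)" by (intro mult_right_mono) auto
      ultimately have "1 < real (Suc n) * (x - a)"
        unfolding mult_1 by (rule less_le_trans)
      then show ?thesis by (simp only: atLeastAtMost_iff not_le) auto
    qed
    then show "real (Suc n) * deriv \<sigma> (real (Suc n) * (x - a)) * H x = 0" by (simp add: z)
  qed (rule contn)
  have eq: "(LINT t|lebesgue. real (Suc n) * deriv \<sigma> (real (Suc n) * (t - a)) * H t) =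
      (LINT x|lebesgue. deriv \<sigma> x * H (a + x / real (Suc n)))" for n
  proof -
    have "(LINT t|lebesgue. real (Suc n) * deriv \<sigma> (real (Suc n) * (t - a)) * H t) =
      \<bar>1 / real (Suc n)\<bar> *\<^sub>R (LINT x|lebesgue. real (Suc n) * deriv \<sigma> (real (Suc n) * ((a + 1 / real (Suc n) * x) - a)) * H (a + 1 / real (Suc n) * x))"
      by (rule lebesgue_integral_real_affine) auto
    also have "\<dots> = (LINT x|lebesgue. \<bar>1 / real (Suc n)\<bar> *\<^sub>R (real (Suc n) * deriv \<sigma> (real (Suc n) * ((a + 1 / real (Suc n) * x) - a)) * H (a + 1 / real (Suc n) * x)))"
      by (rule integral_scaleR_right[symmetric])
    also have "\<dots> = (LINT x|lebesgue. deriv \<sigma> x * H (a + x / real (Suc n)))"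
      by (rule Bochner_Integration.integral_cong) (auto simp del: of_nat_Suc)
    finally show ?thesis .
  qed
  have one: "(LINT x|lebesgue. deriv \<sigma> x * H a) = H a"
  proof -
    have "(LINT x|lborel. indicator {0..1} x *\<^sub>R deriv \<sigma> x) = \<sigma> 1 - \<sigma> 0"
      by (rule integral_FTC_Icc)
        (auto intro: continuous_on_subset[OF cont] D DERIV_subset
           simp flip: has_real_derivative_iff_has_vector_derivative)
    moreover have "(\<lambda>x. indicator {0..1} x *\<^sub>R deriv \<sigma> x) = deriv \<sigma>"
      using z by (force simp: indicator_def fun_eq_iff)
    moreover have "deriv \<sigma> \<in> borel_measurable lborel"
      using cont by (simp add: borel_measurable_continuous_onI)
    ultimately show ?thesis by (simp add: lo hi integral_completion)
  qed
  obtain B where B: "\<And>x. x \<in> {a..a+1} \<Longrightarrow> \<bar>H x\<bar> \<le> B"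
    using compact_imp_bounded[OF compact_continuous_image[OF continuous_on_subset[OF H subset_UNIV] compact_Icc], of a "a+1"]
    unfolding bounded_iff by fastforce
  have "(\<lambda>n. LINT x|lebesgue. deriv \<sigma> x * H (a + x / real (Suc n))) \<longlonglongrightarrow> (LINT x|lebesgue. deriv \<sigma> x * H a)"
  proof (rule integral_dominated_convergence[where w="\<lambda>x. \<bar>deriv \<sigma> x\<bar> * B"])
    have m: "f \<in> borel_measurable lebesgue" if "continuous_on UNIV f" for f :: "real \<Rightarrow> real"
      using that by (intro measurable_completion) (simp add: borel_measurable_continuous_onI)
    show "(\<lambda>x. deriv \<sigma> x * H a) \<in> borel_measurable lebesgue"
      by (intro m continuous_intros cont)
    show "(\<lambda>x. deriv \<sigma> x * H (a + x / real (Suc n))) \<in> borel_measurable lebesgue" for n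
      by (intro m continuous_intros cont continuous_on_compose2[OF H]) auto
    show "integrable lebesgue (\<lambda>x. \<bar>deriv \<sigma> x\<bar> * B)"
      by (rule integrable_continuous_compact_support[where a=0 and b=1])
        (auto intro!: continuous_intros cont simp: z)
    show "AE x in lebesgue. (\<lambda>n. deriv \<sigma> x * H (a + x / real (Suc n))) \<longlonglongrightarrow> deriv \<sigma> x * H a"
    proof (intro AE_I2 tendsto_intros)
      fix x
      have "(\<lambda>n. a + x * (1 / real (Suc n))) \<longlonglongrightarrow> a + x * 0"
        by (intro tendsto_intros LIMSEQ_Suc lim_1_over_n)
      then have "(\<lambda>n. a + x / real (Suc n)) \<longlonglongrightarrow> a" by simp
      then show "(\<lambda>n. H (a + x / real (Suc n))) \<longlonglongrightarrow> H a"
        using H by (metis UNIV_I continuous_on_eq_continuous_at isCont_tendsto_compose open_UNIV)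
    qed
    show "AE x in lebesgue. norm (deriv \<sigma> x * H (a + x / real (Suc n))) \<le> \<bar>deriv \<sigma> x\<bar> * B" for n
    proof (intro AE_I2)
      fix x
      show "norm (deriv \<sigma> x * H (a + x / real (Suc n))) \<le> \<bar>deriv \<sigma> x\<bar> * B"
      proof (cases "x \<in> {0..1}")
        case True
        then have "x / real (Suc n) \<in> {0..1}" by (auto simp: divide_le_eq)
        then show ?thesis using B[of "a + x / real (Suc n)"]
          by (auto simp: abs_mult intro: mult_left_mono)
      qed (simp add: z)
    qed
  qed
  then show "(\<lambda>n. LINT t|lebesgue. real (Suc n) * deriv \<sigma> (real (Suc n) * (t - a)) * H t) \<longlonglongrightarrow> H a"
    by (simp only: eq one)
qed

text \<open>The test functions are \<open>\<phi>\<^sub>n(t) = (\<sigma>(n(t - a)) - \<sigma>(n(t - b))) exp(\<gamma>t)\<close> with a smooth step \<open>\<sigma>\<close>. They tend to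
  \<open>exp(\<gamma>t)\<close> on \<open>(a, b]\<close> and to \<open>0\<close> elsewhere, and their derivatives produce the values of \<open>exp(\<gamma>t) F\<close> at \<open>a\<close> and
  \<open>b\<close>. The weight is built into the test function, so that the product rule for the weak derivative
  of \<open>exp(\<gamma>t) F\<close> comes for free.\<close>

lemma weak_derivative_imp_weighted_integral:
  fixes F g :: "real \<Rightarrow> real" and \<gamma> :: real
  assumes F: "continuous_on {0..} F"
    and g: "\<And>T. T > 0 \<Longrightarrow> set_integrable lebesgue {0..T} g"
    and weak: "\<And>\<phi>. test_function {0<..} \<phi> \<Longrightarrow>
      (LINT t:{0<..}|lebesgue. deriv \<phi> t * F t) = - (LINT t:{0<..}|lebesgue. \<phi> t * g t)"
    and ab: "0 < a" "a \<le> b"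
  shows "exp (\<gamma> * b) * F b - exp (\<gamma> * a) * F a =
    (LINT t:{a..b}|lebesgue. exp (\<gamma> * t) * (g t + \<gamma> * F t))"
proof -
  obtain \<sigma> :: "real \<Rightarrow> real" where \<sigma>: "\<And>k. C_k k \<sigma>" "\<And>x. 0 \<le> \<sigma> x" "\<And>x. \<sigma> x \<le> 1"
    "\<And>x. x \<le> 0 \<Longrightarrow> \<sigma> x = 0" "\<And>x. x \<ge> 1 \<Longrightarrow> \<sigma> x = 1"
    using smooth_step_exists by metis
  \<comment> \<open>\<open>F\<close> is continuous only on \<open>[0, \<infinity>)\<close>; it is extended constantly to the left.\<close>
  define H where "H t = exp (\<gamma> * t) * F (max 0 t)" for t
  have Fm: "continuous_on UNIV (\<lambda>t. F (max 0 t))"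
    by (rule continuous_on_compose2[OF F]) (auto intro!: continuous_intros)
  have H: "continuous_on UNIV H"
    unfolding H_def[abs_def] by (intro continuous_intros Fm)
  note step = step_derivative_approx_identity[OF \<sigma>(1) \<sigma>(4,5) H]
  define m where "m n = real (Suc n)" for n
  have m1: "m n \<ge> 1" for n by (simp add: m_def)
  define \<tau> where "\<tau> n t = \<sigma> (m n * (t - a)) - \<sigma> (m n * (t - b))" for n t
  define \<phi> where "\<phi> n t = \<tau> n t * exp (\<gamma> * t)" for n t
  have C\<tau>: "C_k k (\<tau> n)" for n k
  proof -
    have "C_k k (\<lambda>t. \<sigma> (m n * t + (- m n * a)) + (-1) * \<sigma> (m n * t + (- m n * b)))"
      by (intro C_k_add C_k_mult C_k_const C_k_affine \<sigma>)
    then show ?thesis by (simp add: \<tau>_def[abs_def] algebra_simps)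
  qed
  have C\<phi>: "C_k k (\<phi> n)" for n k
    unfolding \<phi>_def[abs_def] by (intro C_k_mult C\<tau> C_k_exp)
  have \<tau>0: "\<tau> n t = 0" if "t \<notin> {a..b+1}" for n t
  proof (cases "t < a")
    case True
    then have "m n * (t - a) \<le> 0" "m n * (t - b) \<le> 0"
      using ab m1[of n] by (auto intro!: mult_nonneg_nonpos)
    then show ?thesis by (simp add: \<tau>_def \<sigma>)
  next
    case False
    then have "1 * 1 \<le> m n * (t - a)" "1 * 1 \<le> m n * (t - b)"
      using that ab m1[of n] by (intro mult_mono; simp)+
    then show ?thesis by (simp add: \<tau>_def \<sigma>)
  qed
  have \<tau>1: "\<bar>\<tau> n t\<bar> \<le> 1" for n t
    using \<sigma>(2)[of "m n * (t - a)"] \<sigma>(2)[of "m n * (t - b)"] \<sigma>(3)[of "m n * (t - a)"]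
      \<sigma>(3)[of "m n * (t - b)"] unfolding \<tau>_def by linarith
  have test: "test_function {0<..} (\<phi> n)" for n
  proof -
    have "{t. \<phi> n t \<noteq> 0} \<subseteq> {a..b+1}" using \<tau>0 unfolding \<phi>_def by force
    then have sub: "closure {t. \<phi> n t \<noteq> 0} \<subseteq> {a..b+1}" by (rule closure_minimal) simp
    then have "compact (closure {t. \<phi> n t \<noteq> 0})"
      by (meson bounded_closed_interval bounded_subset closed_closure compact_eq_bounded_closed)
    then show ?thesis using sub ab C\<phi> by (auto simp: test_function_def)
  qed
  have der: "deriv (\<phi> n) t = (m n * deriv \<sigma> (m n * (t - a)) - m n * deriv \<sigma> (m n * (t - b))) * exp (\<gamma> * t)
      + \<phi> n t * \<gamma>" for n t
  proof (rule DERIV_imp_deriv)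
    have D: "(\<sigma> has_real_derivative deriv \<sigma> x) (at x)" for x
      by (rule C_k_Suc_realE(1)[OF \<sigma>(1)])
    have "((\<lambda>t. \<sigma> (m n * (t - c))) has_real_derivative deriv \<sigma> (m n * (t - c)) * m n) (at t)" for c
      by (rule DERIV_chain2[OF D]) (auto intro!: derivative_eq_intros)
    then show "(\<phi> n has_real_derivative (m n * deriv \<sigma> (m n * (t - a)) - m n * deriv \<sigma> (m n * (t - b))) * exp (\<gamma> * t)
      + \<phi> n t * \<gamma>) (at t)"
      unfolding \<phi>_def[abs_def] \<tau>_def
      by (auto intro!: derivative_eq_intros simp: algebra_simps)
  qed
  define I where "I c n = (LINT t|lebesgue. m n * deriv \<sigma> (m n * (t - c)) * H t)" for c n
  define G where "G t = indicator {0..b+1} t * (exp (\<gamma> * t) * (g t + \<gamma> * F t))" for t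
  have G: "integrable lebesgue G"
  proof -
    have "set_integrable lebesgue {0..b+1} g" using ab by (intro g) auto
    moreover have "set_integrable lebesgue {0..b+1} F"
      by (rule set_integrable_lebesgue_continuous) (auto intro: continuous_on_subset[OF F])
    ultimately have "set_integrable lebesgue {0..b+1} (\<lambda>t. g t + \<gamma> * F t)"
      by (intro set_integral_add set_integrable_mult_right)
    then have 1: "integrable lebesgue (\<lambda>t. indicator {0..b+1} t * (g t + \<gamma> * F t))"
      by (simp add: set_integrable_def)
    have "exp (\<gamma> * t) \<le> exp (\<bar>\<gamma>\<bar> * (b + 1))" if "t \<in> {0..b+1}" for t
    proof -
      have "\<gamma> * t \<le> \<bar>\<gamma>\<bar> * t" using that by (intro mult_right_mono) auto
      also have "\<dots> \<le> \<bar>\<gamma>\<bar> * (b + 1)" using that by (intro mult_left_mono) auto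
      finally show ?thesis by simp
    qed
    then have bd: "norm (G t) \<le> norm (exp (\<bar>\<gamma>\<bar> * (b + 1)) * (indicator {0..b+1} t * (g t + \<gamma> * F t)))" for t
      unfolding G_def by (auto simp: indicator_def abs_mult intro!: mult_right_mono)
    have "(\<lambda>t. exp (\<gamma> * t) * (indicator {0..b+1} t * (g t + \<gamma> * F t))) \<in> borel_measurable lebesgue"
      by (intro borel_measurable_times measurable_completion borel_measurable_integrable[OF 1]) auto
    also have "(\<lambda>t. exp (\<gamma> * t) * (indicator {0..b+1} t * (g t + \<gamma> * F t))) = G"
      by (auto simp: G_def)
    finally have "G \<in> borel_measurable lebesgue" .
    then show ?thesis
      by (rule Bochner_Integration.integrable_bound[OF integrable_mult_right[OF 1]])
        (use bd in auto)
  qed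
  have Gm[measurable]: "G \<in> borel_measurable lebesgue" using G by auto
  have \<tau>m: "\<tau> n \<in> borel_measurable lebesgue" for n
    using C\<tau>[of 0 n] by (intro measurable_completion) (simp add: borel_measurable_continuous_onI)
  have \<tau>G: "integrable lebesgue (\<lambda>t. \<tau> n t * G t)" for n
    by (rule Bochner_Integration.integrable_bound[OF G])
      (use \<tau>m G \<tau>1 in \<open>auto simp: abs_mult intro!: mult_left_le_one_le borel_measurable_times\<close>)
  \<comment> \<open>The weak equation for \<open>\<phi>\<^sub>n\<close>; every integrand vanishes outside \<open>[a, b + 1]\<close>.\<close>
  have key: "I a n - I b n + (LINT t|lebesgue. \<tau> n t * G t) = 0" for n
  proof -
    have gi: "set_integrable lebesgue {0..b+1} g" using ab by (intro g) auto
    have \<phi>g: "integrable lebesgue (\<lambda>t. indicator {0<..} t * (\<phi> n t * g t))"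
    proof -
      have "integrable lebesgue (\<lambda>t. \<phi> n t * (indicator {0..b+1} t * g t))"
      proof -
        have c: "continuous_on UNIV (\<phi> n)" using C\<phi>[of 0 n] by simp
        obtain B where B: "\<And>t. t \<in> {0..b+1} \<Longrightarrow> \<bar>\<phi> n t\<bar> \<le> B"
          using compact_imp_bounded[OF compact_continuous_image[OF continuous_on_subset[OF c subset_UNIV] compact_Icc], of 0 "b+1"]
          unfolding bounded_iff by fastforce
        have gi': "integrable lebesgue (\<lambda>t. indicator {0..b+1} t * g t)"
          using gi by (simp add: set_integrable_def)
        have "\<phi> n \<in> borel_measurable lebesgue"
          using c by (intro measurable_completion) (simp add: borel_measurable_continuous_onI)
        then have "(\<lambda>t. \<phi> n t * (indicator {0..b+1} t * g t)) \<in> borel_measurable lebesgue"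
          by (intro borel_measurable_times borel_measurable_integrable[OF gi'])
        moreover have "norm (\<phi> n t * (indicator {0..b+1} t * g t)) \<le> norm (B * (indicator {0..b+1} t * g t))" for t
          using B[of t] by (auto simp: indicator_def abs_mult intro!: mult_right_mono)
        ultimately show ?thesis
          by (intro Bochner_Integration.integrable_bound[OF integrable_mult_right[OF gi', of B]]) auto
      qed
      also have "(\<lambda>t. \<phi> n t * (indicator {0..b+1} t * g t)) = (\<lambda>t. indicator {0<..} t * (\<phi> n t * g t))"
        using \<tau>0[of _ n] ab by (force simp: fun_eq_iff indicator_def \<phi>_def)
      finally show ?thesis .
    qed
    have i1: "integrable lebesgue (\<lambda>t. m n * deriv \<sigma> (m n * (t - c)) * H t)" for c
      unfolding m_def by (rule step(4))
    have e: "indicator {0<..} t * (deriv (\<phi> n) t * F t) = m n * deriv \<sigma> (m n * (t - a)) * H t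
        - m n * deriv \<sigma> (m n * (t - b)) * H t + (\<tau> n t * G t - indicator {0<..} t * (\<phi> n t * g t))" for t
    proof (cases "t > 0")
      case True
      show ?thesis
      proof (cases "t \<le> b + 1")
        case True
        with \<open>t > 0\<close> show ?thesis
          by (simp add: der H_def G_def \<phi>_def algebra_simps)
      next
        case False
        then have "\<tau> n t = 0" by (intro \<tau>0) auto
        with \<open>t > 0\<close> show ?thesis
          by (simp add: der H_def \<phi>_def algebra_simps)
      qed
    next
      case False
      then have "m n * (t - a) < 0" "m n * (t - b) < 0"
        using ab m1[of n] by (auto intro!: mult_pos_neg)
      moreover have "\<tau> n t = 0" using False ab by (intro \<tau>0) auto
      ultimately show ?thesis using False step(2) by auto
    qed
    have "(LINT t:{0<..}|lebesgue. deriv (\<phi> n) t * F t) =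
      I a n - I b n + ((LINT t|lebesgue. \<tau> n t * G t) - (LINT t:{0<..}|lebesgue. \<phi> n t * g t))"
      unfolding set_lebesgue_integral_def real_scaleR_def e I_def
      using i1 \<tau>G \<phi>g by simp
    with weak[OF test, of n] show ?thesis by simp
  qed
  have Ilim: "I c \<longlonglongrightarrow> H c" for c
    unfolding I_def[abs_def] m_def by (rule step(1))
  have Glim: "(\<lambda>n. LINT t|lebesgue. \<tau> n t * G t) \<longlonglongrightarrow> (LINT t|lebesgue. indicator {a<..b} t * G t)"
  proof (rule integral_dominated_convergence[where w="\<lambda>t. norm (G t)"])
    show "(\<lambda>t. indicator {a<..b} t * G t) \<in> borel_measurable lebesgue"
      by (intro borel_measurable_times Gm borel_measurable_indicator) auto
    show "(\<lambda>t. \<tau> n t * G t) \<in> borel_measurable lebesgue" for n using \<tau>G by auto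
    show "integrable lebesgue (\<lambda>t. norm (G t))" using G by auto
    show "AE t in lebesgue. norm (\<tau> n t * G t) \<le> norm (G t)" for n
      using \<tau>1 by (auto simp: abs_mult intro!: mult_left_le_one_le)
    have lim: "(\<lambda>n. \<sigma> (m n * (t - c))) \<longlonglongrightarrow> (if t > c then 1 else 0)" for t c
    proof (cases "t > c")
      case True
      obtain N where N: "1 / (t - c) < real N" using reals_Archimedean2 by blast
      have "\<sigma> (m n * (t - c)) = 1" if "n \<ge> N" for n
      proof (rule \<sigma>)
        have "1 / (t - c) \<le> m n" using N that by (simp add: m_def)
        then show "1 \<le> m n * (t - c)" using True by (simp add: divide_le_eq)
      qed
      then show ?thesis using True
        by (auto intro!: tendsto_eventually eventually_sequentiallyI)
    next
      case False
      then have "m n * (t - c) \<le> 0" for n using m1[of n] by (intro mult_nonneg_nonpos) auto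
      then show ?thesis using False by (simp add: \<sigma>)
    qed
    have "(\<lambda>n. \<tau> n t) \<longlonglongrightarrow> indicator {a<..b} t" for t
    proof -
      have "(\<lambda>n. \<tau> n t) \<longlonglongrightarrow> (if t > a then 1 else 0) - (if t > b then 1 else 0)"
        unfolding \<tau>_def by (intro tendsto_diff lim)
      moreover have "(if t > a then 1 else 0) - (if t > b then 1 else 0) = (indicator {a<..b} t :: real)"
        using ab by (auto simp: indicator_def)
      ultimately show ?thesis by simp
    qed
    then show "AE t in lebesgue. (\<lambda>n. \<tau> n t * G t) \<longlonglongrightarrow> indicator {a<..b} t * G t"
      by (auto intro!: tendsto_intros)
  qed
  have "(\<lambda>n. I a n - I b n + (LINT t|lebesgue. \<tau> n t * G t)) \<longlonglongrightarrow>
      H a - H b + (LINT t|lebesgue. indicator {a<..b} t * G t)"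
    by (intro tendsto_intros Ilim Glim)
  then have "H a - H b + (LINT t|lebesgue. indicator {a<..b} t * G t) = 0"
    unfolding key using LIMSEQ_unique tendsto_const by blast
  moreover have "(LINT t|lebesgue. indicator {a<..b} t * G t) =
      (LINT t:{a..b}|lebesgue. exp (\<gamma> * t) * (g t + \<gamma> * F t))"
    unfolding set_lebesgue_integral_def
  proof (rule integral_cong_AE)
    have ae: "AE t in lebesgue. t \<noteq> a"
      by (intro AE_completion AE_lborel_singleton)
    show "AE t in lebesgue. indicator {a<..b} t * G t =
        indicator {a..b} t *\<^sub>R (exp (\<gamma> * t) * (g t + \<gamma> * F t))"
      using ae by eventually_elim (use ab in \<open>auto simp: G_def indicator_def\<close>)
    have "(\<lambda>t. indicator {a..b} t * G t) \<in> borel_measurable lebesgue"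
      by (intro borel_measurable_times Gm borel_measurable_indicator) auto
    also have "(\<lambda>t. indicator {a..b} t * G t) = (\<lambda>t. indicator {a..b} t *\<^sub>R (exp (\<gamma> * t) * (g t + \<gamma> * F t)))"
      using ab by (auto simp: G_def indicator_def)
    finally show "(\<lambda>t. indicator {a..b} t *\<^sub>R (exp (\<gamma> * t) * (g t + \<gamma> * F t))) \<in> borel_measurable lebesgue" .
  qed (intro borel_measurable_times Gm borel_measurable_indicator, auto)
  ultimately show ?thesis using ab by (simp add: H_def)
qed


section \<open>Continuity of translations in \<open>L\<^sup>2\<close>\<close>

text \<open>The squared \<open>L\<^sup>2\<close> norm of \<open>f(\<cdot> + h) - f\<close>, extended real valued so that no integrability has to be
  carried along.\<close>

definition translation_defect :: "(real \<Rightarrow> 'b::real_normed_vector) \<Rightarrow> real \<Rightarrow> ennreal" where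
  "translation_defect f h = (\<integral>\<^sup>+x. ennreal ((norm (f (x + h) - f x))\<^sup>2) \<partial>lborel)"

lemma nn_integral_lborel_shift:
  fixes h :: real
  assumes "f \<in> borel_measurable borel"
  shows "(\<integral>\<^sup>+x. f (x + h) \<partial>lborel) = (\<integral>\<^sup>+x. f x \<partial>lborel)"
  using nn_integral_real_affine[OF assms, of 1 h] by (simp add: add.commute)

text \<open>The constants come from \<open>(a + b + c)\<^sup>2 \<le> 3(a\<^sup>2 + b\<^sup>2 + c\<^sup>2)\<close> and from the translation invariance of
  Lebesgue measure, by which the shifted error equals the unshifted one.\<close>

lemma translation_defect_triangle:
  fixes f g :: "real \<Rightarrow> 'b::{real_normed_vector,second_countable_topology}"
  assumes [measurable]: "f \<in> borel_measurable borel" "g \<in> borel_measurable borel"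
  shows "translation_defect f h \<le>
    6 * (\<integral>\<^sup>+x. ennreal ((norm (f x - g x))\<^sup>2) \<partial>lborel) + 3 * translation_defect g h"
proof -
  let ?d = "\<lambda>x. ennreal ((norm (f x - g x))\<^sup>2)"
  have pw: "ennreal ((norm (f (x + h) - f x))\<^sup>2) \<le>
    3 * (?d (x + h) + ennreal ((norm (g (x + h) - g x))\<^sup>2) + ?d x)" for x
  proof -
    let ?a = "norm (f (x + h) - g (x + h))" and ?b = "norm (g (x + h) - g x)" and ?c = "norm (f x - g x)"
    have "norm (f (x + h) - f x) \<le> ?a + ?b + ?c"
      using norm_triangle_ineq[of "f (x + h) - g (x + h) + (g (x + h) - g x)" "g x - f x"]
        norm_triangle_ineq[of "f (x + h) - g (x + h)" "g (x + h) - g x"]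
      by (simp add: norm_minus_commute)
    then have "(norm (f (x + h) - f x))\<^sup>2 \<le> (?a + ?b + ?c)\<^sup>2"
      by (intro power_mono) auto
    also have "\<dots> \<le> 3 * (?a\<^sup>2 + ?b\<^sup>2 + ?c\<^sup>2)"
      using sum_squares_ge_zero[of "?a - ?b" "?b - ?c"] zero_le_power2[of "?a - ?c"]
        by (simp add: power2_eq_square algebra_simps)
    finally have "ennreal ((norm (f (x + h) - f x))\<^sup>2) \<le> ennreal (3 * (?a\<^sup>2 + ?b\<^sup>2 + ?c\<^sup>2))"
      by (rule ennreal_leI)
    also have "\<dots> = 3 * (?d (x + h) + ennreal (?b\<^sup>2) + ?d x)"
      by (subst ennreal_mult') auto
    finally show ?thesis .
  qed
  have "translation_defect f h \<le>
    (\<integral>\<^sup>+x. 3 * (?d (x + h) + ennreal ((norm (g (x + h) - g x))\<^sup>2) + ?d x) \<partial>lborel)"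
    unfolding translation_defect_def by (intro nn_integral_mono pw)
  also have "\<dots> = 3 * ((\<integral>\<^sup>+x. ?d (x + h) \<partial>lborel) + translation_defect g h + (\<integral>\<^sup>+x. ?d x \<partial>lborel))"
    unfolding translation_defect_def by (simp add: nn_integral_cmult nn_integral_add)
  also have "(\<integral>\<^sup>+x. ?d (x + h) \<partial>lborel) = (\<integral>\<^sup>+x. ?d x \<partial>lborel)"
    by (rule nn_integral_lborel_shift) measurable
  also have "3 * ((\<integral>\<^sup>+x. ?d x \<partial>lborel) + translation_defect g h + (\<integral>\<^sup>+x. ?d x \<partial>lborel)) =
      (3 + 3) * (\<integral>\<^sup>+x. ?d x \<partial>lborel) + 3 * translation_defect g h"
    unfolding distrib_left distrib_right by (simp only: ac_simps)
  finally show ?thesis by simp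
qed

text \<open>Squeeze \<open>E\<close> between a compact \<open>K\<close> and an open \<open>U\<close> of almost the same measure. Shifts shorter than
  the distance from \<open>K\<close> to the complement of \<open>U\<close> keep \<open>K\<close> inside \<open>U\<close>, so a point where the two
  indicators differ lies, possibly after the shift, in \<open>E - K\<close> or \<open>U - E\<close>.\<close>

lemma indicator_translation:
  assumes E: "E \<in> sets borel" and bd: "bounded E" and "e > 0"
  obtains d where "d > 0" "\<And>h::real. \<bar>h\<bar> < d \<Longrightarrow> 
    (\<integral>\<^sup>+x. ennreal \<bar>indicator E (x + h) - indicator E x :: real\<bar> \<partial>lborel) \<le> ennreal e"
proof -
  obtain U where U: "open U" "E \<subseteq> U" "emeasure lborel (U - E) < ennreal (e/4)"
    by (rule outer_regular_lborel[OF E, of "e/4"]) (use \<open>e > 0\<close> in auto)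
  obtain K where K': "closed K" "K \<subseteq> E" "emeasure lebesgue (E - K) < ennreal (e/4)"
    by (rule sets_lebesgue_inner_closed[of E "e/4"]) (use E \<open>e > 0\<close> in auto)
  then have K: "compact K" "K \<subseteq> E" "emeasure lborel (E - K) < ennreal (e/4)"
    using bounded_subset[OF bd K'(2)] E by (simp_all add: compact_eq_bounded_closed)
  obtain d where d: "d > 0" "(\<Union>x\<in>K. ball x d) \<subseteq> U"
    by (rule compact_subset_open_imp_ball_epsilon_subset[OF K(1) U(1) subset_trans[OF K(2) U(2)]])
  have [measurable]: "E \<in> sets borel" "U \<in> sets borel" "K \<in> sets borel"
    using E U K by (auto simp: borel_compact)
  show ?thesis
  proof (rule that[OF d(1)])
    fix h :: real assume h: "\<bar>h\<bar> < d"
    have KU: "x + h \<in> U" if "x \<in> K" for x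
    proof -
      have "x + h \<in> ball x d" using h by (simp add: dist_real_def)
      then show ?thesis using d(2) that by blast
    qed
    have KU': "x \<in> U" if "x + h \<in> K" for x
    proof -
      have "x \<in> ball (x + h) d" using h by (simp add: dist_real_def)
      then show ?thesis using d(2) that by blast
    qed
    let ?g = "\<lambda>x. indicator (E - K) x + indicator (U - E) x :: ennreal"
    have "(\<integral>\<^sup>+x. ennreal \<bar>indicator E (x + h) - indicator E x :: real\<bar> \<partial>lborel) \<le>
      (\<integral>\<^sup>+x. ?g x + ?g (x + h) \<partial>lborel)"
    proof (intro nn_integral_mono)
      fix x
      consider "x \<in> E \<longleftrightarrow> x + h \<in> E" | "x \<in> E - K \<or> x \<in> U - E" "(x \<in> E) \<noteq> (x + h \<in> E)"
        | "x + h \<in> E - K \<or> x + h \<in> U - E" "(x \<in> E) \<noteq> (x + h \<in> E)"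
        using KU[of x] KU'[of x] by blast
      then show "ennreal \<bar>indicator E (x + h) - indicator E x :: real\<bar> \<le> ?g x + ?g (x + h)"
      proof cases
        case 1
        then have "\<bar>indicator E (x + h) - indicator E x :: real\<bar> = 0" by (simp add: indicator_def)
        then show ?thesis by simp
      next
        case 2
        then have "\<bar>indicator E (x + h) - indicator E x :: real\<bar> = 1" "?g x = 1"
          by (auto simp: indicator_def)
        then show ?thesis by simp
      next
        case 3
        then have "\<bar>indicator E (x + h) - indicator E x :: real\<bar> = 1" "?g (x + h) = 1"
          by (auto simp: indicator_def)
        then show ?thesis by simp
      qed
    qed
    also have "\<dots> = (\<integral>\<^sup>+x. ?g x \<partial>lborel) + (\<integral>\<^sup>+x. ?g (x + h) \<partial>lborel)"
      by (rule nn_integral_add) measurable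
    also have "(\<integral>\<^sup>+x. ?g (x + h) \<partial>lborel) = (\<integral>\<^sup>+x. ?g x \<partial>lborel)"
      by (rule nn_integral_lborel_shift) measurable
    also have "(\<integral>\<^sup>+x. ?g x \<partial>lborel) = emeasure lborel (E - K) + emeasure lborel (U - E)"
      by (subst nn_integral_add) auto
    also have "\<dots> + \<dots> \<le> (ennreal (e/4) + ennreal (e/4)) + (ennreal (e/4) + ennreal (e/4))"
      using U K by (intro add_mono) auto
    also have "\<dots> = ennreal e"
      using \<open>e > 0\<close> by (simp add: ennreal_plus[symmetric] del: ennreal_plus)
    finally show "(\<integral>\<^sup>+x. ennreal \<bar>indicator E (x + h) - indicator E x :: real\<bar> \<partial>lborel) \<le> ennreal e" .
  qed
qed


definition translation_continuous_L2 :: "(real \<Rightarrow> 'b::real_normed_vector) \<Rightarrow> bool" where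
  "translation_continuous_L2 f \<longleftrightarrow> f \<in> borel_measurable borel \<and>
     (\<forall>e>0. \<exists>d>0. \<forall>h. \<bar>h\<bar> < d \<longrightarrow> translation_defect f h \<le> ennreal e)"

lemma translation_continuous_L2_indicator:
  fixes v :: "'b::{real_normed_vector,second_countable_topology}"
  assumes E: "E \<in> sets borel" and bd: "bounded E"
  shows "translation_continuous_L2 (\<lambda>x. indicator E x *\<^sub>R v)"
  unfolding translation_continuous_L2_def
proof (intro conjI allI impI)
  show "(\<lambda>x. indicator E x *\<^sub>R v) \<in> borel_measurable borel" using E by simp
  fix e :: real assume "e > 0"
  \<comment> \<open>The summand \<open>1\<close> avoids a division by zero for \<open>v = 0\<close>.\<close>
  define c where "c = (norm v)\<^sup>2 + 1"
  have c: "c > 0" unfolding c_def by (simp add: add_nonneg_pos)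
  with \<open>e > 0\<close> have "e / c > 0" by simp
  from indicator_translation[OF E bd this] obtain d where d: "d > 0"
    "\<And>h::real. \<bar>h\<bar> < d \<Longrightarrow>
      (\<integral>\<^sup>+x. ennreal \<bar>indicator E (x + h) - indicator E x :: real\<bar> \<partial>lborel) \<le> ennreal (e / c)"
    by metis
  have "translation_defect (\<lambda>x. indicator E x *\<^sub>R v) h \<le> ennreal e" if "\<bar>h\<bar> < d" for h
  proof -
    have "translation_defect (\<lambda>x. indicator E x *\<^sub>R v) h \<le>
      (\<integral>\<^sup>+x. ennreal c * ennreal \<bar>indicator E (x + h) - indicator E x :: real\<bar> \<partial>lborel)"
      unfolding translation_defect_def
      by (intro nn_integral_mono)
        (auto simp: indicator_def c_def ennreal_mult[symmetric] simp del: ennreal_plus intro!: ennreal_leI)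
    also have "\<dots> = ennreal c * (\<integral>\<^sup>+x. ennreal \<bar>indicator E (x + h) - indicator E x :: real\<bar> \<partial>lborel)"
    proof -
      note [measurable] = E
      show ?thesis by (intro nn_integral_cmult) measurable
    qed
    also have "\<dots> \<le> ennreal c * ennreal (e / c)" by (intro mult_left_mono d that) auto
    also have "\<dots> = ennreal e" using c \<open>e > 0\<close> by (simp add: ennreal_mult[symmetric])
    finally show ?thesis .
  qed
  then show "\<exists>d>0. \<forall>h. \<bar>h\<bar> < d \<longrightarrow> translation_defect (\<lambda>x. indicator E x *\<^sub>R v) h \<le> ennreal e"
    using d(1) by blast
qed

lemma translation_continuous_L2_add:
  fixes f g :: "real \<Rightarrow> 'b::{real_normed_vector,second_countable_topology}"
  assumes f: "translation_continuous_L2 f" and g: "translation_continuous_L2 g"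
  shows "translation_continuous_L2 (\<lambda>x. f x + g x)"
  unfolding translation_continuous_L2_def
proof (intro conjI allI impI)
  have m[measurable]: "f \<in> borel_measurable borel" "g \<in> borel_measurable borel"
    using f g by (auto simp: translation_continuous_L2_def)
  show "(\<lambda>x. f x + g x) \<in> borel_measurable borel" by measurable
  fix e :: real assume "e > 0"
  then have e4: "e / 4 > 0" by simp
  obtain d1 where d1: "d1 > 0" "\<And>h. \<bar>h\<bar> < d1 \<Longrightarrow> translation_defect f h \<le> ennreal (e / 4)"
    using f e4 unfolding translation_continuous_L2_def by blast
  obtain d2 where d2: "d2 > 0" "\<And>h. \<bar>h\<bar> < d2 \<Longrightarrow> translation_defect g h \<le> ennreal (e / 4)"
    using g e4 unfolding translation_continuous_L2_def by blast
  have "translation_defect (\<lambda>x. f x + g x) h \<le> ennreal e" if h: "\<bar>h\<bar> < min d1 d2" for h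
  proof -
    have "ennreal ((norm (f (x + h) + g (x + h) - (f x + g x)))\<^sup>2) \<le>
      2 * ennreal ((norm (f (x + h) - f x))\<^sup>2) + 2 * ennreal ((norm (g (x + h) - g x))\<^sup>2)" for x
    proof -
      let ?a = "norm (f (x + h) - f x)" and ?b = "norm (g (x + h) - g x)"
      have "norm (f (x + h) + g (x + h) - (f x + g x)) \<le> ?a + ?b"
        by (metis add_diff_add norm_triangle_ineq)
      then have "(norm (f (x + h) + g (x + h) - (f x + g x)))\<^sup>2 \<le> (?a + ?b)\<^sup>2"
        by (intro power_mono) auto
      also have "\<dots> \<le> 2 * ?a\<^sup>2 + 2 * ?b\<^sup>2"
        using zero_le_power2[of "?a - ?b"] by (simp add: power2_eq_square algebra_simps)
      finally have "ennreal ((norm (f (x + h) + g (x + h) - (f x + g x)))\<^sup>2) \<le> ennreal (2 * ?a\<^sup>2 + 2 * ?b\<^sup>2)"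
        by (rule ennreal_leI)
      then show ?thesis by (simp add: ennreal_mult')
    qed
    then have "translation_defect (\<lambda>x. f x + g x) h \<le>
      (\<integral>\<^sup>+x. 2 * ennreal ((norm (f (x + h) - f x))\<^sup>2) + 2 * ennreal ((norm (g (x + h) - g x))\<^sup>2) \<partial>lborel)"
      unfolding translation_defect_def by (intro nn_integral_mono)
    also have "\<dots> = 2 * translation_defect f h + 2 * translation_defect g h"
      unfolding translation_defect_def by (simp add: nn_integral_cmult nn_integral_add)
    also have "\<dots> \<le> 2 * ennreal (e / 4) + 2 * ennreal (e / 4)"
      using h by (intro add_mono mult_left_mono d1 d2) auto
    also have "\<dots> = ennreal e"
      using \<open>e > 0\<close> by (simp add: numeral_mult_ennreal ennreal_plus[symmetric] del: ennreal_plus)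
    finally show ?thesis .
  qed
  then show "\<exists>d>0. \<forall>h. \<bar>h\<bar> < d \<longrightarrow> translation_defect (\<lambda>x. f x + g x) h \<le> ennreal e"
    using d1(1) d2(1) by (intro exI[of _ "min d1 d2"]) auto
qed

lemma translation_continuous_L2_simple:
  fixes f :: "real \<Rightarrow> 'b::{real_normed_vector,second_countable_topology}"
  assumes f: "simple_function lborel f" and supp: "\<And>x. x \<notin> {a..b} \<Longrightarrow> f x = 0"
  shows "translation_continuous_L2 f"
proof -
  have lv: "f -` {v} \<in> sets borel" for v
    using simple_functionD(2)[OF f, of "{v}"] by simp
  have fin: "finite (range f)" using simple_functionD(1)[OF f] by simp
  have one: "translation_continuous_L2 (\<lambda>x. indicator (f -` {v}) x *\<^sub>R v)" for v
  proof (cases "v = 0")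
    case True
    have "translation_continuous_L2 (\<lambda>x. indicator {} x *\<^sub>R v)"
      by (rule translation_continuous_L2_indicator) auto
    then show ?thesis using True by simp
  next
    case False
    then have "f -` {v} \<subseteq> {a..b}" using supp by force
    then show ?thesis
      by (intro translation_continuous_L2_indicator lv) (meson bounded_closed_interval bounded_subset)
  qed
  have "translation_continuous_L2 (\<lambda>x. \<Sum>v\<in>S. indicator (f -` {v}) x *\<^sub>R v)" if "finite S" for S
    using that
  proof induction
    case empty
    then show ?case using translation_continuous_L2_indicator[of "{}" 0] by simp
  next
    case (insert v S)
    show ?case unfolding sum.insert[OF insert.hyps]
      by (rule translation_continuous_L2_add[OF one insert.IH])
  qed
  from this[OF fin] have "translation_continuous_L2 (\<lambda>x. \<Sum>v\<in>range f. indicator (f -` {v}) x *\<^sub>R v)" .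
  also have "(\<lambda>x. \<Sum>v\<in>range f. indicator (f -` {v}) x *\<^sub>R v) = f"
  proof
    fix x
    have "(\<Sum>v\<in>range f. indicator (f -` {v}) x *\<^sub>R v) = (\<Sum>v\<in>range f. if v = f x then v else 0)"
      by (intro sum.cong) (auto simp: indicator_def)
    then show "(\<Sum>v\<in>range f. indicator (f -` {v}) x *\<^sub>R v) = f x" using fin by simp
  qed
  finally show ?thesis .
qed

text \<open>Simple functions dominated by \<open>2|f|\<close> converge to \<open>f\<close> in \<open>L\<^sup>2\<close> by dominated convergence, and for them the
  claim reduces to indicators of bounded sets.\<close>

lemma translation_continuous_L2_compact_support:
  fixes f :: "real \<Rightarrow> 'b::{real_normed_vector,second_countable_topology}"
  assumes f[measurable]: "f \<in> borel_measurable borel" and supp: "\<And>x. x \<notin> {a..b} \<Longrightarrow> f x = 0"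
    and sq: "(\<integral>\<^sup>+x. ennreal ((norm (f x))\<^sup>2) \<partial>lborel) < \<infinity>"
  shows "translation_continuous_L2 f"
  unfolding translation_continuous_L2_def
proof (intro conjI allI impI f)
  fix e :: real assume "e > 0"
  have "f \<in> borel_measurable lborel" by simp
  from borel_measurable_implies_sequence_metric[OF this, of 0]
  obtain s where s0: "(\<forall>i. simple_function lborel (s i)) \<and> (\<forall>x\<in>space lborel. (\<lambda>i. s i x) \<longlonglongrightarrow> f x) \<and>
      (\<forall>i. \<forall>x\<in>space lborel. dist (s i x) 0 \<le> 2 * dist (f x) 0)"
    by (rule exE)
  then have s: "simple_function lborel (s i)" "(\<lambda>i. s i x) \<longlonglongrightarrow> f x"
    "norm (s i x) \<le> 2 * norm (f x)" for i x
    by simp_all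
  have [measurable]: "s i \<in> borel_measurable borel" for i
    using borel_measurable_simple_function[OF s(1)] by simp
  have "(\<lambda>i. \<integral>\<^sup>+x. ennreal ((norm (f x - s i x))\<^sup>2) \<partial>lborel) \<longlonglongrightarrow> (\<integral>\<^sup>+x. 0 \<partial>(lborel :: real measure))"
  proof (rule nn_integral_dominated_convergence[where w="\<lambda>x. 9 * ennreal ((norm (f x))\<^sup>2)"])
    show "AE x in lborel. ennreal ((norm (f x - s i x))\<^sup>2) \<le> 9 * ennreal ((norm (f x))\<^sup>2)" for i
    proof (intro AE_I2)
      fix x
      have "norm (f x - s i x) \<le> 3 * norm (f x)"
        using norm_triangle_ineq4[of "f x" "s i x"] s(3)[of i x] by simp
      then have "(norm (f x - s i x))\<^sup>2 \<le> (3 * norm (f x))\<^sup>2" by (intro power_mono) auto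
      then have "ennreal ((norm (f x - s i x))\<^sup>2) \<le> ennreal (9 * (norm (f x))\<^sup>2)"
        by (intro ennreal_leI) (simp add: power_mult_distrib)
      then show "ennreal ((norm (f x - s i x))\<^sup>2) \<le> 9 * ennreal ((norm (f x))\<^sup>2)"
        by (simp add: ennreal_mult')
    qed
    show "(\<integral>\<^sup>+x. 9 * ennreal ((norm (f x))\<^sup>2) \<partial>lborel) < \<infinity>"
      using sq by (simp add: nn_integral_cmult ennreal_mult_less_top)
    show "AE x in lborel. (\<lambda>i. ennreal ((norm (f x - s i x))\<^sup>2)) \<longlonglongrightarrow> 0"
    proof (intro AE_I2)
      fix x
      have "(\<lambda>i. ennreal ((norm (f x - s i x))\<^sup>2)) \<longlonglongrightarrow> ennreal ((norm (f x - f x))\<^sup>2)"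
        by (intro tendsto_intros s)
      then show "(\<lambda>i. ennreal ((norm (f x - s i x))\<^sup>2)) \<longlonglongrightarrow> 0" by simp
    qed
  qed measurable
  then have "(\<lambda>i. \<integral>\<^sup>+x. ennreal ((norm (f x - s i x))\<^sup>2) \<partial>lborel) \<longlonglongrightarrow> 0" by simp
  moreover have "ennreal (e / 12) > 0" using \<open>e > 0\<close> by simp
  ultimately have "eventually (\<lambda>i. (\<integral>\<^sup>+x. ennreal ((norm (f x - s i x))\<^sup>2) \<partial>lborel) < ennreal (e / 12)) sequentially"
    by (rule order_tendstoD)
  then obtain i where i: "(\<integral>\<^sup>+x. ennreal ((norm (f x - s i x))\<^sup>2) \<partial>lborel) < ennreal (e / 12)"
    unfolding eventually_sequentially by blast
  have "s i x = 0" if "x \<notin> {a..b}" for x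
    using s(3)[of i x] supp[OF that] by simp
  then have "translation_continuous_L2 (s i)"
    by (rule translation_continuous_L2_simple[OF s(1)])
  moreover have "e / 6 > 0" using \<open>e > 0\<close> by simp
  ultimately obtain d where d: "d > 0" "\<And>h. \<bar>h\<bar> < d \<Longrightarrow> translation_defect (s i) h \<le> ennreal (e / 6)"
    unfolding translation_continuous_L2_def by blast
  have "translation_defect f h \<le> ennreal e" if "\<bar>h\<bar> < d" for h
  proof -
    have "translation_defect f h \<le> 6 * (\<integral>\<^sup>+x. ennreal ((norm (f x - s i x))\<^sup>2) \<partial>lborel) + 3 * translation_defect (s i) h"
      by (rule translation_defect_triangle) measurable
    also have "\<dots> \<le> 6 * ennreal (e / 12) + 3 * ennreal (e / 6)"
      using i by (intro add_mono mult_left_mono d that) auto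
    also have "\<dots> = ennreal e"
      using \<open>e > 0\<close> by (simp add: numeral_mult_ennreal ennreal_plus[symmetric] del: ennreal_plus)
    finally show ?thesis .
  qed
  then show "\<exists>d>0. \<forall>h. \<bar>h\<bar> < d \<longrightarrow> translation_defect f h \<le> ennreal e" using d(1) by blast
qed


section \<open>Measurability and Fubini for pairings with the dual\<close>

text \<open>A Borel version can be shifted inside a product measure, where composition of a merely Lebesgue
  measurable function with \<open>(q, p) \<mapsto> q + p\<close> need not be measurable.\<close>

lemma lebesgue_measurable_borel_version:
  fixes f :: "real \<Rightarrow> 'b::{banach,second_countable_topology}"
  assumes f: "f \<in> borel_measurable lebesgue"
  obtains f' where "f' \<in> borel_measurable borel" "AE x in lebesgue. f x = f' x"
proof -
  from borel_measurable_implies_sequence_metric[OF f, of 0]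
  obtain F where "(\<forall>i. simple_function lebesgue (F i)) \<and>
      (\<forall>x\<in>space lebesgue. (\<lambda>i. F i x) \<longlonglongrightarrow> f x) \<and>
      (\<forall>i. \<forall>x\<in>space lebesgue. dist (F i x) 0 \<le> 2 * dist (f x) 0)"
    by (rule exE)
  then have F: "simple_function lebesgue (F i)" "(\<lambda>i. F i x) \<longlonglongrightarrow> f x" for i x
    by simp_all
  have "\<exists>g. simple_function lborel g \<and> (AE x in lborel. F i x = g x)" for i
    by (rule completion_ex_simple_function[OF F(1)])
  then obtain g where g: "\<And>i. simple_function lborel (g i)" "\<And>i. AE x in lborel. F i x = g i x"
    by metis
  have [measurable]: "g i \<in> borel_measurable borel" for i
    using borel_measurable_simple_function[OF g(1)] by simp
  have "AE x in lborel. \<forall>i. F i x = g i x" using g(2) by (simp add: AE_all_countable)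
  then have "AE x in lborel. f x = lim (\<lambda>i. g i x)"
  proof eventually_elim
    case (elim x)
    then have "(\<lambda>i. g i x) \<longlonglongrightarrow> f x" using F(2)[of x] by simp
    then show ?case by (simp add: limI)
  qed
  then have "AE x in lebesgue. f x = lim (\<lambda>i. g i x)" by (rule AE_completion)
  moreover have "(\<lambda>x. lim (\<lambda>i. g i x)) \<in> borel_measurable borel" by measurable
  ultimately show ?thesis using that by blast
qed

text \<open>Approximating \<open>g\<close> by simple functions reduces the pairing to fixed vectors \<open>v\<close>. This keeps all later
  arguments at the level of weak measurability, which passes to sums and products without any
  separability of the dual.\<close>

lemma borel_measurable_blinfun_apply_weak:
  fixes F :: "'a \<Rightarrow> 'v::{real_normed_vector,second_countable_topology} \<Rightarrow>\<^sub>L real"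
  assumes F: "\<And>v. (\<lambda>x. F x v) \<in> borel_measurable M" and g: "g \<in> borel_measurable M"
  shows "(\<lambda>x. F x (g x)) \<in> borel_measurable M"
proof -
  from borel_measurable_implies_sequence_metric[OF g, of 0]
  obtain s where "(\<forall>i. simple_function M (s i)) \<and> (\<forall>x\<in>space M. (\<lambda>i. s i x) \<longlonglongrightarrow> g x) \<and>
      (\<forall>i. \<forall>x\<in>space M. dist (s i x) 0 \<le> 2 * dist (g x) 0)"
    by (rule exE)
  then have s: "simple_function M (s i)" "x \<in> space M \<Longrightarrow> (\<lambda>i. s i x) \<longlonglongrightarrow> g x" for i x
    by simp_all
  show ?thesis
  proof (rule borel_measurable_LIMSEQ_real)
    show "(\<lambda>i. F x (s i x)) \<longlonglongrightarrow> F x (g x)" if "x \<in> space M" for x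
      by (intro blinfun.tendsto tendsto_const s that)
    show "(\<lambda>x. F x (s i x)) \<in> borel_measurable M" for i
    proof -
      have fin: "finite (s i ` space M)" using s(1) by (rule simple_functionD)
      have [measurable]: "s i -` {v} \<inter> space M \<in> sets M" for v
        by (rule simple_functionD(2)[OF s(1)])
      have "(\<lambda>x. \<Sum>v\<in>s i ` space M. indicator (s i -` {v} \<inter> space M) x * F x v) \<in> borel_measurable M"
        using F by (intro borel_measurable_sum borel_measurable_times) auto
      also have "?this \<longleftrightarrow> ?thesis"
      proof (rule measurable_cong)
        fix x assume x: "x \<in> space M"
        have "(\<Sum>v\<in>s i ` space M. indicator (s i -` {v} \<inter> space M) x * F x v) =
          (\<Sum>v\<in>s i ` space M. if v = s i x then F x v else 0)"
          using x by (intro sum.cong) (auto simp: indicator_def)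
        also have "\<dots> = F x (s i x)" using fin x by simp
        finally show "(\<Sum>v\<in>s i ` space M. indicator (s i -` {v} \<inter> space M) x * F x v) = F x (s i x)" .
      qed
      finally show ?thesis .
    qed
  qed
qed

lemma sigma_finite_lebesgue: "sigma_finite_measure (lebesgue :: 'a::euclidean_space measure)"
proof (rule sigma_finite_measure.intro)
  have "\<exists>A::'a set set. countable A \<and> A \<subseteq> sets lborel \<and> \<Union>A = space lborel \<and>
      (\<forall>a\<in>A. emeasure lborel a \<noteq> \<infinity>)"
    using lborel.sigma_finite_measure_axioms unfolding sigma_finite_measure_def .
  then obtain A :: "'a set set" where A: "countable A \<and> A \<subseteq> sets lborel \<and> \<Union>A = space lborel \<and>
      (\<forall>a\<in>A. emeasure lborel a \<noteq> \<infinity>)"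
    by (rule exE)
  have "A \<subseteq> sets lebesgue" "\<forall>a\<in>A. emeasure lebesgue a \<noteq> \<infinity>"
    using A sets_completionI_sets[of _ lborel] by (auto simp: subset_iff)
  then show "\<exists>A::'a set set. countable A \<and> A \<subseteq> sets lebesgue \<and> \<Union>A = space lebesgue \<and>
      (\<forall>a\<in>A. emeasure lebesgue a \<noteq> \<infinity>)"
    using A by (intro exI[of _ A]) simp
qed

lemma (in pair_sigma_finite) integrable_product_mult:
  fixes f :: "'a \<Rightarrow> real" and g :: "'b \<Rightarrow> real"
  assumes f: "integrable M1 f" and g: "integrable M2 g"
  shows "integrable (M1 \<Otimes>\<^sub>M M2) (\<lambda>(x, y). f x * g y)"
proof (rule Fubini_integrable)
  show "(\<lambda>(x, y). f x * g y) \<in> borel_measurable (M1 \<Otimes>\<^sub>M M2)"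
    unfolding split_beta
    by (intro borel_measurable_times measurable_compose[OF measurable_fst borel_measurable_integrable[OF f]]
        measurable_compose[OF measurable_snd borel_measurable_integrable[OF g]])
  show "integrable M1 (\<lambda>x. LINT y|M2. norm (case (x, y) of (x, y) \<Rightarrow> f x * g y))"
    using f g by (simp add: abs_mult)
  show "AE x in M1. integrable M2 (\<lambda>y. case (x, y) of (x, y) \<Rightarrow> f x * g y)"
    using g by simp
qed

text \<open>Fubini in the variables \<open>(q, r)\<close>, the substitution \<open>r = q + p\<close> for fixed \<open>q\<close>, and Fubini in the
  variables \<open>(q, p)\<close>.\<close>

lemma shear_Fubini:
  fixes k :: "real \<Rightarrow> real \<Rightarrow> real"
  assumes int: "integrable (lebesgue \<Otimes>\<^sub>M lborel) (\<lambda>(q, r). k q r)"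
    and meas: "(\<lambda>(q, p). k q (q + p)) \<in> borel_measurable (lebesgue \<Otimes>\<^sub>M lborel)"
  shows "(LINT r|lborel. LINT q|lebesgue. k q r) = (LINT p|lborel. LINT q|lebesgue. k q (q + p))"
    and "integrable lborel (\<lambda>p. LINT q|lebesgue. k q (q + p))"
proof -
  interpret L: sigma_finite_measure "lebesgue :: real measure" by (rule sigma_finite_lebesgue)
  interpret P: pair_sigma_finite "lebesgue :: real measure" "lborel :: real measure" ..
  have int': "integrable (lebesgue \<Otimes>\<^sub>M lborel) (\<lambda>(q, p). k q (q + p))"
  proof (rule P.Fubini_integrable[OF meas])
    have "(LINT r|lborel. norm (k q r)) = (LINT p|lborel. norm (k q (q + p)))" for q
      by (subst lborel_integral_real_affine[of 1 _ q]) simp_all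
    then show "integrable lebesgue (\<lambda>q. LINT p|lborel. norm (case (q, p) of (q, p) \<Rightarrow> k q (q + p)))"
      using P.integrable_fst'[OF integrable_norm[OF int]] by (simp only: prod.case)
    have "AE q in lebesgue. integrable lborel (k q)"
      using P.AE_integrable_fst[OF int] by (simp only: prod.case)
    then show "AE q in lebesgue. integrable lborel (\<lambda>p. case (q, p) of (q, p) \<Rightarrow> k q (q + p))"
    proof eventually_elim
      case (elim q)
      from lborel_integrable_real_affine[OF this, of 1 q] show ?case by simp
    qed
  qed
  have "(LINT r|lborel. LINT q|lebesgue. k q r) = (LINT q|lebesgue. LINT r|lborel. k q r)"
    by (rule P.Fubini_integral[OF int])
  also have "\<dots> = (LINT q|lebesgue. LINT p|lborel. k q (q + p))"
    by (subst lborel_integral_real_affine[of 1 "k q" q for q]) simp_all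
  also have "\<dots> = (LINT p|lborel. LINT q|lebesgue. k q (q + p))"
    by (rule P.Fubini_integral[OF int', symmetric])
  finally show "(LINT r|lborel. LINT q|lebesgue. k q r) = (LINT p|lborel. LINT q|lebesgue. k q (q + p))" .
  show "integrable lborel (\<lambda>p. LINT q|lebesgue. k q (q + p))"
    using P.integrable_snd[OF int'] .
qed


section \<open>The energy inequality\<close>

text \<open>By Young's inequality \<open>N d \<le> c N\<^sup>2 + d\<^sup>2 / c\<close>, where \<open>d\<close> is the size of \<open>Y(q + p) - Y(q)\<close>. First \<open>c\<close> is
  taken small, then the shift \<open>p\<close>.\<close>

lemma pairing_translation_continuous:
  fixes F :: "real \<Rightarrow> 'v::{real_normed_vector,second_countable_topology} \<Rightarrow>\<^sub>L real"
  assumes F: "\<And>v. (\<lambda>q. F q v) \<in> borel_measurable lebesgue"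
    and N: "N \<in> borel_measurable lebesgue" "integrable lebesgue (\<lambda>q. (N q)\<^sup>2)"
    and FN: "\<And>q. norm (F q) \<le> N q"
    and Y: "translation_continuous_L2 Y" "(\<integral>\<^sup>+x. ennreal ((norm (Y x))\<^sup>2) \<partial>lborel) < \<infinity>"
    and "e > 0"
  obtains d where "d > 0"
    "\<And>p. \<bar>p\<bar> < d \<Longrightarrow> \<bar>(LINT q|lebesgue. F q (Y (q + p))) - (LINT q|lebesgue. F q (Y q))\<bar> \<le> e"
proof -
  have Yb[measurable]: "Y \<in> borel_measurable borel" using Y(1) by (simp add: translation_continuous_L2_def)
  have N0: "N q \<ge> 0" for q using FN[of q] norm_ge_zero order_trans by blast
  have Ysh: "(\<lambda>q. Y (q + p)) \<in> borel_measurable lebesgue" for p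
    by (rule measurable_completion) measurable
  have m: "(\<lambda>q. F q (Z q)) \<in> borel_measurable lebesgue" if "Z \<in> borel_measurable lebesgue" for Z
    by (rule borel_measurable_blinfun_apply_weak[OF F that])
  have sq: "integrable lebesgue (\<lambda>q. (norm (Z q))\<^sup>2)"
    if "Z \<in> borel_measurable borel" "(\<integral>\<^sup>+x. ennreal ((norm (Z x))\<^sup>2) \<partial>lborel) < \<infinity>" for Z :: "real \<Rightarrow> 'v"
  proof (rule integrableI_bounded)
    have [measurable]: "Z \<in> borel_measurable borel" by fact
    show "(\<lambda>q. (norm (Z q))\<^sup>2) \<in> borel_measurable lebesgue"
      by (rule measurable_completion) measurable
    show "(\<integral>\<^sup>+x. ennreal (norm ((norm (Z x))\<^sup>2)) \<partial>lebesgue) < \<infinity>"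
      using that(2) by (simp add: nn_integral_completion)
  qed
  have Ysq: "integrable lebesgue (\<lambda>q. (norm (Y (q + p)))\<^sup>2)" for p
  proof (rule sq)
    have "(\<integral>\<^sup>+x. ennreal ((norm (Y (x + p)))\<^sup>2) \<partial>lborel) = (\<integral>\<^sup>+x. ennreal ((norm (Y x))\<^sup>2) \<partial>lborel)"
      by (rule nn_integral_lborel_shift[where f="\<lambda>x. ennreal ((norm (Y x))\<^sup>2)"]) measurable
    then show "(\<integral>\<^sup>+x. ennreal ((norm (Y (x + p)))\<^sup>2) \<partial>lborel) < \<infinity>" using Y(2) by simp
  qed measurable
  have FYint: "integrable lebesgue (\<lambda>q. F q (Y (q + p)))" for p
  proof (rule Bochner_Integration.integrable_bound[OF Bochner_Integration.integrable_add[OF N(2) Ysq[of p]]])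
    show "(\<lambda>q. F q (Y (q + p))) \<in> borel_measurable lebesgue" by (intro m Ysh)
    have "\<bar>F q (Y (q + p))\<bar> \<le> (N q)\<^sup>2 + (norm (Y (q + p)))\<^sup>2" for q
    proof -
      have "\<bar>F q (Y (q + p))\<bar> \<le> norm (F q) * norm (Y (q + p))"
        using norm_blinfun[of "F q" "Y (q + p)"] by simp
      also have "\<dots> \<le> N q * norm (Y (q + p))" by (intro mult_right_mono FN) auto
      also have "\<dots> \<le> (N q)\<^sup>2 + (norm (Y (q + p)))\<^sup>2"
      proof -
        have "2 * N q * norm (Y (q + p)) \<le> (N q)\<^sup>2 + (norm (Y (q + p)))\<^sup>2" by (rule sum_squares_bound)
        moreover have "0 \<le> N q * norm (Y (q + p))" using N0[of q] by simp
        ultimately show ?thesis by linarith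
      qed
      finally show ?thesis .
    qed
    then show "AE q in lebesgue. norm (F q (Y (q + p))) \<le> norm ((N q)\<^sup>2 + (norm (Y (q + p)))\<^sup>2)"
      by simp
  qed
  define I where "I = (LINT q|lebesgue. (N q)\<^sup>2)"
  have I: "I \<ge> 0" unfolding I_def by (intro Bochner_Integration.integral_nonneg) auto
  \<comment> \<open>This makes \<open>c I \<le> e/2\<close>; a defect of at most \<open>c e / 2\<close> then costs another \<open>e/2\<close>.\<close>
  define c where "c = e / (2 * (I + 1))"
  have c: "c > 0" using \<open>e > 0\<close> I by (simp add: c_def)
  have cI: "c * I \<le> e / 2" using \<open>e > 0\<close> I by (simp add: c_def field_simps)
  have "c * e / 2 > 0" using c \<open>e > 0\<close> by simp
  then obtain d where d: "d > 0" "\<And>h. \<bar>h\<bar> < d \<Longrightarrow> translation_defect Y h \<le> ennreal (c * e / 2)"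
    using Y(1) unfolding translation_continuous_L2_def by blast
  show ?thesis
  proof (rule that[OF d(1)])
    fix p assume p: "\<bar>p\<bar> < d"
    let ?D = "\<lambda>q. (norm (Y (q + p) - Y q))\<^sup>2"
    have Dn: "(\<integral>\<^sup>+q. ennreal (?D q) \<partial>lborel) \<le> ennreal (c * e / 2)"
      using d(2)[OF p] by (simp add: translation_defect_def)
    have Di: "integrable lebesgue ?D"
    proof (rule sq)
      show "(\<integral>\<^sup>+q. ennreal (?D q) \<partial>lborel) < \<infinity>"
        using le_less_trans[OF Dn ennreal_less_top] by simp
    qed measurable
    have DI: "(LINT q|lebesgue. ?D q) \<le> c * e / 2"
    proof (rule integral_real_bounded)
      show "0 \<le> c * e / 2" using c \<open>e > 0\<close> by simp
      show "(\<integral>\<^sup>+q. ennreal (?D q) \<partial>lebesgue) \<le> ennreal (c * e / 2)"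
        using Dn by (simp only: nn_integral_completion)
    qed
    have "\<bar>(LINT q|lebesgue. F q (Y (q + p))) - (LINT q|lebesgue. F q (Y q))\<bar>
      = \<bar>LINT q|lebesgue. F q (Y (q + p)) - F q (Y q)\<bar>"
      using FYint[of p] FYint[of 0] by simp
    also have "\<dots> \<le> (LINT q|lebesgue. c * (N q)\<^sup>2 + (1 / c) * ?D q)"
    proof (rule integral_abs_bound_integral)
      show "integrable lebesgue (\<lambda>q. F q (Y (q + p)) - F q (Y q))"
        using FYint[of p] FYint[of 0] by simp
      show "integrable lebesgue (\<lambda>q. c * (N q)\<^sup>2 + (1 / c) * ?D q)"
        using N(2) Di by simp
      fix q
      have "\<bar>F q (Y (q + p)) - F q (Y q)\<bar> \<le> norm (F q) * norm (Y (q + p) - Y q)"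
        using norm_blinfun[of "F q" "Y (q + p) - Y q"]
        unfolding blinfun.diff_right real_norm_def .
      also have "\<dots> \<le> N q * norm (Y (q + p) - Y q)" by (intro mult_right_mono FN) auto
      also have "\<dots> \<le> c * (N q)\<^sup>2 + (1 / c) * ?D q"
      proof -
        have "2 * (sqrt c * N q) * (norm (Y (q + p) - Y q) / sqrt c)
            \<le> (sqrt c * N q)\<^sup>2 + (norm (Y (q + p) - Y q) / sqrt c)\<^sup>2"
          by (rule sum_squares_bound)
        then have "2 * (N q * norm (Y (q + p) - Y q)) \<le> c * (N q)\<^sup>2 + (1 / c) * ?D q"
          using c by (simp add: power_mult_distrib power_divide)
        moreover have "0 \<le> N q * norm (Y (q + p) - Y q)" using N0 by simp
        ultimately show ?thesis by linarith
      qed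
      finally show "\<bar>F q (Y (q + p)) - F q (Y q)\<bar> \<le> c * (N q)\<^sup>2 + (1 / c) * ?D q" .
    qed
    also have "\<dots> = c * I + (1 / c) * (LINT q|lebesgue. ?D q)"
      using N(2) Di by (simp add: I_def)
    also have "\<dots> \<le> e / 2 + (1 / c) * (c * e / 2)"
      by (intro add_mono cI mult_left_mono DI) (use c in auto)
    also have "\<dots> = e" using c by simp
    finally show "\<bar>(LINT q|lebesgue. F q (Y (q + p))) - (LINT q|lebesgue. F q (Y q))\<bar> \<le> e" .
  qed
qed

text \<open>After a shift of the second term, the integral is that of \<open>E\<close> over \<open>[t - h, t]\<close> minus that over
  \<open>[s - h, s]\<close>, and \<open>E\<close> is nearly constant on both.\<close>

lemma integral_difference_quotient_lower:
  fixes E :: "real \<Rightarrow> real"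
  assumes E: "continuous_on {0..} E" and st: "0 < s" "s < t" and "e > 0"
  obtains d where "d > 0" "\<And>h. 0 < h \<Longrightarrow> h < d \<Longrightarrow> h < s \<Longrightarrow>
    h * (E t - E s - e) \<le> (LINT r:{s..t}|lborel. E r - E (r - h))"
proof -
  have cont: "isCont E x" if "x > 0" for x
    using E that by (intro continuous_on_interior[OF E]) (simp add: interior_Ici[of "-1"])
  have loc: "\<exists>d>0. \<forall>x. \<bar>x - a\<bar> < d \<longrightarrow> \<bar>E x - E a\<bar> < e / 2" if "a > 0" for a
  proof -
    have "(E \<longlongrightarrow> E a) (at a)" using cont[OF that] by (simp add: isCont_def)
    then have "eventually (\<lambda>x. dist (E x) (E a) < e / 2) (at a)"
      using \<open>e > 0\<close> by (intro tendstoD) auto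
    then obtain d where "d > 0" "\<And>x. x \<noteq> a \<Longrightarrow> dist x a < d \<Longrightarrow> dist (E x) (E a) < e / 2"
      unfolding eventually_at by blast
    moreover have "dist (E a) (E a) < e / 2" using \<open>e > 0\<close> by simp
    ultimately show ?thesis unfolding dist_real_def by metis
  qed
  have "t > 0" using st by simp
  obtain d1 where d1: "d1 > 0" "\<forall>x. \<bar>x - t\<bar> < d1 \<longrightarrow> \<bar>E x - E t\<bar> < e / 2"
    using loc[OF \<open>t > 0\<close>] by (elim exE conjE)
  obtain d2 where d2: "d2 > 0" "\<forall>x. \<bar>x - s\<bar> < d2 \<longrightarrow> \<bar>E x - E s\<bar> < e / 2"
    using loc[OF \<open>0 < s\<close>] by (elim exE conjE)
  show ?thesis
  proof (rule that[of "min (min d1 d2) (t - s)"])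
    show "min (min d1 d2) (t - s) > 0" using d1 d2 st by simp
    fix h assume h: "0 < h" "h < min (min d1 d2) (t - s)" "h < s"
    have c: "continuous_on {a..b} E" if "0 \<le> a" for a b
      by (rule continuous_on_subset[OF E]) (use that in auto)
    have i: "E integrable_on {a..b}" if "0 \<le> a" for a b
      by (intro integrable_continuous_interval c that)
    have csh: "continuous_on {s..t} (\<lambda>r. E (r - h))"
      by (rule continuous_on_compose2[OF E]) (use h in \<open>auto intro!: continuous_intros\<close>)
    have "(LINT r:{s..t}|lborel. E r - E (r - h)) = integral {s..t} (\<lambda>r. E r - E (r - h))"
      unfolding set_lebesgue_integral_def
      by (rule set_borel_integral_eq_integral(2)[unfolded set_lebesgue_integral_def])
        (unfold set_integrable_def, rule borel_integrable_compact,
          use st in \<open>auto intro!: continuous_intros c csh\<close>)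
    also have "\<dots> = integral {s..t} E - integral {s..t} (\<lambda>r. E (r - h))"
      by (intro Henstock_Kurzweil_Integration.integral_diff i integrable_continuous_interval csh) (use st in auto)
    also have "integral {s..t} (\<lambda>r. E (r - h)) = integral {s-h..t-h} E"
      using integral_shift_real_ivl[of s h t "\<lambda>r. E (r - h)"] by simp
    also have "integral {s..t} E = integral {s..t-h} E + integral {t-h..t} E"
      by (rule Henstock_Kurzweil_Integration.integral_combine[symmetric]) (use h st i in auto)
    also have "integral {s-h..t-h} E = integral {s-h..s} E + integral {s..t-h} E"
      by (rule Henstock_Kurzweil_Integration.integral_combine[symmetric]) (use h st i in auto)
    finally have L: "(LINT r:{s..t}|lborel. E r - E (r - h)) = integral {t-h..t} E - integral {s-h..s} E"
      by simp
    have "integral {t-h..t} (\<lambda>_. E t - e / 2) \<le> integral {t-h..t} E"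
    proof (rule integral_le)
      fix x assume "x \<in> {t-h..t}"
      then have "\<bar>x - t\<bar> < d1" using h by auto
      then have "\<bar>E x - E t\<bar> < e / 2" using d1(2) by blast
      then show "E t - e / 2 \<le> E x" by linarith
    qed (use h st i in auto)
    moreover have "integral {s-h..s} E \<le> integral {s-h..s} (\<lambda>_. E s + e / 2)"
    proof (rule integral_le)
      fix x assume "x \<in> {s-h..s}"
      then have "\<bar>x - s\<bar> < d2" using h by auto
      then have "\<bar>E x - E s\<bar> < e / 2" using d2(2) by blast
      then show "E x \<le> E s + e / 2" by linarith
    qed (use h st i in auto)
    ultimately show "h * (E t - E s - e) \<le> (LINT r:{s..t}|lborel. E r - E (r - h))"
      unfolding L using h by (simp add: algebra_simps)
  qed
qed


text \<open>For almost every \<open>r\<close> the value \<open>u(r)\<close> comes from the \<open>V\<close>-valued version \<open>Y(r)\<close>, so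
  \<open>|u(r)|\<^sup>2 - |u(r - h)|\<^sup>2 \<le> 2 (u(r) - u(r - h), u(r))\<close> and the increment of \<open>u\<close> may be tested with \<open>Y(r)\<close>.
  The region \<open>r - h \<le> q \<le> r\<close> of integration is sheared to \<open>0 \<le> p \<le> h\<close>.\<close>

lemma steklov_energy_bound:
  fixes u :: "real \<Rightarrow> 'h::real_inner"
    and F :: "real \<Rightarrow> 'v::{real_normed_vector,second_countable_topology} \<Rightarrow>\<^sub>L real"
    and j :: "'v \<Rightarrow>\<^sub>L 'h"
  assumes u: "continuous_on {0..} u"
    and Y: "Y \<in> borel_measurable borel" "integrable lborel (\<lambda>r. norm (Y r))"
      "AE r in lborel. s \<le> r \<and> r \<le> t \<longrightarrow> j (Y r) = u r" "\<And>r. r \<notin> {s..t} \<Longrightarrow> Y r = 0"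
    and F: "\<And>v. (\<lambda>q. F q v) \<in> borel_measurable lebesgue" "\<And>q. norm (F q) \<le> N q"
      "integrable lebesgue N"
    and inc: "\<And>v a b. 0 < a \<Longrightarrow> a \<le> b \<Longrightarrow> b \<le> t \<Longrightarrow>
      inner (u b - u a) (j v) = (LINT q:{a..b}|lebesgue. F q v)"
    and h: "0 < h" "h < s" "s \<le> t"
  shows "(LINT r:{s..t}|lborel. (norm (u r))\<^sup>2 - (norm (u (r - h)))\<^sup>2) \<le>
    2 * (LINT p:{0..h}|lborel. LINT q|lebesgue. F q (Y (q + p)))"
    and "set_integrable lborel {0..h} (\<lambda>p. LINT q|lebesgue. F q (Y (q + p)))"
proof -
  interpret L: sigma_finite_measure "lebesgue :: real measure" by (rule sigma_finite_lebesgue)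
  interpret P: pair_sigma_finite "lebesgue :: real measure" "lborel :: real measure" ..
  let ?M = "lebesgue \<Otimes>\<^sub>M lborel :: (real \<times> real) measure"
  \<comment> \<open>The indicator restricts \<open>q\<close> to \<open>[r - h, r]\<close> and depends only on \<open>r - q\<close>.\<close>
  define k where "k q r = indicator {0..h} (r - q) * F q (Y r)" for q r
  have Yb[measurable]: "Y \<in> borel_measurable borel" by fact
  have idm: "(\<lambda>x. x) \<in> borel_measurable (lebesgue :: real measure)"
    by (rule measurable_completion) simp
  have fstm[measurable]: "(\<lambda>x. fst x) \<in> borel_measurable ?M"
    by (rule measurable_compose[OF measurable_fst idm])
  have sndm[measurable]: "(\<lambda>x. snd x) \<in> borel_measurable ?M"
    using measurable_snd[of lebesgue lborel] by simp
  have FM: "(\<lambda>x. F (fst x) (Z x)) \<in> borel_measurable ?M" if "Z \<in> borel_measurable ?M" for Z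
    by (rule borel_measurable_blinfun_apply_weak[OF measurable_compose[OF measurable_fst F(1)] that])
  have YM: "(\<lambda>x. Y (snd x)) \<in> borel_measurable ?M"
    by measurable
  have YM': "(\<lambda>x. Y (fst x + snd x)) \<in> borel_measurable ?M"
    by measurable
  have km: "(\<lambda>(q, r). k q r) \<in> borel_measurable ?M"
    unfolding k_def split_beta by (intro borel_measurable_times FM YM) measurable
  have km': "(\<lambda>(q, p). k q (q + p)) \<in> borel_measurable ?M"
    unfolding k_def split_beta by (intro borel_measurable_times FM YM') measurable
  have N0: "N q \<ge> 0" for q using F(2)[of q] norm_ge_zero order_trans by blast
  have kb: "\<bar>k q r\<bar> \<le> N q * norm (Y r)" for q r
  proof -
    have "\<bar>F q (Y r)\<bar> \<le> norm (F q) * norm (Y r)"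
      using norm_blinfun[of "F q" "Y r"] by simp
    also have "\<dots> \<le> N q * norm (Y r)" by (intro mult_right_mono F) auto
    finally show ?thesis using N0[of q] by (simp add: k_def indicator_def)
  qed
  have prod: "integrable ?M (\<lambda>(q, r). N q * norm (Y r))"
    by (rule P.integrable_product_mult[OF F(3) Y(2)])
  have kint: "integrable ?M (\<lambda>(q, r). k q r)"
    by (rule Bochner_Integration.integrable_bound[OF prod km]) (use kb N0 in \<open>auto simp: abs_mult\<close>)
  have shift: "(LINT q|lebesgue. k q (q + p)) = indicator {0..h} p * (LINT q|lebesgue. F q (Y (q + p)))" for p
    by (simp add: k_def)
  have shear: "(LINT r|lborel. LINT q|lebesgue. k q r) = (LINT p:{0..h}|lborel. LINT q|lebesgue. F q (Y (q + p)))"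
    using shear_Fubini(1)[OF kint km'] unfolding shift set_lebesgue_integral_def by simp
  show "set_integrable lborel {0..h} (\<lambda>p. LINT q|lebesgue. F q (Y (q + p)))"
    using shear_Fubini(2)[OF kint km'] unfolding shift set_integrable_def by simp
  have "(LINT r:{s..t}|lborel. (norm (u r))\<^sup>2 - (norm (u (r - h)))\<^sup>2) \<le>
      (LINT r|lborel. 2 * (LINT q|lebesgue. k q r))"
    unfolding set_lebesgue_integral_def
  proof (rule integral_mono_AE)
    have "continuous_on {s..t} (\<lambda>r. u (r - h))"
      by (rule continuous_on_compose2[OF u]) (use h in \<open>auto intro!: continuous_intros\<close>)
    moreover have "continuous_on {s..t} u" by (rule continuous_on_subset[OF u]) (use h in auto)
    ultimately show "integrable lborel (\<lambda>r. indicator {s..t} r *\<^sub>R ((norm (u r))\<^sup>2 - (norm (u (r - h)))\<^sup>2))"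
      by (intro borel_integrable_compact compact_Icc continuous_intros)
    show "integrable lborel (\<lambda>r. 2 * (LINT q|lebesgue. k q r))"
      using P.integrable_snd[OF kint] by simp
    show "AE r in lborel. indicator {s..t} r *\<^sub>R ((norm (u r))\<^sup>2 - (norm (u (r - h)))\<^sup>2) \<le>
        2 * (LINT q|lebesgue. k q r)"
      using Y(3)
    proof eventually_elim
      case (elim r)
      show ?case
      proof (cases "r \<in> {s..t}")
        case False
        then show ?thesis using Y(4) by (simp add: k_def)
      next
        case True
        have "(norm (u r))\<^sup>2 - (norm (u (r - h)))\<^sup>2 \<le> 2 * inner (u r - u (r - h)) (u r)"
        proof -
          have "0 \<le> inner (u r - u (r - h)) (u r - u (r - h))" by (rule inner_ge_zero)
          then show ?thesis
            by (simp add: power2_norm_eq_inner inner_diff_left inner_diff_right inner_commute)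
        qed
        also have "inner (u r - u (r - h)) (u r) = inner (u r - u (r - h)) (j (Y r))"
          using elim True by simp
        also have "\<dots> = (LINT q:{r-h..r}|lebesgue. F q (Y r))"
          by (rule inc) (use True h in auto)
        also have "\<dots> = (LINT q|lebesgue. k q r)"
          unfolding set_lebesgue_integral_def k_def
          by (intro Bochner_Integration.integral_cong) (auto simp: indicator_def)
        finally show ?thesis using True by simp
      qed
    qed
  qed
  also have "\<dots> = 2 * (LINT p:{0..h}|lborel. LINT q|lebesgue. F q (Y (q + p)))"
    unfolding shear[symmetric] by simp
  finally show "(LINT r:{s..t}|lborel. (norm (u r))\<^sup>2 - (norm (u (r - h)))\<^sup>2) \<le>
    2 * (LINT p:{0..h}|lborel. LINT q|lebesgue. F q (Y (q + p)))" .
qed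

lemma square_int_on_integrable:
  fixes g :: "real \<Rightarrow> 'b::real_normed_vector"
  assumes "square_int_on {a..b} g"
  shows "integrable lebesgue (\<lambda>x. indicator {a..b} x * norm (g x))"
    and "integrable lebesgue (\<lambda>x. indicator {a..b} x * (norm (g x))\<^sup>2)"
proof -
  show sq: "integrable lebesgue (\<lambda>x. indicator {a..b} x * (norm (g x))\<^sup>2)"
    using assms by (simp add: square_int_on_def set_integrable_def)
  have one: "integrable lebesgue (\<lambda>x. indicator {a..b} x :: real)"
    by (intro integrable_real_indicator) (auto simp: emeasure_lborel_Icc_eq)
  have "(\<lambda>x. norm (indicator {a..b} x *\<^sub>R g x)) \<in> borel_measurable lebesgue"
    using assms by (intro measurable_compose[OF _ borel_measurable_norm])
      (simp add: square_int_on_def set_borel_measurable_def)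
  then have m: "(\<lambda>x. indicator {a..b} x * norm (g x)) \<in> borel_measurable lebesgue" by simp
  show "integrable lebesgue (\<lambda>x. indicator {a..b} x * norm (g x))"
  proof (rule Bochner_Integration.integrable_bound[OF Bochner_Integration.integrable_add[OF one sq] m], intro AE_I2)
    fix x
    show "norm (indicator {a..b} x * norm (g x)) \<le> norm (indicator {a..b} x + indicator {a..b} x * (norm (g x))\<^sup>2)"
    proof -
      have "norm (g x) \<le> 1 + (norm (g x))\<^sup>2"
      proof -
        have "2 * norm (g x) \<le> (norm (g x))\<^sup>2 + 1" using sum_squares_bound[of "norm (g x)" 1] by simp
        with norm_ge_zero[of "g x"] show ?thesis by linarith
      qed
      then show ?thesis by (auto simp: indicator_def)
    qed
  qed
qed

text \<open>Divide the bound for the averaged increments by \<open>h\<close> and let \<open>h\<close> tend to zero. The dual function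
  \<open>f\<close> enters only through its pairings with fixed vectors and a norm bound \<open>n\<close>, so that weighted sums
  of such functions are covered.\<close>

lemma energy_inequality_positive_times:
  fixes u :: "real \<Rightarrow> 'h::real_inner"
    and f :: "real \<Rightarrow> 'v::{real_normed_vector,banach,second_countable_topology} \<Rightarrow>\<^sub>L real"
    and j :: "'v \<Rightarrow>\<^sub>L 'h"
  assumes u: "continuous_on {0..} u"
    and G: "L2_loc G" "AE r in lebesgue. 0 < r \<longrightarrow> j (G r) = u r"
    and f: "\<And>T v. T > 0 \<Longrightarrow> set_borel_measurable lebesgue {0..T} (\<lambda>r. f r v)"
      "\<And>r. norm (f r) \<le> n r" "L2_loc n"
    and inc: "\<And>v a b. 0 < a \<Longrightarrow> a \<le> b \<Longrightarrow>
      inner (u b - u a) (j v) = (LINT r:{a..b}|lebesgue. f r v)"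
    and st: "0 < s" "s < t"
  shows "(norm (u t))\<^sup>2 - (norm (u s))\<^sup>2 \<le> 2 * (LINT r:{s..t}|lebesgue. f r (G r))"
proof -
  define F where "F r = indicator {0..t} r *\<^sub>R f r" for r
  define N where "N r = indicator {0..t} r * n r" for r
  define G' where "G' r = indicator {s..t} r *\<^sub>R G r" for r
  have t0: "t > 0" using st by simp
  have n0: "n r \<ge> 0" for r using f(2)[of r] norm_ge_zero order_trans by blast
  have Fm: "(\<lambda>q. F q v) \<in> borel_measurable lebesgue" for v
    using f(1)[OF t0, of v] by (simp add: F_def set_borel_measurable_def blinfun.scaleR_left)
  have FN: "norm (F r) \<le> N r" for r
    using f(2)[of r] by (simp add: F_def N_def indicator_def)
  have sqn: "square_int_on {0..t} n" and sqG: "square_int_on {0..t} G"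
    using f(3) G(1) t0 by (auto simp: L2_loc_def)
  have Nint: "integrable lebesgue N"
    using square_int_on_integrable(1)[OF sqn] n0 by (simp add: N_def[abs_def])
  have N2: "integrable lebesgue (\<lambda>r. (N r)\<^sup>2)"
  proof -
    have "(\<lambda>r. (N r)\<^sup>2) = (\<lambda>r. indicator {0..t} r * (norm (n r))\<^sup>2)"
      by (auto simp: N_def indicator_def)
    then show ?thesis using square_int_on_integrable(2)[OF sqn] by simp
  qed
  have G'm: "G' \<in> borel_measurable lebesgue"
  proof -
    have "(\<lambda>r. indicator {s..t} r *\<^sub>R (indicator {0..t} r *\<^sub>R G r)) \<in> borel_measurable lebesgue"
    proof (rule borel_measurable_scaleR)
      show "(\<lambda>r. indicator {0..t} r *\<^sub>R G r) \<in> borel_measurable lebesgue"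
        using sqG by (simp add: square_int_on_def set_borel_measurable_def)
      show "(indicator {s..t} :: real \<Rightarrow> real) \<in> borel_measurable lebesgue"
        by (intro borel_measurable_indicator) auto
    qed
    also have "(\<lambda>r. indicator {s..t} r *\<^sub>R (indicator {0..t} r *\<^sub>R G r)) = G'"
      using st by (auto simp: G'_def indicator_def)
    finally show ?thesis .
  qed
  obtain Y0 where Y0: "Y0 \<in> borel_measurable borel" "AE r in lebesgue. G' r = Y0 r"
    using lebesgue_measurable_borel_version[OF G'm] .
  \<comment> \<open>The Borel version may differ from \<open>0\<close> on a null set outside \<open>[s, t]\<close>; it is cut off once more.\<close>
  define Y where "Y r = indicator {s..t} r *\<^sub>R Y0 r" for r
  have Yb[measurable]: "Y \<in> borel_measurable borel"
    unfolding Y_def[abs_def] using Y0(1) by measurable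
  have YG: "AE r in lebesgue. Y r = G' r"
    using Y0(2) by eventually_elim (auto simp: Y_def G'_def indicator_def)
  have Ysupp: "Y r = 0" if "r \<notin> {s..t}" for r using that by (simp add: Y_def)
  have nb: "integrable lborel g"
    if "g \<in> borel_measurable borel" "integrable lebesgue g'" "AE r in lebesgue. norm (g r) \<le> norm (g' r)"
    for g g' :: "real \<Rightarrow> real"
  proof -
    have "g \<in> borel_measurable lebesgue" using that(1) by (intro measurable_completion) simp
    then have "integrable lebesgue g"
      by (rule Bochner_Integration.integrable_bound[OF that(2) _ that(3)])
    then show ?thesis using that(1) by (simp add: integrable_completion)
  qed
  have Y1: "integrable lborel (\<lambda>r. norm (Y r))"
  proof (rule nb[OF _ square_int_on_integrable(1)[OF sqG]])
    show "AE r in lebesgue. norm (norm (Y r)) \<le> norm (indicator {0..t} r * norm (G r))"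
      using YG by eventually_elim (use st in \<open>auto simp: G'_def indicator_def\<close>)
  qed measurable
  have Y2: "integrable lborel (\<lambda>r. (norm (Y r))\<^sup>2)"
  proof (rule nb[OF _ square_int_on_integrable(2)[OF sqG]])
    show "AE r in lebesgue. norm ((norm (Y r))\<^sup>2) \<le> norm (indicator {0..t} r * (norm (G r))\<^sup>2)"
      using YG by eventually_elim (use st in \<open>auto simp: G'_def indicator_def\<close>)
  qed measurable
  have Y2': "(\<integral>\<^sup>+r. ennreal ((norm (Y r))\<^sup>2) \<partial>lborel) < \<infinity>"
    using Y2 by (simp add: integrable_iff_bounded)
  have tc: "translation_continuous_L2 Y"
    by (rule translation_continuous_L2_compact_support[OF Yb Ysupp Y2'])
  have Yu: "AE r in lborel. s \<le> r \<and> r \<le> t \<longrightarrow> j (Y r) = u r"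
  proof -
    have "AE r in lebesgue. s \<le> r \<and> r \<le> t \<longrightarrow> j (Y r) = u r"
      using YG G(2) by eventually_elim (use st in \<open>auto simp: G'_def\<close>)
    then show ?thesis by (simp add: AE_completion_iff)
  qed
  have incF: "inner (u b - u a) (j v) = (LINT q:{a..b}|lebesgue. F q v)"
    if "0 < a" "a \<le> b" "b \<le> t" for v a b
  proof -
    have "(LINT q:{a..b}|lebesgue. f q v) = (LINT q:{a..b}|lebesgue. F q v)"
      unfolding set_lebesgue_integral_def
      by (intro Bochner_Integration.integral_cong) (use that in \<open>auto simp: F_def indicator_def\<close>)
    then show ?thesis using inc[OF that(1,2)] by simp
  qed
  define \<Phi> where "\<Phi> p = (LINT q|lebesgue. F q (Y (q + p)))" for p
  have \<Phi>0: "\<Phi> 0 = (LINT r:{s..t}|lebesgue. f r (G r))"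
  proof -
    have Fm': "(\<lambda>q. F q (Z q)) \<in> borel_measurable lebesgue" if "Z \<in> borel_measurable lebesgue" for Z
      by (rule borel_measurable_blinfun_apply_weak[OF Fm that])
    have "\<Phi> 0 = (LINT q|lebesgue. F q (G' q))"
      unfolding \<Phi>_def add_0_right
    proof (rule integral_cong_AE)
      show "AE q in lebesgue. F q (Y q) = F q (G' q)" using YG by eventually_elim simp
      show "(\<lambda>q. F q (Y q)) \<in> borel_measurable lebesgue"
        by (intro Fm' measurable_completion) simp
    qed (rule Fm'[OF G'm])
    also have "\<dots> = (LINT r:{s..t}|lebesgue. f r (G r))"
      unfolding set_lebesgue_integral_def
      by (intro Bochner_Integration.integral_cong)
        (use st in \<open>auto simp: F_def G'_def indicator_def\<close>)
    finally show ?thesis .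
  qed
  have "(norm (u t))\<^sup>2 - (norm (u s))\<^sup>2 \<le> 2 * \<Phi> 0 + e" if "e > 0" for e
  proof -
    have e3: "e / 3 > 0" using that by simp
    obtain d1 where d1: "d1 > 0"
      "\<And>p. \<bar>p\<bar> < d1 \<Longrightarrow> \<bar>(LINT q|lebesgue. F q (Y (q + p))) - (LINT q|lebesgue. F q (Y q))\<bar> \<le> e / 3"
      by (rule pairing_translation_continuous[OF Fm borel_measurable_integrable[OF Nint] N2 FN tc Y2' e3]) (rule that)
    have d1': "\<bar>\<Phi> p - \<Phi> 0\<bar> \<le> e / 3" if "\<bar>p\<bar> < d1" for p
      using d1(2)[OF that] unfolding \<Phi>_def add_0_right .
    have E: "continuous_on {0..} (\<lambda>r. (norm (u r))\<^sup>2)" by (intro continuous_intros u)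
    obtain d2 where d2: "d2 > 0" "\<And>h. 0 < h \<Longrightarrow> h < d2 \<Longrightarrow> h < s \<Longrightarrow>
      h * ((norm (u t))\<^sup>2 - (norm (u s))\<^sup>2 - e / 3) \<le> (LINT r:{s..t}|lborel. (norm (u r))\<^sup>2 - (norm (u (r - h)))\<^sup>2)"
      by (rule integral_difference_quotient_lower[OF E st e3]) (rule that)
    define h where "h = min (min d1 d2) s / 2"
    have h: "0 < h" "h < d1" "h < d2" "h < s" using d1 d2 st by (auto simp: h_def)
    note bound = steklov_energy_bound[OF u Yb Y1 Yu Ysupp Fm FN Nint incF h(1,4) less_imp_le[OF st(2)], folded \<Phi>_def]
    have "h * ((norm (u t))\<^sup>2 - (norm (u s))\<^sup>2 - e / 3) \<le> 2 * (LINT p:{0..h}|lborel. \<Phi> p)"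
      using d2(2)[OF h(1,3,4)] bound(1) by linarith
    also have "(LINT p:{0..h}|lborel. \<Phi> p) \<le> (LINT p:{0..h}|lborel. \<Phi> 0 + e / 3)"
    proof (rule set_integral_mono[OF bound(2)])
      show "set_integrable lborel {0..h} (\<lambda>p. \<Phi> 0 + e / 3)"
        unfolding set_integrable_def by (rule borel_integrable_compact) auto
      fix p assume "p \<in> {0..h}"
      then have "\<bar>p\<bar> < d1" using h by auto
      from d1'[OF this] show "\<Phi> p \<le> \<Phi> 0 + e / 3" unfolding abs_le_iff by linarith
    qed
    also have "(LINT p:{0..h}|lborel. \<Phi> 0 + e / 3) = h * (\<Phi> 0 + e / 3)"
      using h by (simp add: set_lebesgue_integral_def)
    finally have "h * ((norm (u t))\<^sup>2 - (norm (u s))\<^sup>2 - e / 3) \<le> h * (2 * (\<Phi> 0 + e / 3))"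
      by (simp only: mult.left_commute)
    then have "(norm (u t))\<^sup>2 - (norm (u s))\<^sup>2 - e / 3 \<le> 2 * (\<Phi> 0 + e / 3)"
      using h(1) by (rule mult_left_le_imp_le)
    then show ?thesis by (simp add: field_simps)
  qed
  then show ?thesis unfolding \<Phi>0[symmetric] by (rule field_le_epsilon)
qed


text \<open>By Young's inequality the pairing is dominated by \<open>n\<^sup>2 + |G|\<^sup>2\<close>.\<close>

lemma pairing_set_integrable:
  fixes f :: "real \<Rightarrow> 'v::{real_normed_vector,second_countable_topology} \<Rightarrow>\<^sub>L real"
  assumes f: "\<And>v. set_borel_measurable lebesgue {a..b} (\<lambda>r. f r v)" "\<And>r. norm (f r) \<le> n r"
    and n: "square_int_on {a..b} n" and G: "square_int_on {a..b} G"
  shows "set_integrable lebesgue {a..b} (\<lambda>r. f r (G r))"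
proof -
  let ?F = "\<lambda>r. indicator {a..b} r *\<^sub>R f r" and ?G = "\<lambda>r. indicator {a..b} r *\<^sub>R G r"
  have "(\<lambda>r. ?F r (?G r)) \<in> borel_measurable lebesgue"
    by (rule borel_measurable_blinfun_apply_weak)
      (use f(1) G in \<open>simp_all add: set_borel_measurable_def square_int_on_def blinfun.scaleR_left\<close>)
  also have "(\<lambda>r. ?F r (?G r)) = (\<lambda>r. indicator {a..b} r *\<^sub>R f r (G r))"
    by (auto simp: indicator_def)
  finally have m: "(\<lambda>r. indicator {a..b} r *\<^sub>R f r (G r)) \<in> borel_measurable lebesgue" .
  show ?thesis
    unfolding set_integrable_def
  proof (rule Bochner_Integration.integrable_bound[OF Bochner_Integration.integrable_add[OF
        square_int_on_integrable(2)[OF n] square_int_on_integrable(2)[OF G]] m], intro AE_I2)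
    fix r
    have "\<bar>f r (G r)\<bar> \<le> norm (f r) * norm (G r)" using norm_blinfun[of "f r" "G r"] by simp
    also have "\<dots> \<le> \<bar>n r\<bar> * norm (G r)"
      using f(2)[of r] by (intro mult_right_mono) auto
    also have "\<dots> \<le> \<bar>n r\<bar>\<^sup>2 + (norm (G r))\<^sup>2"
    proof -
      have "2 * \<bar>n r\<bar> * norm (G r) \<le> \<bar>n r\<bar>\<^sup>2 + (norm (G r))\<^sup>2" by (rule sum_squares_bound)
      moreover have "0 \<le> \<bar>n r\<bar> * norm (G r)" by simp
      ultimately show ?thesis by linarith
    qed
    finally show "norm (indicator {a..b} r *\<^sub>R f r (G r)) \<le>
        norm (indicator {a..b} r * (norm (n r))\<^sup>2 + indicator {a..b} r * (norm (G r))\<^sup>2)"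
      by (simp add: indicator_def)
  qed
qed

text \<open>Both sides depend continuously on \<open>s\<close>, so the inequality for positive times extends to \<open>s = 0\<close>.\<close>

lemma energy_inequality:
  fixes u :: "real \<Rightarrow> 'h::real_inner"
    and f :: "real \<Rightarrow> 'v::{real_normed_vector,banach,second_countable_topology} \<Rightarrow>\<^sub>L real"
    and j :: "'v \<Rightarrow>\<^sub>L 'h"
  assumes u: "continuous_on {0..} u"
    and G: "L2_loc G" "AE r in lebesgue. 0 < r \<longrightarrow> j (G r) = u r"
    and f: "\<And>T v. T > 0 \<Longrightarrow> set_borel_measurable lebesgue {0..T} (\<lambda>r. f r v)"
      "\<And>r. norm (f r) \<le> n r" "L2_loc n"
    and inc: "\<And>v a b. 0 < a \<Longrightarrow> a \<le> b \<Longrightarrow>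
      inner (u b - u a) (j v) = (LINT r:{a..b}|lebesgue. f r v)"
    and st: "0 \<le> s" "s \<le> t"
  shows "(norm (u t))\<^sup>2 - (norm (u s))\<^sup>2 \<le> 2 * (LINT r:{s..t}|lebesgue. f r (G r))"
proof (cases "s = t")
  case True
  have "(LINT r:{s..t}|lebesgue. f r (G r)) = 0"
    unfolding set_lebesgue_integral_def
  proof (rule integral_eq_zero_AE)
    have "AE r in lebesgue. r \<noteq> t" by (intro AE_completion AE_lborel_singleton)
    then show "AE r in lebesgue. indicator {s..t} r *\<^sub>R f r (G r) = 0"
      by eventually_elim (use True in auto)
  qed
  then show ?thesis using True by simp
next
  case False
  then have t: "t > 0" "s < t" using st by auto
  let ?g = "\<lambda>r. f r (G r)"
  have gi: "set_integrable lebesgue {0..t} ?g"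
    using t f G(1) by (intro pairing_set_integrable[of _ _ f n]) (auto simp: L2_loc_def)
  then have hk: "?g integrable_on {0..t}" by (rule set_lebesgue_integral_eq_integral(1))
  have eq: "(LINT r:{x..t}|lebesgue. ?g r) = integral {x..t} ?g" if "0 \<le> x" for x
    by (rule set_lebesgue_integral_eq_integral(2)[OF set_integrable_subset[OF gi]]) (use that in auto)
  define \<psi> where "\<psi> x = (norm (u t))\<^sup>2 - (norm (u x))\<^sup>2 - 2 * integral {x..t} ?g" for x
  have "closure {0<..<t} = {0..t}" using t by simp
  moreover have "continuous_on {0..t} \<psi>"
    unfolding \<psi>_def
    by (intro continuous_intros continuous_on_subset[OF u] indefinite_integral_continuous_1' hk) auto
  moreover have "\<psi> x \<le> 0" if "x \<in> {0<..<t}" for x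
    using energy_inequality_positive_times[OF u G f inc, of x t] that eq[of x] by (simp add: \<psi>_def)
  ultimately have "\<psi> s \<le> 0"
    using continuous_le_on_closure[of "{0<..<t}" \<psi> s 0] st by simp
  then show ?thesis using eq[OF st(1)] by (simp add: \<psi>_def)
qed


section \<open>The weighted energy inequality in the energy space\<close>

lemma set_borel_measurable_blinfun_apply:
  fixes f :: "real \<Rightarrow> 'v::real_normed_vector \<Rightarrow>\<^sub>L real"
  assumes "set_borel_measurable M S f"
  shows "set_borel_measurable M S (\<lambda>r. f r v)"
proof -
  have "continuous_on UNIV (\<lambda>F :: 'v \<Rightarrow>\<^sub>L real. F v)" by (intro continuous_intros)
  then have "(\<lambda>F :: 'v \<Rightarrow>\<^sub>L real. F v) \<in> borel_measurable borel"
    by (rule borel_measurable_continuous_onI)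
  from measurable_compose[OF assms[unfolded set_borel_measurable_def] this]
  show ?thesis by (simp add: set_borel_measurable_def blinfun.scaleR_left)
qed

lemma dual_pairing_set_integrable:
  fixes f :: "real \<Rightarrow> 'v::{real_normed_vector,second_countable_topology} \<Rightarrow>\<^sub>L real"
  assumes f: "square_int_on {a..b} f" and G: "square_int_on {a..b} G"
  shows "set_integrable lebesgue {a..b} (\<lambda>r. f r (G r))"
proof (rule pairing_set_integrable[OF _ order_refl _ G])
  have m: "set_borel_measurable lebesgue {a..b} f" using f by (simp add: square_int_on_def)
  show "set_borel_measurable lebesgue {a..b} (\<lambda>r. f r v)" for v
    by (rule set_borel_measurable_blinfun_apply[OF m])
  have "(\<lambda>x. norm (indicator {a..b} x *\<^sub>R f x)) \<in> borel_measurable lebesgue"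
    using m by (intro measurable_compose[OF _ borel_measurable_norm]) (simp add: set_borel_measurable_def)
  then show "square_int_on {a..b} (\<lambda>r. norm (f r))"
    using f by (simp add: square_int_on_def set_borel_measurable_def)
qed

lemma continuous_square_int_on:
  fixes g :: "real \<Rightarrow> 'b::{banach,second_countable_topology}"
  assumes "continuous_on {a..b} g"
  shows "square_int_on {a..b} g"
  unfolding square_int_on_def
proof
  show "set_borel_measurable lebesgue {a..b} g"
    using borel_measurable_integrable[OF set_integrable_lebesgue_continuous[OF assms, unfolded set_integrable_def]]
    by (simp add: set_borel_measurable_def)
  show "set_integrable lebesgue {a..b} (\<lambda>x. (norm (g x))\<^sup>2)"
    by (intro set_integrable_lebesgue_continuous continuous_intros assms)
qed

lemma square_int_on_norm:
  assumes "square_int_on S g"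
  shows "square_int_on S (\<lambda>x. norm (g x))"
proof -
  have "(\<lambda>x. norm (indicator S x *\<^sub>R g x)) \<in> borel_measurable lebesgue"
    using assms by (intro measurable_compose[OF _ borel_measurable_norm])
      (simp add: square_int_on_def set_borel_measurable_def)
  then show ?thesis
    using assms by (simp add: square_int_on_def set_borel_measurable_def)
qed

lemma square_int_on_add:
  fixes f g :: "real \<Rightarrow> real"
  assumes f: "square_int_on {a..b} f" and g: "square_int_on {a..b} g"
  shows "square_int_on {a..b} (\<lambda>x. f x + g x)"
proof -
  have m: "(\<lambda>x. indicator {a..b} x *\<^sub>R (f x + g x)) \<in> borel_measurable lebesgue"
    unfolding scaleR_add_right
    by (rule borel_measurable_add) (use f g in \<open>simp_all add: square_int_on_def set_borel_measurable_def\<close>)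
  have "(\<lambda>x. (indicator {a..b} x *\<^sub>R (f x + g x))\<^sup>2) \<in> borel_measurable lebesgue"
    by (rule borel_measurable_power[OF m])
  also have "(\<lambda>x. (indicator {a..b} x *\<^sub>R (f x + g x))\<^sup>2) = (\<lambda>x. indicator {a..b} x * (norm (f x + g x))\<^sup>2)"
    by (auto simp: indicator_def)
  finally have m2: "(\<lambda>x. indicator {a..b} x * (norm (f x + g x))\<^sup>2) \<in> borel_measurable lebesgue" .
  have "integrable lebesgue (\<lambda>x. 2 * (indicator {a..b} x * (norm (f x))\<^sup>2) + 2 * (indicator {a..b} x * (norm (g x))\<^sup>2))"
    by (intro Bochner_Integration.integrable_add integrable_mult_right square_int_on_integrable f g)
  then have "integrable lebesgue (\<lambda>x. indicator {a..b} x * (norm (f x + g x))\<^sup>2)"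
  proof (rule Bochner_Integration.integrable_bound[OF _ m2], intro AE_I2)
    fix x
    have "2 * f x * g x \<le> (f x)\<^sup>2 + (g x)\<^sup>2" by (rule sum_squares_bound)
    then have "(f x + g x)\<^sup>2 \<le> 2 * (f x)\<^sup>2 + 2 * (g x)\<^sup>2" by (simp add: power2_sum)
    then show "norm (indicator {a..b} x * (norm (f x + g x))\<^sup>2) \<le>
      norm (2 * (indicator {a..b} x * (norm (f x))\<^sup>2) + 2 * (indicator {a..b} x * (norm (g x))\<^sup>2))"
      by (simp add: indicator_def)
  qed
  then show ?thesis using m
    by (simp add: square_int_on_def set_borel_measurable_def set_integrable_def)
qed

lemma square_int_on_continuous_scaleR:
  fixes w :: "real \<Rightarrow> real" and g :: "real \<Rightarrow> 'b::{real_normed_vector,second_countable_topology}"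
  assumes w: "continuous_on UNIV w" and g: "square_int_on {a..b} g"
  shows "square_int_on {a..b} (\<lambda>x. w x *\<^sub>R g x)"
proof -
  have wm: "w \<in> borel_measurable lebesgue"
    by (rule measurable_completion) (simp add: borel_measurable_continuous_onI[OF w])
  have "(\<lambda>x. w x *\<^sub>R (indicator {a..b} x *\<^sub>R g x)) \<in> borel_measurable lebesgue"
    using g by (intro borel_measurable_scaleR[OF wm]) (simp add: square_int_on_def set_borel_measurable_def)
  then have m: "(\<lambda>x. indicator {a..b} x *\<^sub>R (w x *\<^sub>R g x)) \<in> borel_measurable lebesgue"
    by (simp add: mult.commute)
  have sq: "integrable lebesgue (\<lambda>x. indicator {a..b} x * (norm (g x))\<^sup>2)"
    by (rule square_int_on_integrable(2)[OF g])
  have "bounded (w ` {a..b})"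
    by (intro compact_imp_bounded compact_continuous_image continuous_on_subset[OF w]) auto
  then obtain B where B: "\<forall>x\<in>{a..b}. \<bar>w x\<bar> \<le> B"
    unfolding bounded_iff by auto
  have "(\<lambda>x. (w x)\<^sup>2 * (indicator {a..b} x * (norm (g x))\<^sup>2)) \<in> borel_measurable lebesgue"
    by (intro borel_measurable_times borel_measurable_power wm borel_measurable_integrable[OF sq])
  also have "(\<lambda>x. (w x)\<^sup>2 * (indicator {a..b} x * (norm (g x))\<^sup>2)) = (\<lambda>x. indicator {a..b} x * (norm (w x *\<^sub>R g x))\<^sup>2)"
    by (auto simp: power_mult_distrib indicator_def)
  finally have m2: "(\<lambda>x. indicator {a..b} x * (norm (w x *\<^sub>R g x))\<^sup>2) \<in> borel_measurable lebesgue" .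
  have "integrable lebesgue (\<lambda>x. indicator {a..b} x * (norm (w x *\<^sub>R g x))\<^sup>2)"
  proof (rule Bochner_Integration.integrable_bound[OF integrable_mult_right[OF sq, of "B\<^sup>2"] m2], intro AE_I2)
    fix x
    show "norm (indicator {a..b} x * (norm (w x *\<^sub>R g x))\<^sup>2) \<le> norm (B\<^sup>2 * (indicator {a..b} x * (norm (g x))\<^sup>2))"
    proof (cases "x \<in> {a..b}")
      case True
      then have "\<bar>w x\<bar>\<^sup>2 \<le> B\<^sup>2" using B by (intro power_mono) auto
      then show ?thesis using True by (simp add: power_mult_distrib mult_right_mono)
    qed simp
  qed
  then show ?thesis using m
    by (simp add: square_int_on_def set_borel_measurable_def set_integrable_def)
qed

lemma pivot_apply [simp]: "pivot j h v = inner h (j v)"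
  by (simp add: pivot_def)

lemma norm_pivot_le: "norm (pivot j h) \<le> norm j * norm h"
proof (rule norm_blinfun_bound)
  fix v
  have "norm (pivot j h v) \<le> norm h * norm (j v)"
    by (simp add: Cauchy_Schwarz_ineq2)
  also have "\<dots> \<le> norm h * (norm j * norm v)"
    by (intro mult_left_mono norm_blinfun) auto
  finally show "norm (pivot j h v) \<le> norm j * norm h * norm v" by (simp add: mult_ac)
qed simp

text \<open>The energy inequality for \<open>u(r) = exp(\<gamma>r) y(r)\<close>, whose derivative is \<open>exp(\<gamma>r) (y' + \<gamma> y)\<close>.\<close>

lemma energy_space_weighted_inequality:
  fixes j :: "'v::{real_inner,banach,second_countable_topology} \<Rightarrow>\<^sub>L
              'h::{real_inner,banach,second_countable_topology}"
  assumes es: "energy_space j yV y yd" and st: "0 \<le> s" "s \<le> t"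
  shows "exp (2 * \<gamma> * t) * (norm (y t))\<^sup>2 - exp (2 * \<gamma> * s) * (norm (y s))\<^sup>2 \<le>
    2 * (LINT r:{s..t}|lebesgue. exp (2 * \<gamma> * r) * (yd r (yV r) + \<gamma> * inner (y r) (j (yV r))))"
proof -
  have yV: "L2_loc yV" and y: "continuous_on {0..} y" and ae: "AE t in lebesgue. 0 < t \<longrightarrow> j (yV t) = y t"
    and yd: "L2_loc yd" and der: "has_time_derivative j y yd"
    using es by (auto simp: energy_space_def)
  have yc: "continuous_on {0..T} y" for T by (rule continuous_on_subset[OF y]) auto
  have expc: "continuous_on UNIV (\<lambda>r. exp (\<gamma> * r))" by (intro continuous_intros)
  define u where "u r = exp (\<gamma> * r) *\<^sub>R y r" for r
  define G where "G r = exp (\<gamma> * r) *\<^sub>R yV r" for r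
  define f where "f r = exp (\<gamma> * r) *\<^sub>R (yd r + \<gamma> *\<^sub>R pivot j (y r))" for r
  define n where "n r = exp (\<gamma> * r) *\<^sub>R (norm (yd r) + \<bar>\<gamma>\<bar> * norm j * norm (y r))" for r
  have fv: "f r v = exp (\<gamma> * r) * (yd r v + \<gamma> * inner (y r) (j v))" for r v
    by (simp add: f_def blinfun.scaleR_left blinfun.add_left)
  have "(norm (u t))\<^sup>2 - (norm (u s))\<^sup>2 \<le> 2 * (LINT r:{s..t}|lebesgue. f r (G r))"
  proof (rule energy_inequality[where n=n and j=j])
    show "continuous_on {0..} u" unfolding u_def by (intro continuous_intros y)
    show "L2_loc G"
      using yV unfolding L2_loc_def G_def[abs_def]
      by (auto intro!: square_int_on_continuous_scaleR[OF expc])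
    show "AE r in lebesgue. 0 < r \<longrightarrow> j (G r) = u r"
      using ae by eventually_elim (simp add: G_def u_def blinfun.scaleR_right)
    show "set_borel_measurable lebesgue {0..T} (\<lambda>r. f r v)" if "T > 0" for T v
    proof -
      have 1: "(\<lambda>r. indicator {0..T} r *\<^sub>R yd r v) \<in> borel_measurable lebesgue"
        using set_borel_measurable_blinfun_apply[of lebesgue "{0..T}" yd v] yd that
        by (simp add: L2_loc_def square_int_on_def set_borel_measurable_def)
      have "continuous_on {0..T} (\<lambda>r. \<gamma> * inner (y r) (j v))" by (intro continuous_intros yc)
      from borel_measurable_integrable[OF set_integrable_lebesgue_continuous[OF this, unfolded set_integrable_def]]
      have 2: "(\<lambda>r. indicator {0..T} r *\<^sub>R (\<gamma> * inner (y r) (j v))) \<in> borel_measurable lebesgue" .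
      have 3: "(\<lambda>r. exp (\<gamma> * r)) \<in> borel_measurable lebesgue"
        by (rule measurable_completion) simp
      have "(\<lambda>r. exp (\<gamma> * r) * (indicator {0..T} r *\<^sub>R yd r v + indicator {0..T} r *\<^sub>R (\<gamma> * inner (y r) (j v))))
          \<in> borel_measurable lebesgue"
        by (intro borel_measurable_times borel_measurable_add 1 2 3)
      then show ?thesis
        unfolding set_borel_measurable_def fv by (simp add: algebra_simps)
    qed
    show "norm (f r) \<le> n r" for r
    proof -
      have "norm (pivot j (y r)) \<le> norm j * norm (y r)" by (rule norm_pivot_le)
      then have "norm (\<gamma> *\<^sub>R pivot j (y r)) \<le> \<bar>\<gamma>\<bar> * norm j * norm (y r)"
        by (simp add: mult.assoc mult_left_mono)
      then have "norm (yd r + \<gamma> *\<^sub>R pivot j (y r)) \<le> norm (yd r) + \<bar>\<gamma>\<bar> * norm j * norm (y r)"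
        by (intro order_trans[OF norm_triangle_ineq] add_left_mono)
      then show ?thesis by (simp add: f_def n_def)
    qed
    show "L2_loc n"
      unfolding L2_loc_def
    proof (intro allI impI)
      fix T :: real assume T: "T > 0"
      have "square_int_on {0..T} (\<lambda>r. norm (yd r))"
        using yd T by (intro square_int_on_norm) (simp add: L2_loc_def)
      moreover have "square_int_on {0..T} (\<lambda>r. \<bar>\<gamma>\<bar> * norm j * norm (y r))"
        by (intro continuous_square_int_on continuous_intros yc)
      ultimately show "square_int_on {0..T} n"
        unfolding n_def[abs_def] by (intro square_int_on_continuous_scaleR expc square_int_on_add)
    qed
    show "inner (u b - u a) (j v) = (LINT r:{a..b}|lebesgue. f r v)" if ab: "0 < a" "a \<le> b" for v a b
    proof -
      have "exp (\<gamma> * b) * inner (y b) (j v) - exp (\<gamma> * a) * inner (y a) (j v) =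
        (LINT r:{a..b}|lebesgue. exp (\<gamma> * r) * (yd r v + \<gamma> * inner (y r) (j v)))"
      proof (rule weak_derivative_imp_weighted_integral[OF _ _ _ ab])
        show "continuous_on {0..} (\<lambda>r. inner (y r) (j v))" by (intro continuous_intros y)
        show "set_integrable lebesgue {0..T} (\<lambda>r. yd r v)" if "T > 0" for T
          using yd that by (intro dual_pairing_set_integrable continuous_square_int_on continuous_intros)
            (simp add: L2_loc_def)
        show "(LINT t:{0<..}|lebesgue. deriv \<phi> t * inner (y t) (j v)) = - (LINT t:{0<..}|lebesgue. \<phi> t * yd t v)"
          if "test_function {0<..} \<phi>" for \<phi>
          using der that by (simp add: has_time_derivative_def)
      qed
      then show ?thesis unfolding fv by (simp add: u_def inner_diff_left)
    qed
  qed fact+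
  moreover have "(norm (u r))\<^sup>2 = exp (2 * \<gamma> * r) * (norm (y r))\<^sup>2" for r
    by (simp add: u_def power_mult_distrib power2_eq_square exp_add[symmetric])
  moreover have "f r (G r) = exp (2 * \<gamma> * r) * (yd r (yV r) + \<gamma> * inner (y r) (j (yV r)))" for r
  proof -
    have "exp (2 * \<gamma> * r) = exp (\<gamma> * r) * exp (\<gamma> * r)" by (simp add: exp_add[symmetric])
    then show ?thesis unfolding fv G_def by (simp add: blinfun.scaleR_right algebra_simps)
  qed
  ultimately show ?thesis by simp
qed

lemma square_int_on_set_integrable:
  fixes g :: "real \<Rightarrow> 'b::{banach,second_countable_topology}"
  assumes "square_int_on {a..b} g"
  shows "set_integrable lebesgue {a..b} g"
  unfolding set_integrable_def
proof (rule Bochner_Integration.integrable_bound[OF square_int_on_integrable(1)[OF assms]])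
  show "(\<lambda>x. indicator {a..b} x *\<^sub>R g x) \<in> borel_measurable lebesgue"
    using assms by (simp add: square_int_on_def set_borel_measurable_def)
qed simp

lemma set_integrable_continuous_mult:
  fixes w g :: "real \<Rightarrow> real"
  assumes w: "continuous_on UNIV w" and g: "set_integrable lebesgue {a..b} g"
  shows "set_integrable lebesgue {a..b} (\<lambda>x. w x * g x)"
proof -
  have gi: "integrable lebesgue (\<lambda>x. indicator {a..b} x * g x)"
    using g by (simp add: set_integrable_def)
  have wm: "w \<in> borel_measurable lebesgue"
    by (rule measurable_completion) (simp add: borel_measurable_continuous_onI[OF w])
  have "bounded (w ` {a..b})"
    by (intro compact_imp_bounded compact_continuous_image continuous_on_subset[OF w]) auto
  then obtain B where B: "\<forall>x\<in>{a..b}. \<bar>w x\<bar> \<le> B"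
    unfolding bounded_iff by auto
  have "integrable lebesgue (\<lambda>x. w x * (indicator {a..b} x * g x))"
  proof (rule Bochner_Integration.integrable_bound[OF integrable_mult_right[OF gi, of B]])
    show "(\<lambda>x. w x * (indicator {a..b} x * g x)) \<in> borel_measurable lebesgue"
      by (intro borel_measurable_times wm borel_measurable_integrable[OF gi])
    have "norm (w x * (indicator {a..b} x * g x)) \<le> norm (B * (indicator {a..b} x * g x))" for x
    proof (cases "x \<in> {a..b}")
      case True
      then have "\<bar>w x\<bar> \<le> \<bar>B\<bar>" using B by force
      then show ?thesis by (simp add: abs_mult mult_right_mono)
    qed simp
    then show "AE x in lebesgue. norm (w x * (indicator {a..b} x * g x)) \<le> norm (B * (indicator {a..b} x * g x))"
      by simp
  qed
  then show ?thesis by (simp add: set_integrable_def mult.left_commute)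
qed

text \<open>A pointwise dissipation inequality, in which \<open>m\<close> stands for the memory term and \<open>p\<close> for what remains on
  the right-hand side, integrated against the weight.\<close>

lemma energy_memory_inequality:
  fixes j :: "'v::{real_inner,banach,second_countable_topology} \<Rightarrow>\<^sub>L
              'h::{real_inner,banach,second_countable_topology}"
    and m :: "real \<Rightarrow> 'v \<Rightarrow>\<^sub>L real"
  assumes es: "energy_space j yV y yd" and m: "L2_loc m" and p: "continuous_on {0..} p"
    and pw: "AE r in lebesgue. 0 < r \<longrightarrow>
      2 * (yd r (yV r) + \<gamma> * inner (y r) (j (yV r))) + 2 * \<eta> * m r (yV r) \<le> p r"
    and st: "0 \<le> s" "s \<le> t"
  shows "exp (2 * \<gamma> * t) * (norm (y t))\<^sup>2 + 2 * \<eta> * (LINT r:{0..t}|lebesgue. exp (2 * \<gamma> * r) * m r (yV r)) \<le>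
    exp (2 * \<gamma> * s) * (norm (y s))\<^sup>2 + 2 * \<eta> * (LINT r:{0..s}|lebesgue. exp (2 * \<gamma> * r) * m r (yV r))
    + (LINT r:{s..t}|lebesgue. exp (2 * \<gamma> * r) * p r)"
proof -
  let ?w = "\<lambda>r. exp (2 * \<gamma> * r)"
  let ?a = "\<lambda>r. yd r (yV r) + \<gamma> * inner (y r) (j (yV r))" and ?b = "\<lambda>r. m r (yV r)"
  have y: "continuous_on {0..} y" and yV: "square_int_on {0..T} yV" and yd: "square_int_on {0..T} yd"
    and mT: "square_int_on {0..T} m" if "T > 0" for T
    using es m that by (auto simp: energy_space_def L2_loc_def)
  have wc: "continuous_on UNIV ?w" by (intro continuous_intros)
  \<comment> \<open>Integrability is taken on \<open>[0, t + 1]\<close>, a proper interval also for \<open>t = 0\<close>.\<close>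
  have T: "t + 1 > 0" using st by simp
  have yc: "continuous_on {0..t+1} y" by (rule continuous_on_subset[OF y[OF T]]) auto
  have "set_integrable lebesgue {0..t+1} (\<lambda>r. pivot j (y r) (yV r))"
  proof (rule pairing_set_integrable[OF _ norm_pivot_le _ yV[OF T]])
    show "set_borel_measurable lebesgue {0..t+1} (\<lambda>r. pivot j (y r) v)" for v
    proof -
      have "continuous_on {0..t+1} (\<lambda>r. pivot j (y r) v)"
        unfolding pivot_apply by (intro continuous_intros yc)
      then show ?thesis
        using continuous_square_int_on[of 0 "t+1" "\<lambda>r. pivot j (y r) v"]
        by (simp add: square_int_on_def)
    qed
    show "square_int_on {0..t+1} (\<lambda>r. norm j * norm (y r))"
      by (intro continuous_square_int_on continuous_intros yc)
  qed
  then have "set_integrable lebesgue {0..t+1} ?a"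
    unfolding pivot_apply
    by (intro set_integral_add(1) set_integrable_mult_right dual_pairing_set_integrable[OF yd[OF T] yV[OF T]])
  then have ai: "set_integrable lebesgue {0..t+1} (\<lambda>r. ?w r * ?a r)"
    by (rule set_integrable_continuous_mult[OF wc])
  have bi: "set_integrable lebesgue {0..t+1} (\<lambda>r. ?w r * ?b r)"
    by (intro set_integrable_continuous_mult wc dual_pairing_set_integrable[OF mT[OF T] yV[OF T]])
  have pi: "set_integrable lebesgue {0..t+1} (\<lambda>r. ?w r * p r)"
    by (intro set_integrable_lebesgue_continuous continuous_intros continuous_on_subset[OF p]) auto
  have sub: "set_integrable lebesgue {x..x'} g" if "set_integrable lebesgue {0..t+1} g" "0 \<le> x" "x' \<le> t + 1"
    for g :: "real \<Rightarrow> real" and x x'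
    by (rule set_integrable_subset[OF that(1)]) (use that in auto)
  have "(LINT r:{0..t}|lebesgue. ?w r * ?b r) = integral {0..t} (\<lambda>r. ?w r * ?b r)"
    by (rule set_lebesgue_integral_eq_integral(2)[OF sub[OF bi]]) auto
  also have "\<dots> = integral {0..s} (\<lambda>r. ?w r * ?b r) + integral {s..t} (\<lambda>r. ?w r * ?b r)"
    by (rule Henstock_Kurzweil_Integration.integral_combine[symmetric])
      (use st set_lebesgue_integral_eq_integral(1)[OF sub[OF bi, of 0 t]] in auto)
  also have "integral {0..s} (\<lambda>r. ?w r * ?b r) = (LINT r:{0..s}|lebesgue. ?w r * ?b r)"
    by (rule set_lebesgue_integral_eq_integral(2)[OF sub[OF bi], symmetric]) (use st in auto)
  also have "integral {s..t} (\<lambda>r. ?w r * ?b r) = (LINT r:{s..t}|lebesgue. ?w r * ?b r)"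
    by (rule set_lebesgue_integral_eq_integral(2)[OF sub[OF bi], symmetric]) (use st in auto)
  finally have split: "(LINT r:{0..t}|lebesgue. ?w r * ?b r) =
      (LINT r:{0..s}|lebesgue. ?w r * ?b r) + (LINT r:{s..t}|lebesgue. ?w r * ?b r)" .
  have ia: "set_integrable lebesgue {s..t} (\<lambda>r. ?w r * ?a r)"
    and ib: "set_integrable lebesgue {s..t} (\<lambda>r. ?w r * ?b r)"
    and ip: "set_integrable lebesgue {s..t} (\<lambda>r. ?w r * p r)"
    using sub[OF ai st(1)] sub[OF bi st(1)] sub[OF pi st(1)] by auto
  have i2a: "set_integrable lebesgue {s..t} (\<lambda>r. 2 * (?w r * ?a r))"
    and i2b: "set_integrable lebesgue {s..t} (\<lambda>r. 2 * \<eta> * (?w r * ?b r))"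
    by (intro set_integrable_mult_right ia ib)+
  have "2 * (LINT r:{s..t}|lebesgue. ?w r * ?a r) + 2 * \<eta> * (LINT r:{s..t}|lebesgue. ?w r * ?b r)
    = (LINT r:{s..t}|lebesgue. 2 * (?w r * ?a r) + 2 * \<eta> * (?w r * ?b r))"
    by (simp add: set_integral_add(2)[OF i2a i2b])
  also have "\<dots> \<le> (LINT r:{s..t}|lebesgue. ?w r * p r)"
    unfolding set_lebesgue_integral_def
  proof (rule integral_mono_AE)
    show "integrable lebesgue (\<lambda>r. indicator {s..t} r *\<^sub>R (2 * (?w r * ?a r) + 2 * \<eta> * (?w r * ?b r)))"
      using set_integral_add(1)[OF i2a i2b] by (simp only: set_integrable_def)
    show "integrable lebesgue (\<lambda>r. indicator {s..t} r *\<^sub>R (?w r * p r))"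
      using ip by (simp only: set_integrable_def)
    \<comment> \<open>The pointwise inequality is available at positive times only.\<close>
    have "AE r in lebesgue. r \<noteq> (0::real)" by (intro AE_completion AE_lborel_singleton)
    then show "AE r in lebesgue. indicator {s..t} r *\<^sub>R (2 * (?w r * ?a r) + 2 * \<eta> * (?w r * ?b r))
        \<le> indicator {s..t} r *\<^sub>R (?w r * p r)"
      using pw
    proof eventually_elim
      case (elim r)
      show ?case
      proof (cases "r \<in> {s..t}")
        case True
        with elim st have "2 * ?a r + 2 * \<eta> * ?b r \<le> p r" by auto
        then have "?w r * (2 * ?a r + 2 * \<eta> * ?b r) \<le> ?w r * p r" by (intro mult_left_mono) auto
        moreover have "?w r * (2 * ?a r + 2 * \<eta> * ?b r) = 2 * (?w r * ?a r) + 2 * \<eta> * (?w r * ?b r)"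
          by (simp add: algebra_simps)
        ultimately have "2 * (?w r * ?a r) + 2 * \<eta> * (?w r * ?b r) \<le> ?w r * p r" by linarith
        then show ?thesis using True by (simp only: indicator_simps scaleR_one)
      qed simp
    qed
  qed
  finally have "2 * (LINT r:{s..t}|lebesgue. ?w r * ?a r) + 2 * \<eta> * (LINT r:{s..t}|lebesgue. ?w r * ?b r)
    \<le> (LINT r:{s..t}|lebesgue. ?w r * p r)" .
  with energy_space_weighted_inequality[OF es st, of \<gamma>] show ?thesis
    unfolding split distrib_left by linarith
qed


section \<open>Memory energies\<close>

lemma memory_operator_L2_loc: "memory_operator Am \<Longrightarrow> L2_loc g \<Longrightarrow> L2_loc (Am g)"
  by (simp add: memory_operator_def)

text \<open>The positivity assumption speaks of \<open>g\<close> cut off at time \<open>t\<close>; causality removes the cut-off.\<close>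

lemma memory_energy_nonneg:
  fixes Am :: "(real \<Rightarrow> 'v::{real_normed_vector,second_countable_topology}) \<Rightarrow> real \<Rightarrow> 'v \<Rightarrow>\<^sub>L real"
  assumes mo: "memory_operator Am" and A4: "assumption_A4 Am" and g: "L2_loc g"
    and "0 \<le> \<eta>" "0 \<le> t"
  shows "0 \<le> memory_energy \<eta> Am g t"
proof (cases "t = 0")
  case True
  have "(LINT \<tau>:{0..t}|lebesgue. Am g \<tau> (g \<tau>)) = 0"
    unfolding set_lebesgue_integral_def
  proof (rule integral_eq_zero_AE)
    have "AE r in lebesgue. r \<noteq> (0::real)" by (intro AE_completion AE_lborel_singleton)
    then show "AE r in lebesgue. indicator {0..t} r *\<^sub>R Am g r (g r) = 0"
      by eventually_elim (use True in auto)
  qed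
  then show ?thesis by (simp add: memory_energy_def)
next
  case False
  with \<open>0 \<le> t\<close> have t: "t > 0" by simp
  define h where "h r = (if r \<in> {0..t} then g r else 0)" for r
  have h: "L2_loc h"
    unfolding L2_loc_def
  proof (intro allI impI)
    fix T :: real assume "T > 0"
    then have "square_int_on {0..min T t} g" using g t by (simp add: L2_loc_def)
    moreover have "indicator {0..T} x *\<^sub>R h x = indicator {0..min T t} x *\<^sub>R g x"
      "indicator {0..T} x *\<^sub>R (norm (h x))\<^sup>2 = indicator {0..min T t} x *\<^sub>R (norm (g x))\<^sup>2" for x
      by (auto simp: h_def indicator_def)
    ultimately show "square_int_on {0..T} h"
      unfolding square_int_on_def set_borel_measurable_def set_integrable_def by simp
  qed
  have causal: "AE s in lebesgue. 0 < s \<and> s < t \<longrightarrow> Am h s = Am g s"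
  proof -
    have "AE s in lebesgue. 0 < s \<and> s < t \<longrightarrow> h s = g s" by (simp add: h_def)
    then show ?thesis using mo t g h unfolding memory_operator_def by blast
  qed
  have "0 \<le> (LINT s:{0..t}|lebesgue. Am h s (g s))"
    using A4 t g unfolding assumption_A4_def L2_loc_def h_def[abs_def] by blast
  also have "\<dots> = (LINT s:{0..t}|lebesgue. Am g s (g s))"
    unfolding set_lebesgue_integral_def
  proof (rule integral_cong_AE)
    have int: "set_integrable lebesgue {0..t} (\<lambda>s. Am f s (g s))" if "L2_loc f" for f
      using memory_operator_L2_loc[OF mo that] g t by (intro dual_pairing_set_integrable) (auto simp: L2_loc_def)
    show "(\<lambda>s. indicator {0..t} s *\<^sub>R Am h s (g s)) \<in> borel_measurable lebesgue"
      using borel_measurable_integrable[OF int[OF h, unfolded set_integrable_def]] .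
    show "(\<lambda>s. indicator {0..t} s *\<^sub>R Am g s (g s)) \<in> borel_measurable lebesgue"
      using borel_measurable_integrable[OF int[OF g, unfolded set_integrable_def]] .
    have "AE r in lebesgue. r \<noteq> (0::real)" "AE r in lebesgue. r \<noteq> t"
      by (intro AE_completion AE_lborel_singleton)+
    then show "AE s in lebesgue. indicator {0..t} s *\<^sub>R Am h s (g s) = indicator {0..t} s *\<^sub>R Am g s (g s)"
      using causal by eventually_elim (auto simp: indicator_def)
  qed
  finally show ?thesis using \<open>0 \<le> \<eta>\<close> by (simp add: memory_energy_def)
qed

text \<open>Both \<open>D\<close> and the evaluation at a test vector commute with the Bochner integral of \<open>G\<close> in \<open>V\<close>.\<close>

lemma dual_integral_operator:
  fixes D :: "'v::{real_normed_vector,banach,second_countable_topology} \<Rightarrow>\<^sub>L 'v \<Rightarrow>\<^sub>L real"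
  assumes "set_integrable lebesgue S G"
  shows "dual_integral S (\<lambda>r. D (G r)) = D (LINT r:S|lebesgue. G r)"
proof -
  have "(LINT r:S|lebesgue. D (G r) w) = D (LINT r:S|lebesgue. G r) w" for w
  proof -
    have bl: "bounded_linear (\<lambda>x. D x w)"
      by (intro bounded_linear_intros)
    have "(LINT r|lebesgue. D (indicator S r *\<^sub>R G r) w) = D (LINT r|lebesgue. indicator S r *\<^sub>R G r) w"
      using integral_bounded_linear[OF bl assms[unfolded set_integrable_def]] .
    then show ?thesis
      by (simp add: set_lebesgue_integral_def blinfun.scaleR_right blinfun.scaleR_left)
  qed
  then show ?thesis
    by (simp add: dual_integral_def blinfun_apply_inverse)
qed

text \<open>With \<open>P(\<tau>) = \<integral>\<^sub>0\<^sup>\<tau> G\<close> this is the integrated form of \<open>(D(P, P))' = 2 D(P, P')\<close>. It is proved without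
  differentiation: the square \<open>[0, t]\<^sup>2\<close> splits along the diagonal into two triangles, and on them
  the symmetric integrand \<open>D(G(r), G(\<tau>))\<close> has equal integrals.\<close>

lemma symmetric_form_primitive:
  fixes D :: "'v::{real_normed_vector,banach,second_countable_topology} \<Rightarrow>\<^sub>L 'v \<Rightarrow>\<^sub>L real" and G :: "real \<Rightarrow> 'v"
  assumes sym: "\<And>v w. D v w = D w v" and G: "set_integrable lebesgue {0..t} G"
  shows "2 * (LINT \<tau>:{0..t}|lebesgue. D (LINT r:{0..\<tau>}|lebesgue. G r) (G \<tau>)) =
      D (LINT r:{0..t}|lebesgue. G r) (LINT r:{0..t}|lebesgue. G r)"
    and "set_integrable lebesgue {0..t} (\<lambda>\<tau>. D (LINT r:{0..\<tau>}|lebesgue. G r) (G \<tau>))"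
proof -
  interpret L: sigma_finite_measure "lebesgue :: real measure" by (rule sigma_finite_lebesgue)
  interpret P: pair_sigma_finite "lebesgue :: real measure" "lebesgue :: real measure" ..
  let ?M = "lebesgue \<Otimes>\<^sub>M lebesgue :: (real \<times> real) measure"
  define H where "H r = indicator {0..t} r *\<^sub>R G r" for r
  have H: "integrable lebesgue H" using G by (simp add: set_integrable_def H_def[abs_def])
  have Hm: "H \<in> borel_measurable lebesgue" using H by auto
  define k where "k r \<tau> = D (H r) (H \<tau>)" for r \<tau>
  \<comment> \<open>The restriction of \<open>k\<close> to the triangle \<open>r \<le> \<tau>\<close>.\<close>
  define a where "a r \<tau> = indicator {..\<tau>} r * k r \<tau>" for r \<tau> :: real
  have ksym: "k r \<tau> = k \<tau> r" for r \<tau> unfolding k_def by (rule sym)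
  have idm: "(\<lambda>x. x) \<in> borel_measurable (lebesgue :: real measure)"
    by (rule measurable_completion) simp
  have fstm: "(\<lambda>x. fst x) \<in> borel_measurable ?M" by (rule measurable_compose[OF measurable_fst idm])
  have sndm: "(\<lambda>x. snd x) \<in> borel_measurable ?M" by (rule measurable_compose[OF measurable_snd idm])
  have km: "(\<lambda>x. k (fst x) (snd x)) \<in> borel_measurable ?M"
  proof -
    have "continuous_on UNIV (\<lambda>x :: 'v \<times> 'v. D (fst x) (snd x))"
      by (intro continuous_intros)
    then have c: "(\<lambda>x :: 'v \<times> 'v. D (fst x) (snd x)) \<in> borel_measurable borel"
      by (rule borel_measurable_continuous_onI)
    have p: "(\<lambda>x. (H (fst x), H (snd x))) \<in> borel_measurable ?M"
      by (intro borel_measurable_Pair measurable_compose[OF measurable_fst Hm] measurable_compose[OF measurable_snd Hm])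
    show ?thesis using measurable_compose[OF p c] by (simp add: k_def)
  qed
  have am: "(\<lambda>(r, \<tau>). a r \<tau>) \<in> borel_measurable ?M"
  proof -
    have "Measurable.pred ?M (\<lambda>x. fst x \<le> snd x)"
      unfolding pred_def by (intro borel_measurable_le fstm sndm)
    then have "(\<lambda>x. if fst x \<le> snd x then k (fst x) (snd x) else 0) \<in> borel_measurable ?M"
      by (intro measurable_If km) auto
    also have "(\<lambda>x. if fst x \<le> snd x then k (fst x) (snd x) else 0) = (\<lambda>(r, \<tau>). a r \<tau>)"
      by (auto simp: a_def fun_eq_iff)
    finally show ?thesis .
  qed
  have kb: "\<bar>k r \<tau>\<bar> \<le> norm D * norm (H r) * norm (H \<tau>)" for r \<tau>
  proof -
    have "\<bar>k r \<tau>\<bar> \<le> norm (D (H r)) * norm (H \<tau>)"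
      using norm_blinfun[of "D (H r)" "H \<tau>"] by (simp add: k_def)
    also have "\<dots> \<le> norm D * norm (H r) * norm (H \<tau>)"
      by (intro mult_right_mono norm_blinfun) auto
    finally show ?thesis .
  qed
  have prod: "integrable ?M (\<lambda>(r, \<tau>). (norm D * norm (H r)) * norm (H \<tau>))"
    by (rule P.integrable_product_mult) (use H in auto)
  have aint: "integrable ?M (\<lambda>(r, \<tau>). a r \<tau>)"
  proof (rule Bochner_Integration.integrable_bound[OF prod am], intro AE_I2)
    fix x :: "real \<times> real"
    have "\<bar>a (fst x) (snd x)\<bar> \<le> \<bar>k (fst x) (snd x)\<bar>" by (simp add: a_def indicator_def)
    then show "norm (case x of (r, \<tau>) \<Rightarrow> a r \<tau>) \<le> norm (case x of (r, \<tau>) \<Rightarrow> norm D * norm (H r) * norm (H \<tau>))"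
      using kb[of "fst x" "snd x"] by (simp add: split_beta)
  qed
  have kint: "integrable lebesgue (\<lambda>r. k r \<tau>)" for \<tau>
  proof -
    have bl: "bounded_linear (\<lambda>x. D x (H \<tau>))" by (intro bounded_linear_intros)
    show ?thesis unfolding k_def by (rule integrable_bounded_linear[OF bl H])
  qed
  have ak: "integrable lebesgue (\<lambda>r. a r \<tau>)" "integrable lebesgue (\<lambda>r. a \<tau> r)" for \<tau>
  proof -
    have "set_integrable lebesgue {..\<tau>} (\<lambda>r. k r \<tau>)" "set_integrable lebesgue {\<tau>..} (\<lambda>r. k r \<tau>)"
      unfolding set_integrable_def by (rule integrable_mult_indicator[OF _ kint], simp)+
    moreover have "(\<lambda>r. a \<tau> r) = (\<lambda>r. indicator {\<tau>..} r *\<^sub>R k r \<tau>)"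
      by (auto simp: a_def indicator_def ksym fun_eq_iff)
    ultimately show "integrable lebesgue (\<lambda>r. a r \<tau>)" "integrable lebesgue (\<lambda>r. a \<tau> r)"
      by (simp_all add: a_def set_integrable_def)
  qed
  have inner_eq: "indicator {0..t} \<tau> * D (LINT r:{0..\<tau>}|lebesgue. G r) (G \<tau>) = (LINT r|lebesgue. a r \<tau>)" for \<tau>
  proof (cases "\<tau> \<in> {0..t}")
    case False
    then show ?thesis by (simp add: a_def k_def H_def)
  next
    case True
    have bl: "bounded_linear (\<lambda>x. D x (G \<tau>))" by (intro bounded_linear_intros)
    have "set_integrable lebesgue {0..\<tau>} G" by (rule set_integrable_subset[OF G]) (use True in auto)
    then have "D (LINT r|lebesgue. indicator {0..\<tau>} r *\<^sub>R G r) (G \<tau>) =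
        (LINT r|lebesgue. D (indicator {0..\<tau>} r *\<^sub>R G r) (G \<tau>))"
      using integral_bounded_linear[OF bl, of lebesgue "\<lambda>r. indicator {0..\<tau>} r *\<^sub>R G r"] by (simp add: set_integrable_def)
    also have "\<dots> = (LINT r|lebesgue. a r \<tau>)"
      by (intro Bochner_Integration.integral_cong)
        (use True in \<open>auto simp: a_def k_def H_def indicator_def\<close>)
    finally show ?thesis using True by (simp add: set_lebesgue_integral_def)
  qed
  show "set_integrable lebesgue {0..t} (\<lambda>\<tau>. D (LINT r:{0..\<tau>}|lebesgue. G r) (G \<tau>))"
    unfolding set_integrable_def real_scaleR_def inner_eq
    using P.integrable_snd[OF aint] .
  let ?I = "LINT \<tau>|lebesgue. LINT r|lebesgue. a r \<tau>"
  have I: "(LINT \<tau>:{0..t}|lebesgue. D (LINT r:{0..\<tau>}|lebesgue. G r) (G \<tau>)) = ?I"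
    unfolding set_lebesgue_integral_def real_scaleR_def inner_eq[unfolded set_lebesgue_integral_def] ..
  have I': "?I = (LINT \<tau>|lebesgue. LINT r|lebesgue. a \<tau> r)"
    by (rule P.Fubini_integral[OF aint])
  have "?I + ?I = (LINT \<tau>|lebesgue. LINT r|lebesgue. a r \<tau>) + (LINT \<tau>|lebesgue. LINT r|lebesgue. a \<tau> r)"
    using I' by simp
  also have "\<dots> = (LINT \<tau>|lebesgue. (LINT r|lebesgue. a r \<tau>) + (LINT r|lebesgue. a \<tau> r))"
    using P.integrable_snd[OF aint] P.integrable_fst[OF aint]
    by (rule Bochner_Integration.integral_add[symmetric])
  also have "\<dots> = (LINT \<tau>|lebesgue. LINT r|lebesgue. k r \<tau>)"
  proof (rule Bochner_Integration.integral_cong[OF refl])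
    fix \<tau>
    have "(LINT r|lebesgue. a r \<tau>) + (LINT r|lebesgue. a \<tau> r) = (LINT r|lebesgue. a r \<tau> + a \<tau> r)"
      by (rule Bochner_Integration.integral_add[symmetric]) (rule ak)+
    also have "\<dots> = (LINT r|lebesgue. k r \<tau>)"
    proof (rule integral_cong_AE)
      have "AE r in lebesgue. r \<noteq> \<tau>" by (intro AE_completion AE_lborel_singleton)
      then show "AE r in lebesgue. a r \<tau> + a \<tau> r = k r \<tau>"
        by eventually_elim (auto simp: a_def indicator_def ksym)
    qed (use ak kint in auto)
    finally show "(LINT r|lebesgue. a r \<tau>) + (LINT r|lebesgue. a \<tau> r) = (LINT r|lebesgue. k r \<tau>)" .
  qed
  also have "\<dots> = D (LINT r|lebesgue. H r) (LINT r|lebesgue. H r)"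
  proof -
    have "(LINT r|lebesgue. k r \<tau>) = D (LINT r|lebesgue. H r) (H \<tau>)" for \<tau>
    proof -
      have bl: "bounded_linear (\<lambda>x. D x (H \<tau>))" by (intro bounded_linear_intros)
      show ?thesis unfolding k_def by (rule integral_bounded_linear[OF bl H])
    qed
    moreover have "(LINT \<tau>|lebesgue. D (LINT r|lebesgue. H r) (H \<tau>)) = D (LINT r|lebesgue. H r) (LINT r|lebesgue. H r)"
      by (rule integral_bounded_linear[OF _ H]) (intro bounded_linear_intros)
    ultimately show ?thesis by simp
  qed
  finally show "2 * (LINT \<tau>:{0..t}|lebesgue. D (LINT r:{0..\<tau>}|lebesgue. G r) (G \<tau>)) =
      D (LINT r:{0..t}|lebesgue. G r) (LINT r:{0..t}|lebesgue. G r)"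
    unfolding I by (simp add: set_lebesgue_integral_def H_def)
qed

text \<open>In \<open>exp(2\<gamma>\<tau>) \<langle>\<integral>\<^sub>0\<^sup>\<tau> exp(-\<gamma>(\<tau>-s)) D g(s) ds, g(\<tau>)\<rangle>\<close> one factor \<open>exp(\<gamma>\<tau>)\<close> cancels the decay of the kernel and the other
  goes to \<open>g(\<tau>)\<close>. The second equation makes the sign of the energy visible when \<open>D\<close> is nonnegative.\<close>

lemma exp_memory_energy_eq:
  fixes D :: "'v::{real_inner,banach,second_countable_topology} \<Rightarrow>\<^sub>L 'v \<Rightarrow>\<^sub>L real"
  assumes mo: "memory_operator Am" and ex: "is_exponential_memory \<gamma> D Am" and g: "L2_loc g"
    and sym: "\<And>v w. D v w = D w v" and t: "0 \<le> t"
  shows "exp_memory_energy \<eta> \<gamma> D g t =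
      2 * \<eta> * (LINT \<tau>:{0..t}|lebesgue. exp (2 * \<gamma> * \<tau>) * Am g \<tau> (g \<tau>))"
    and "exp_memory_energy \<eta> \<gamma> D g t = \<eta> * D (LINT r:{0..t}|lebesgue. exp (\<gamma> * r) *\<^sub>R g r) (LINT r:{0..t}|lebesgue. exp (\<gamma> * r) *\<^sub>R g r)"
proof -
  define G where "G r = exp (\<gamma> * r) *\<^sub>R g r" for r
  have sq: "square_int_on {0..T} (\<lambda>r. exp (c * r) *\<^sub>R g r)" if "T > 0" for T c
    using g that by (intro square_int_on_continuous_scaleR continuous_intros) (simp add: L2_loc_def)
  have Gi1: "set_integrable lebesgue {0..T} (\<lambda>r. exp (c * r) *\<^sub>R g r)" for T c
  proof -
    have "set_integrable lebesgue {0..\<bar>T\<bar>+1} (\<lambda>r. exp (c * r) *\<^sub>R g r)"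
      by (intro square_int_on_set_integrable sq) auto
    then show ?thesis by (rule set_integrable_subset) auto
  qed
  have Gi: "set_integrable lebesgue {0..T} G" for T
    unfolding G_def[abs_def] by (rule Gi1)
  have di: "dual_integral {0..\<tau>} (\<lambda>r. D (exp (\<gamma> * r) *\<^sub>R g r)) = D (LINT r:{0..\<tau>}|lebesgue. G r)" for \<tau>
    using dual_integral_operator[OF Gi, of \<tau> D] by (simp add: G_def)
  have e: "exp_memory_energy \<eta> \<gamma> D g t = 2 * \<eta> * (LINT \<tau>:{0..t}|lebesgue. D (LINT r:{0..\<tau>}|lebesgue. G r) (G \<tau>))"
    unfolding exp_memory_energy_def di G_def ..
  show "exp_memory_energy \<eta> \<gamma> D g t = \<eta> * D (LINT r:{0..t}|lebesgue. exp (\<gamma> * r) *\<^sub>R g r) (LINT r:{0..t}|lebesgue. exp (\<gamma> * r) *\<^sub>R g r)"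
    unfolding e G_def[symmetric] by (simp add: symmetric_form_primitive(1)[OF sym Gi, symmetric])
  have "AE \<tau> in lebesgue. 0 < \<tau> \<longrightarrow> exp (2 * \<gamma> * \<tau>) * Am g \<tau> (g \<tau>) = D (LINT r:{0..\<tau>}|lebesgue. G r) (G \<tau>)"
  proof -
    have "AE t in lebesgue. 0 < t \<longrightarrow>
           Am g t = dual_integral {0..t} (\<lambda>s. exp (- \<gamma> * (t - s)) *\<^sub>R D (g s))"
      using ex g by (simp add: is_exponential_memory_def)
    then show ?thesis
    proof eventually_elim
      case (elim \<tau>)
      show ?case
      proof
        assume "0 < \<tau>"
        have "(\<lambda>s. exp (- \<gamma> * (\<tau> - s)) *\<^sub>R D (g s)) = (\<lambda>s. D (exp (- \<gamma> * \<tau>) *\<^sub>R G s))"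
          by (auto simp: G_def blinfun.scaleR_right exp_add[symmetric] algebra_simps)
        then have "Am g \<tau> = dual_integral {0..\<tau>} (\<lambda>s. D (exp (- \<gamma> * \<tau>) *\<^sub>R G s))"
          using elim \<open>0 < \<tau>\<close> by simp
        also have "\<dots> = D (LINT r:{0..\<tau>}|lebesgue. exp (- \<gamma> * \<tau>) *\<^sub>R G r)"
          by (intro dual_integral_operator set_integrable_scaleR_right Gi)
        also have "(LINT r:{0..\<tau>}|lebesgue. exp (- \<gamma> * \<tau>) *\<^sub>R G r) = exp (- \<gamma> * \<tau>) *\<^sub>R (LINT r:{0..\<tau>}|lebesgue. G r)"
          by (rule set_integral_scaleR_right)
        finally have "Am g \<tau> = exp (- \<gamma> * \<tau>) *\<^sub>R D (LINT r:{0..\<tau>}|lebesgue. G r)"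
          by (simp add: blinfun.scaleR_right)
        moreover have "exp (2 * \<gamma> * \<tau>) * exp (- \<gamma> * \<tau>) = exp (\<gamma> * \<tau>)"
          by (simp add: exp_add[symmetric])
        ultimately show "exp (2 * \<gamma> * \<tau>) * Am g \<tau> (g \<tau>) = D (LINT r:{0..\<tau>}|lebesgue. G r) (G \<tau>)"
          by (simp add: G_def blinfun.scaleR_left blinfun.scaleR_right mult.assoc[symmetric])
      qed
    qed
  qed
  moreover have "AE r in lebesgue. r \<noteq> (0::real)" by (intro AE_completion AE_lborel_singleton)
  ultimately have ae: "AE \<tau> in lebesgue. indicator {0..t} \<tau> *\<^sub>R D (LINT r:{0..\<tau>}|lebesgue. G r) (G \<tau>) =
      indicator {0..t} \<tau> *\<^sub>R (exp (2 * \<gamma> * \<tau>) * Am g \<tau> (g \<tau>))"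
    by eventually_elim (auto simp: indicator_def)
  have T: "t + 1 > 0" using t by simp
  have "set_integrable lebesgue {0..t+1} (\<lambda>\<tau>. exp (2 * \<gamma> * \<tau>) * Am g \<tau> (g \<tau>))"
    using memory_operator_L2_loc[OF mo g] g T
    by (intro set_integrable_continuous_mult dual_pairing_set_integrable continuous_intros) (auto simp: L2_loc_def)
  then have "set_integrable lebesgue {0..t} (\<lambda>\<tau>. exp (2 * \<gamma> * \<tau>) * Am g \<tau> (g \<tau>))"
    by (rule set_integrable_subset) auto
  then have "(LINT \<tau>:{0..t}|lebesgue. D (LINT r:{0..\<tau>}|lebesgue. G r) (G \<tau>)) =
      (LINT \<tau>:{0..t}|lebesgue. exp (2 * \<gamma> * \<tau>) * Am g \<tau> (g \<tau>))"
    unfolding set_lebesgue_integral_def set_integrable_def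
    using symmetric_form_primitive(2)[OF sym Gi, of t] ae
    by (intro integral_cong_AE borel_measurable_integrable)
      (simp_all add: set_integrable_def set_lebesgue_integral_def)
  then show "exp_memory_energy \<eta> \<gamma> D g t = 2 * \<eta> * (LINT \<tau>:{0..t}|lebesgue. exp (2 * \<gamma> * \<tau>) * Am g \<tau> (g \<tau>))"
    unfolding e by simp
qed

(*THM*)


section \<open>The closed loop\<close>

lemma bounded_feedback:
  assumes U: "bounded_op_from_Rvec m U" and K: "bounded_op_to_Rvec m K"
  obtains k where "0 \<le> k" "\<And>h. norm (U (K h)) \<le> k * norm h"
proof -
  obtain C1 where C1: "\<forall>v\<in>Rvec m. norm (U v) \<le> C1 * L2_set v {..<m}"
    using U unfolding bounded_op_from_Rvec_def by (elim conjE exE)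
  obtain C2 where C2: "\<forall>h. L2_set (K h) {..<m} \<le> C2 * norm h"
    using K unfolding bounded_op_to_Rvec_def by (elim conjE exE)
  show ?thesis
  proof (rule that[of "\<bar>C1\<bar> * \<bar>C2\<bar>"])
    fix h
    have "K h \<in> Rvec m" using K by (simp add: bounded_op_to_Rvec_def)
    then have "norm (U (K h)) \<le> C1 * L2_set (K h) {..<m}" using C1 by blast
    also have "\<dots> \<le> \<bar>C1\<bar> * L2_set (K h) {..<m}" by (intro mult_right_mono) auto
    also have "\<dots> \<le> \<bar>C1\<bar> * (\<bar>C2\<bar> * norm h)"
    proof (intro mult_left_mono)
      have "L2_set (K h) {..<m} \<le> C2 * norm h" using C2 by blast
      also have "\<dots> \<le> \<bar>C2\<bar> * norm h" by (intro mult_right_mono) auto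
      finally show "L2_set (K h) {..<m} \<le> \<bar>C2\<bar> * norm h" .
    qed simp
    finally show "norm (U (K h)) \<le> \<bar>C1\<bar> * \<bar>C2\<bar> * norm h" by (simp add: mult.assoc)
  qed simp
qed

text \<open>Almost every \<open>A\<^sub>r\<^sub>c(t)\<close> has a splitting of norm below \<open>|C\<^sub>r\<^sub>c| + 1\<close>, and each of its two parts
  pairs one \<open>V\<close>-norm with one \<open>H\<close>-norm.\<close>

lemma reaction_convection_bound:
  fixes j :: "'v::real_inner \<Rightarrow>\<^sub>L 'h::real_inner"
  assumes "assumption_A2 j Arc"
  obtains c where "0 \<le> c"
    "AE t in lebesgue. 0 < t \<longrightarrow> (\<forall>w. \<bar>Arc t w w\<bar> \<le> c * norm w * norm (j w))"
proof -
  obtain Crc where Crc: "AE t in lebesgue. 0 < t \<longrightarrow> rc_norm j (Arc t) \<le> Crc"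
    using assms unfolding assumption_A2_def by (elim conjE exE)
  have ex: "AE t in lebesgue. 0 < t \<longrightarrow> (\<exists>B C. rc_split j (Arc t) B C)"
    using assms unfolding assumption_A2_def by (elim conjE)
  show ?thesis
  proof (rule that[of "\<bar>Crc\<bar> + 1"])
    show "AE t in lebesgue. 0 < t \<longrightarrow> (\<forall>w. \<bar>Arc t w w\<bar> \<le> (\<bar>Crc\<bar> + 1) * norm w * norm (j w))"
      using Crc ex
    proof eventually_elim
      case (elim t)
      show ?case
      proof (intro impI allI)
        fix w assume t: "0 < t"
        let ?S = "{norm B + norm C | B C. rc_split j (Arc t) B C}"
        have "?S \<noteq> {}" using elim(2) t by blast
        moreover have "Inf ?S < \<bar>Crc\<bar> + 1"
          using elim(1) t unfolding rc_norm_def by linarith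
        ultimately obtain x where "x \<in> ?S" "x < \<bar>Crc\<bar> + 1" by (rule cInf_lessD[THEN bexE])
        then obtain B C where BC: "rc_split j (Arc t) B C" "norm B + norm C < \<bar>Crc\<bar> + 1" by blast
        have "\<bar>B (j w) w\<bar> \<le> norm B * norm (j w) * norm w"
        proof -
          have "\<bar>B (j w) w\<bar> \<le> norm (B (j w)) * norm w" using norm_blinfun[of "B (j w)" w] by simp
          also have "\<dots> \<le> norm B * norm (j w) * norm w" by (intro mult_right_mono norm_blinfun) auto
          finally show ?thesis .
        qed
        moreover have "\<bar>inner (C w) (j w)\<bar> \<le> norm C * norm w * norm (j w)"
        proof -
          have "\<bar>inner (C w) (j w)\<bar> \<le> norm (C w) * norm (j w)" by (rule Cauchy_Schwarz_ineq2)
          also have "\<dots> \<le> norm C * norm w * norm (j w)" by (intro mult_right_mono norm_blinfun) auto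
          finally show ?thesis .
        qed
        moreover have "Arc t w w = B (j w) w + inner (C w) (j w)"
          using BC(1) by (simp add: rc_split_def blinfun.add_left)
        ultimately have "\<bar>Arc t w w\<bar> \<le> (norm B + norm C) * (norm w * norm (j w))"
          by (simp add: algebra_simps)
        also have "\<dots> \<le> (\<bar>Crc\<bar> + 1) * (norm w * norm (j w))"
          using BC(2) by (intro mult_right_mono) auto
        finally show "\<bar>Arc t w w\<bar> \<le> (\<bar>Crc\<bar> + 1) * norm w * norm (j w)" by (simp add: mult.assoc)
      qed
    qed
  qed simp
qed

text \<open>By Young's inequality \<open>2|\<langle>R w, w\rangle>|\<close> is at most \<open>|w|\<^sub>V\<^sup>2 + c\<^sup>2 |w|\<^sub>H\<^sup>2\<close>, which the coercivity of the
  closed-loop operator pays for, together with the contribution \<open>2\<gamma> |w|\<^sub>H\<^sup>2\<close> of the weight.\<close>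

lemma feedback_dissipation:
  fixes j :: "'v::real_inner \<Rightarrow>\<^sub>L 'h::real_inner"
    and A R :: "'v \<Rightarrow>\<^sub>L 'v \<Rightarrow>\<^sub>L real"
  assumes coer: "2 * (A w - pivot j (B (j w))) w \<ge> (norm w)\<^sup>2 + (c\<^sup>2 + 2 * \<gamma> + 2) * (norm (j w))\<^sup>2"
    and R: "\<bar>R w w\<bar> \<le> c * norm w * norm (j w)"
  shows "2 * ((- A w - R w + pivot j (B (j w))) w + \<gamma> * inner (j w) (j w)) \<le> - 2 * (norm (j w))\<^sup>2"
proof -
  have "2 * norm w * (c * norm (j w)) \<le> (norm w)\<^sup>2 + (c * norm (j w))\<^sup>2"
    by (rule sum_squares_bound)
  then have "2 * \<bar>R w w\<bar> \<le> (norm w)\<^sup>2 + c\<^sup>2 * (norm (j w))\<^sup>2"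
    using R by (simp add: power_mult_distrib mult_ac)
  then have "- 2 * R w w \<le> (norm w)\<^sup>2 + c\<^sup>2 * (norm (j w))\<^sup>2" by linarith
  then show ?thesis using coer
    by (simp add: blinfun.diff_left blinfun.add_left blinfun.minus_left power2_norm_eq_inner[symmetric] algebra_simps)
qed

text \<open>The equation for \<open>z\<close> is autonomous and dissipates \<open>2Q\<close>; the input from \<open>z\<close> raises the energy of \<open>y\<close> by
  at most \<open>k\<^sup>2 Q\<close>. As the energies are nonnegative, \<open>Q\<close> is at most the energy of \<open>z\<close> at time \<open>s\<close>.\<close>

lemma closed_loop_estimate:
  fixes j :: "'v::{real_inner,banach,second_countable_topology} \<Rightarrow>\<^sub>L
              'h::{real_inner,banach,second_countable_topology}"
    and A :: "'v \<Rightarrow>\<^sub>L 'v \<Rightarrow>\<^sub>L real"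
    and Arc :: "real \<Rightarrow> 'v \<Rightarrow>\<^sub>L 'v \<Rightarrow>\<^sub>L real"
  assumes mo: "memory_operator Am"
    and arc: "AE t in lebesgue. 0 < t \<longrightarrow> (\<forall>w. \<bar>Arc t w w\<bar> \<le> c * norm w * norm (j w))"
    and UK: "\<And>w. 2 * (A w - pivot j (UK (j w))) w \<ge> (norm w)\<^sup>2 + (c\<^sup>2 + 2 * \<gamma> + 2) * (norm (j w))\<^sup>2"
    and LW: "\<And>w. 2 * (A w - pivot j (LW (j w))) w \<ge> (norm w)\<^sup>2 + (c\<^sup>2 + 2 * \<gamma> + 2) * (norm (j w))\<^sup>2"
    and k: "\<And>h. norm (UK h) \<le> k * norm h"
    and sol: "weak_solution j A Arc Am \<eta> UK LW z\<^sub>0 y\<^sub>0 zV z yV y"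
    and mem: "mem = (\<lambda>g t. 2 * \<eta> * (LINT \<tau>:{0..t}|lebesgue. exp (2 * \<gamma> * \<tau>) * Am g \<tau> (g \<tau>)))"
    and nonneg: "\<And>t. 0 \<le> t \<Longrightarrow> 0 \<le> mem zV t" "\<And>t. 0 \<le> t \<Longrightarrow> 0 \<le> mem yV t"
    and st: "0 \<le> s" "s \<le> t"
  shows "exp (2 * \<gamma> * t) * (norm (z t, y t))\<^sup>2 + (mem zV t + mem yV t) \<le>
    (1 + k\<^sup>2) * (exp (2 * \<gamma> * s) * (norm (z s, y s))\<^sup>2 + (mem zV s + mem yV s))"
proof -
  obtain zd yd where es: "energy_space j zV z zd" "energy_space j yV y yd"
    and eqy: "AE t in lebesgue. 0 < t \<longrightarrow>
           yd t = - A (yV t) - Arc t (yV t) - \<eta> *\<^sub>R Am yV t + pivot j (UK (y t)) + pivot j (UK (z t))"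
    and eqz: "AE t in lebesgue. 0 < t \<longrightarrow>
           zd t = - A (zV t) - Arc t (zV t) - \<eta> *\<^sub>R Am zV t + pivot j (LW (z t))"
    using sol unfolding weak_solution_def by (elim conjE exE)
  have zc: "continuous_on {0..} z" and zae: "AE t in lebesgue. 0 < t \<longrightarrow> j (zV t) = z t" and zL: "L2_loc zV"
    using es(1) by (auto simp: energy_space_def)
  have yae: "AE t in lebesgue. 0 < t \<longrightarrow> j (yV t) = y t" and yL: "L2_loc yV"
    using es(2) by (auto simp: energy_space_def)
  have pz: "AE r in lebesgue. 0 < r \<longrightarrow>
      2 * (zd r (zV r) + \<gamma> * inner (z r) (j (zV r))) + 2 * \<eta> * Am zV r (zV r) \<le> - 2 * (norm (z r))\<^sup>2"
    using eqz zae arc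
  proof eventually_elim
    case (elim r)
    show ?case
    proof
      assume "0 < r"
      with elim have e: "zd r = - A (zV r) - Arc r (zV r) - \<eta> *\<^sub>R Am zV r + pivot j (LW (j (zV r)))"
        and zr: "z r = j (zV r)" by simp_all
      have R: "\<bar>Arc r (zV r) (zV r)\<bar> \<le> c * norm (zV r) * norm (j (zV r))"
        using elim(3) \<open>0 < r\<close> by blast
      show "2 * (zd r (zV r) + \<gamma> * inner (z r) (j (zV r))) + 2 * \<eta> * Am zV r (zV r) \<le> - 2 * (norm (z r))\<^sup>2"
        using feedback_dissipation[where B=LW, OF LW R] unfolding e zr
        by (simp add: blinfun.diff_left blinfun.add_left blinfun.minus_left blinfun.scaleR_left algebra_simps)
    qed
  qed
  have py: "AE r in lebesgue. 0 < r \<longrightarrow>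
      2 * (yd r (yV r) + \<gamma> * inner (y r) (j (yV r))) + 2 * \<eta> * Am yV r (yV r) \<le> k\<^sup>2 * (norm (z r))\<^sup>2"
    using eqy yae arc
  proof eventually_elim
    case (elim r)
    show ?case
    proof
      assume "0 < r"
      with elim have e: "yd r = - A (yV r) - Arc r (yV r) - \<eta> *\<^sub>R Am yV r + pivot j (UK (j (yV r))) + pivot j (UK (z r))"
        and yr: "y r = j (yV r)" by simp_all
      have R: "\<bar>Arc r (yV r) (yV r)\<bar> \<le> c * norm (yV r) * norm (j (yV r))"
        using elim(3) \<open>0 < r\<close> by blast
      have "inner (UK (z r)) (j (yV r)) \<le> norm (UK (z r)) * norm (j (yV r))"
        by (rule norm_cauchy_schwarz)
      moreover have "2 * norm (UK (z r)) * norm (j (yV r)) \<le> (norm (UK (z r)))\<^sup>2 + (norm (j (yV r)))\<^sup>2"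
        by (rule sum_squares_bound)
      moreover have "(norm (UK (z r)))\<^sup>2 \<le> k\<^sup>2 * (norm (z r))\<^sup>2"
        using power_mono[OF k[of "z r"], of 2] by (simp add: power_mult_distrib)
      moreover have "0 \<le> (norm (j (yV r)))\<^sup>2" by simp
      ultimately have "2 * inner (UK (z r)) (j (yV r)) - 2 * (norm (j (yV r)))\<^sup>2 \<le> k\<^sup>2 * (norm (z r))\<^sup>2"
        by linarith
      then show "2 * (yd r (yV r) + \<gamma> * inner (y r) (j (yV r))) + 2 * \<eta> * Am yV r (yV r) \<le> k\<^sup>2 * (norm (z r))\<^sup>2"
        using feedback_dissipation[where B=UK, OF UK R] unfolding e yr
        by (simp add: blinfun.diff_left blinfun.add_left blinfun.minus_left blinfun.scaleR_left algebra_simps)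
    qed
  qed
  define Q where "Q = (LINT r:{s..t}|lebesgue. exp (2 * \<gamma> * r) * (norm (z r))\<^sup>2)"
  have Q: "Q \<ge> 0"
    unfolding Q_def set_lebesgue_integral_def by (intro Bochner_Integration.integral_nonneg) simp
  have scale: "(LINT r:{s..t}|lebesgue. exp (2 * \<gamma> * r) * (a * (norm (z r))\<^sup>2)) = a * Q" for a
    unfolding Q_def by (simp add: mult.left_commute)
  have "exp (2 * \<gamma> * t) * (norm (z t))\<^sup>2 + mem zV t \<le> exp (2 * \<gamma> * s) * (norm (z s))\<^sup>2 + mem zV s + (- 2) * Q"
    unfolding mem scale[symmetric]
    by (rule energy_memory_inequality[OF es(1) memory_operator_L2_loc[OF mo zL] _ pz st])
      (intro continuous_intros zc)
  moreover have "exp (2 * \<gamma> * t) * (norm (y t))\<^sup>2 + mem yV t \<le> exp (2 * \<gamma> * s) * (norm (y s))\<^sup>2 + mem yV s + k\<^sup>2 * Q"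
    unfolding mem scale[symmetric]
    by (rule energy_memory_inequality[OF es(2) memory_operator_L2_loc[OF mo yL] _ py st])
      (intro continuous_intros zc)
  moreover define ez ey where "ez r = exp (2 * \<gamma> * r) * (norm (z r))\<^sup>2 + mem zV r"
    and "ey r = exp (2 * \<gamma> * r) * (norm (y r))\<^sup>2 + mem yV r" for r
  ultimately have z: "ez t \<le> ez s - 2 * Q" and y: "ey t \<le> ey s + k\<^sup>2 * Q" by (simp_all add: ez_def ey_def)
  have pos: "0 \<le> ez r" "0 \<le> ey r" if "0 \<le> r" for r
    using nonneg[OF that] by (simp_all add: ez_def ey_def)
  have "Q \<le> ez s" using z pos(1)[of t] st Q by linarith
  then have "k\<^sup>2 * Q \<le> k\<^sup>2 * (ez s + ey s)"
    using pos(2)[OF st(1)] by (intro mult_left_mono) auto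
  then have "ez t + ey t \<le> (1 + k\<^sup>2) * (ez s + ey s)"
    using z y Q by (simp add: algebra_simps)
  moreover have "exp (2 * \<gamma> * r) * (norm (z r, y r))\<^sup>2 + (mem zV r + mem yV r) = ez r + ey r" for r
    by (simp add: norm_Pair ez_def ey_def algebra_simps)
  ultimately show ?thesis by simp
qed

lemma feedback_gains:
  fixes A :: "'v::real_inner \<Rightarrow>\<^sub>L 'v \<Rightarrow>\<^sub>L real"
  assumes A3: "assumption_A3 j A F" and \<rho>: "\<rho> > 0"
  obtains M\<^sub>0 \<Lambda> where "M\<^sub>0 \<ge> 1" "\<And>M. M \<ge> M\<^sub>0 \<Longrightarrow> 0 \<le> \<Lambda> M"
    "\<And>M l w. M \<ge> M\<^sub>0 \<Longrightarrow> l \<ge> \<Lambda> M \<Longrightarrow>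
      2 * (A w - pivot j (F M l (j w))) w \<ge> (norm w)\<^sup>2 + \<rho> * (norm (j w))\<^sup>2"
proof -
  let ?P = "\<lambda>M l\<^sub>0. l\<^sub>0 \<ge> 0 \<and> (\<forall>l\<ge>l\<^sub>0. \<forall>w.
        2 * (A w - pivot j (F M l (j w))) w \<ge> (norm w)\<^sup>2 + \<rho> * (norm (j w))\<^sup>2)"
  obtain M\<^sub>0 where M\<^sub>0: "M\<^sub>0 \<ge> 1" "\<forall>M\<ge>M\<^sub>0. \<exists>l\<^sub>0. ?P M l\<^sub>0"
    using A3 \<rho> unfolding assumption_A3_def by blast
  then have P: "?P M (SOME l\<^sub>0. ?P M l\<^sub>0)" if "M \<ge> M\<^sub>0" for M
    using that by (intro someI_ex[of "?P M"]) blast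
  show ?thesis
    by (rule that[OF M\<^sub>0(1), of "\<lambda>M. SOME l\<^sub>0. ?P M l\<^sub>0"]) (use P in blast)+
qed

theorem theorem3p1:
  fixes j :: "'v::{real_inner,banach,second_countable_topology} \<Rightarrow>\<^sub>L
              'h::{real_inner,banach,second_countable_topology}"
    and A :: "'v \<Rightarrow>\<^sub>L 'v \<Rightarrow>\<^sub>L real"
    and Arc :: "real \<Rightarrow> 'v \<Rightarrow>\<^sub>L 'v \<Rightarrow>\<^sub>L real"
    and Am :: "(real \<Rightarrow> 'v) \<Rightarrow> real \<Rightarrow> 'v \<Rightarrow>\<^sub>L real"
    and \<eta> :: real
    and nact nsens :: "nat \<Rightarrow> nat"
    and U :: "nat \<Rightarrow> (nat \<Rightarrow> real) \<Rightarrow> 'h"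
    and K :: "nat \<Rightarrow> real \<Rightarrow> 'h \<Rightarrow> nat \<Rightarrow> real"
    and W :: "nat \<Rightarrow> 'h \<Rightarrow> nat \<Rightarrow> real"
    and L :: "nat \<Rightarrow> real \<Rightarrow> (nat \<Rightarrow> real) \<Rightarrow> 'h"
  assumes "\<eta> \<ge> 0"
    and "memory_operator Am"
    and "\<And>M. M \<ge> 1 \<Longrightarrow> nact M \<ge> 1"
    and "\<And>M. M \<ge> 1 \<Longrightarrow> bounded_op_from_Rvec (nact M) (U M)"
    and "\<And>M l. M \<ge> 1 \<Longrightarrow> l \<ge> 0 \<Longrightarrow> bounded_op_to_Rvec (nact M) (K M l)"
    and "\<And>S. S \<ge> 1 \<Longrightarrow> nsens S \<ge> 1"
    and "\<And>S. S \<ge> 1 \<Longrightarrow> bounded_op_to_Rvec (nsens S) (W S)"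
    and "\<And>S l. S \<ge> 1 \<Longrightarrow> l \<ge> 0 \<Longrightarrow> bounded_op_from_Rvec (nsens S) (L S l)"
    and "assumption_A1 j A"
    and "assumption_A2 j Arc"
    and "assumption_A3 j A (\<lambda>M l h. U M (K M l h))"
    and "assumption_A3 j A (\<lambda>S l h. L S l (W S h))"
    and "assumption_A4 Am"
  shows
    "\<exists>M\<^sub>0\<ge>1. \<exists>S\<^sub>0\<ge>1.
      (\<exists>\<Lambda>\<^sub>1 \<Lambda>\<^sub>2 :: nat \<Rightarrow> real. \<forall>M\<ge>M\<^sub>0. \<forall>S\<ge>S\<^sub>0. 0 \<le> \<Lambda>\<^sub>1 M \<and> 0 \<le> \<Lambda>\<^sub>2 S \<and>
        (\<forall>l\<^sub>1\<ge>\<Lambda>\<^sub>1 M. \<forall>l\<^sub>2\<ge>\<Lambda>\<^sub>2 S. \<exists>D\<^sub>1\<ge>0. \<forall>z\<^sub>0 y\<^sub>0 zV z yV y.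
          weak_solution j A Arc Am \<eta> (\<lambda>h. U M (K M l\<^sub>1 h)) (\<lambda>h. L S l\<^sub>2 (W S h)) z\<^sub>0 y\<^sub>0 zV z yV y \<longrightarrow>
          (\<forall>t\<ge>0. 0 \<le> memory_energy \<eta> Am zV t \<and> 0 \<le> memory_energy \<eta> Am yV t) \<and>
          (\<forall>s t. 0 \<le> s \<and> s \<le> t \<longrightarrow>
            (norm (z t, y t))\<^sup>2 + (memory_energy \<eta> Am zV t + memory_energy \<eta> Am yV t)
            \<le> (1 + D\<^sub>1) *
              ((norm (z s, y s))\<^sup>2 + (memory_energy \<eta> Am zV s + memory_energy \<eta> Am yV s))))) \<and>
      (\<forall>(bc :: boundary_condition) (\<Omega> :: (real^'d) set) (rep :: 'h \<Rightarrow> real^'d \<Rightarrow> real)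
          (D :: 'v \<Rightarrow>\<^sub>L 'v \<Rightarrow>\<^sub>L real) (\<gamma> :: real).
        polytopal_domain \<Omega> \<and> is_L2_space \<Omega> rep \<and> is_Sobolev_space bc \<Omega> rep j \<and>
        is_neg_Laplacian \<Omega> rep j D \<and> \<gamma> > 0 \<and> is_exponential_memory \<gamma> D Am \<longrightarrow>
        (\<exists>M\<^sub>1\<ge>M\<^sub>0. \<exists>S\<^sub>1\<ge>S\<^sub>0.
          \<exists>\<Lambda>\<^sub>1 \<Lambda>\<^sub>2 :: nat \<Rightarrow> real. \<forall>M\<ge>M\<^sub>1. \<forall>S\<ge>S\<^sub>1. 0 \<le> \<Lambda>\<^sub>1 M \<and> 0 \<le> \<Lambda>\<^sub>2 S \<and>
          (\<forall>l\<^sub>1\<ge>\<Lambda>\<^sub>1 M. \<forall>l\<^sub>2\<ge>\<Lambda>\<^sub>2 S. \<exists>D\<^sub>1\<ge>0. \<forall>z\<^sub>0 y\<^sub>0 zV z yV y.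
            weak_solution j A Arc Am \<eta> (\<lambda>h. U M (K M l\<^sub>1 h)) (\<lambda>h. L S l\<^sub>2 (W S h)) z\<^sub>0 y\<^sub>0 zV z yV y \<longrightarrow>
            (\<forall>t\<ge>0. 0 \<le> exp_memory_energy \<eta> \<gamma> D zV t \<and> 0 \<le> exp_memory_energy \<eta> \<gamma> D yV t) \<and>
            (\<forall>s t. 0 \<le> s \<and> s \<le> t \<longrightarrow>
              exp (2 * \<gamma> * t) * (norm (z t, y t))\<^sup>2
                + (exp_memory_energy \<eta> \<gamma> D zV t + exp_memory_energy \<eta> \<gamma> D yV t)
              \<le> (1 + D\<^sub>1) *
                (exp (2 * \<gamma> * s) * (norm (z s, y s))\<^sup>2
                  + (exp_memory_energy \<eta> \<gamma> D zV s + exp_memory_energy \<eta> \<gamma> D yV s))))))"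
proof -
  note eta = assms(1) and mo = assms(2) and Ub = assms(4) and Kb = assms(5)
    and A3U = assms(11) and A3L = assms(12) and A4 = assms(13)
  obtain c where c: "0 \<le> c" "AE t in lebesgue. 0 < t \<longrightarrow> (\<forall>w. \<bar>Arc t w w\<bar> \<le> c * norm w * norm (j w))"
    by (rule reaction_convection_bound[OF assms(10)])
  \<comment> \<open>The assertion common to both parts, for a weight exponent \<open>\<gamma>\<close> and a memory energy \<open>mem\<close>.\<close>
  define P where "P \<gamma> mem M S \<Lambda>\<^sub>1 \<Lambda>\<^sub>2 \<longleftrightarrow> 0 \<le> \<Lambda>\<^sub>1 M \<and> 0 \<le> \<Lambda>\<^sub>2 S \<and>
      (\<forall>l\<^sub>1\<ge>\<Lambda>\<^sub>1 M. \<forall>l\<^sub>2\<ge>\<Lambda>\<^sub>2 S. \<exists>D\<^sub>1\<ge>0. \<forall>z\<^sub>0 y\<^sub>0 zV z yV y.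
        weak_solution j A Arc Am \<eta> (\<lambda>h. U M (K M l\<^sub>1 h)) (\<lambda>h. L S l\<^sub>2 (W S h)) z\<^sub>0 y\<^sub>0 zV z yV y \<longrightarrow>
        (\<forall>t\<ge>0. 0 \<le> mem zV t \<and> 0 \<le> mem yV t) \<and>
        (\<forall>s t. 0 \<le> s \<and> s \<le> t \<longrightarrow>
          exp (2 * \<gamma> * t) * (norm (z t, y t))\<^sup>2 + (mem zV t + mem yV t)
          \<le> (1 + D\<^sub>1) * (exp (2 * \<gamma> * s) * (norm (z s, y s))\<^sup>2 + (mem zV s + mem yV s))))"
    for \<gamma> :: real and mem :: "(real \<Rightarrow> 'v) \<Rightarrow> real \<Rightarrow> real" and M S :: nat and \<Lambda>\<^sub>1 \<Lambda>\<^sub>2 :: "nat \<Rightarrow> real"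
  have main: "\<exists>M\<^sub>0\<ge>1. \<exists>S\<^sub>0\<ge>1. \<exists>\<Lambda>\<^sub>1 \<Lambda>\<^sub>2. \<forall>M\<ge>M\<^sub>0. \<forall>S\<ge>S\<^sub>0. P \<gamma> mem M S \<Lambda>\<^sub>1 \<Lambda>\<^sub>2"
    if \<gamma>: "\<gamma> \<ge> 0"
      and mem: "\<And>g t. L2_loc g \<Longrightarrow> 0 \<le> t \<Longrightarrow>
        mem g t = 2 * \<eta> * (LINT \<tau>:{0..t}|lebesgue. exp (2 * \<gamma> * \<tau>) * Am g \<tau> (g \<tau>))"
      and nonneg: "\<And>g t. L2_loc g \<Longrightarrow> 0 \<le> t \<Longrightarrow> 0 \<le> mem g t"
    for \<gamma> :: real and mem :: "(real \<Rightarrow> 'v) \<Rightarrow> real \<Rightarrow> real"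
  proof -
    have \<rho>: "c\<^sup>2 + 2 * \<gamma> + 2 > 0" using \<gamma> zero_le_power2[of c] by linarith
    obtain M\<^sub>0 \<Lambda>\<^sub>1 where M: "M\<^sub>0 \<ge> 1" "\<And>M. M \<ge> M\<^sub>0 \<Longrightarrow> 0 \<le> \<Lambda>\<^sub>1 M"
      "\<And>M l w. M \<ge> M\<^sub>0 \<Longrightarrow> l \<ge> \<Lambda>\<^sub>1 M \<Longrightarrow>
        2 * (A w - pivot j (U M (K M l (j w)))) w \<ge> (norm w)\<^sup>2 + (c\<^sup>2 + 2 * \<gamma> + 2) * (norm (j w))\<^sup>2"
      by (rule feedback_gains[OF A3U \<rho>]) (rule that)
    obtain S\<^sub>0 \<Lambda>\<^sub>2 where S: "S\<^sub>0 \<ge> 1" "\<And>S. S \<ge> S\<^sub>0 \<Longrightarrow> 0 \<le> \<Lambda>\<^sub>2 S"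
      "\<And>S l w. S \<ge> S\<^sub>0 \<Longrightarrow> l \<ge> \<Lambda>\<^sub>2 S \<Longrightarrow>
        2 * (A w - pivot j (L S l (W S (j w)))) w \<ge> (norm w)\<^sup>2 + (c\<^sup>2 + 2 * \<gamma> + 2) * (norm (j w))\<^sup>2"
      by (rule feedback_gains[OF A3L \<rho>]) (rule that)
    have "P \<gamma> mem M S \<Lambda>\<^sub>1 \<Lambda>\<^sub>2" if MS: "M \<ge> M\<^sub>0" "S \<ge> S\<^sub>0" for M S
      unfolding P_def
    proof (intro conjI allI impI M(2) S(2) MS)
      fix l\<^sub>1 l\<^sub>2 assume l: "\<Lambda>\<^sub>1 M \<le> l\<^sub>1" "\<Lambda>\<^sub>2 S \<le> l\<^sub>2"
      have "M \<ge> 1" "l\<^sub>1 \<ge> 0" using M(1) M(2)[OF MS(1)] MS l by auto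
      then obtain k where k: "0 \<le> k" "\<And>h. norm (U M (K M l\<^sub>1 h)) \<le> k * norm h"
        using bounded_feedback[OF Ub Kb] by metis
      show "\<exists>D\<^sub>1\<ge>0. \<forall>z\<^sub>0 y\<^sub>0 zV z yV y.
        weak_solution j A Arc Am \<eta> (\<lambda>h. U M (K M l\<^sub>1 h)) (\<lambda>h. L S l\<^sub>2 (W S h)) z\<^sub>0 y\<^sub>0 zV z yV y \<longrightarrow>
        (\<forall>t\<ge>0. 0 \<le> mem zV t \<and> 0 \<le> mem yV t) \<and>
        (\<forall>s t. 0 \<le> s \<and> s \<le> t \<longrightarrow>
          exp (2 * \<gamma> * t) * (norm (z t, y t))\<^sup>2 + (mem zV t + mem yV t)
          \<le> (1 + D\<^sub>1) * (exp (2 * \<gamma> * s) * (norm (z s, y s))\<^sup>2 + (mem zV s + mem yV s)))"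
      proof (intro exI[of _ "k\<^sup>2"] conjI[OF zero_le_power2] allI impI)
        fix z\<^sub>0 y\<^sub>0 zV z yV y
        assume sol: "weak_solution j A Arc Am \<eta> (\<lambda>h. U M (K M l\<^sub>1 h)) (\<lambda>h. L S l\<^sub>2 (W S h)) z\<^sub>0 y\<^sub>0 zV z yV y"
        have L2: "L2_loc zV" "L2_loc yV" using sol by (auto simp: weak_solution_def energy_space_def)
        define mem' where "mem' = (\<lambda>g t. 2 * \<eta> * (LINT \<tau>:{0..t}|lebesgue. exp (2 * \<gamma> * \<tau>) * Am g \<tau> (g \<tau>)))"
        have mem': "mem' zV t = mem zV t" "mem' yV t = mem yV t" if "0 \<le> t" for t
          using mem[OF L2(1) that] mem[OF L2(2) that] by (simp_all add: mem'_def)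
        show "(\<forall>t\<ge>0. 0 \<le> mem zV t \<and> 0 \<le> mem yV t) \<and>
          (\<forall>s t. 0 \<le> s \<and> s \<le> t \<longrightarrow>
            exp (2 * \<gamma> * t) * (norm (z t, y t))\<^sup>2 + (mem zV t + mem yV t)
            \<le> (1 + k\<^sup>2) * (exp (2 * \<gamma> * s) * (norm (z s, y s))\<^sup>2 + (mem zV s + mem yV s)))"
        proof (intro conjI allI impI nonneg L2; (elim conjE)?)
          fix s t :: real assume st: "0 \<le> s" "s \<le> t"
          have "0 \<le> mem' zV t" "0 \<le> mem' yV t" if "0 \<le> t" for t
            using mem'[OF that] nonneg[OF L2(1) that] nonneg[OF L2(2) that] by simp_all
          from closed_loop_estimate[where mem=mem', OF mo c(2) M(3)[OF MS(1) l(1)] S(3)[OF MS(2) l(2)] k(2) sol mem'_def this st]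
          show "exp (2 * \<gamma> * t) * (norm (z t, y t))\<^sup>2 + (mem zV t + mem yV t)
            \<le> (1 + k\<^sup>2) * (exp (2 * \<gamma> * s) * (norm (z s, y s))\<^sup>2 + (mem zV s + mem yV s))"
            using st by (simp add: mem')
        qed
      qed
    qed
    then show ?thesis using M(1) S(1) by blast
  qed
  \<comment> \<open>The first part is the unweighted case \<open>\<gamma> = 0\<close>.\<close>
  have "\<exists>M\<^sub>0\<ge>1. \<exists>S\<^sub>0\<ge>1. \<exists>\<Lambda>\<^sub>1 \<Lambda>\<^sub>2. \<forall>M\<ge>M\<^sub>0. \<forall>S\<ge>S\<^sub>0. P 0 (memory_energy \<eta> Am) M S \<Lambda>\<^sub>1 \<Lambda>\<^sub>2"
    by (rule main) (use memory_energy_nonneg[OF mo A4 _ eta] in \<open>auto simp: memory_energy_def\<close>)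
  then obtain M\<^sub>0 S\<^sub>0 where MS: "M\<^sub>0 \<ge> 1" "S\<^sub>0 \<ge> 1"
    and part_i: "\<exists>\<Lambda>\<^sub>1 \<Lambda>\<^sub>2. \<forall>M\<ge>M\<^sub>0. \<forall>S\<ge>S\<^sub>0. P 0 (memory_energy \<eta> Am) M S \<Lambda>\<^sub>1 \<Lambda>\<^sub>2"
    by blast
  have part_ii: "\<exists>M\<^sub>1\<ge>M\<^sub>0. \<exists>S\<^sub>1\<ge>S\<^sub>0. \<exists>\<Lambda>\<^sub>1 \<Lambda>\<^sub>2. \<forall>M\<ge>M\<^sub>1. \<forall>S\<ge>S\<^sub>1. P \<gamma> (exp_memory_energy \<eta> \<gamma> D) M S \<Lambda>\<^sub>1 \<Lambda>\<^sub>2"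
    if D: "is_neg_Laplacian \<Omega> rep j D" and \<gamma>: "\<gamma> > 0" and ex: "is_exponential_memory \<gamma> D Am"
    for \<Omega> :: "(real^'d) set" and rep :: "'h \<Rightarrow> real^'d \<Rightarrow> real" and D :: "'v \<Rightarrow>\<^sub>L 'v \<Rightarrow>\<^sub>L real" and \<gamma> :: real
  proof -
    \<comment> \<open>Symmetry and nonnegativity of \<open>D\<close> are read off from the gradient formula.\<close>
    have sym: "D v w = D w v" for v w
      using D by (simp add: is_neg_Laplacian_def inner_commute)
    have psd: "0 \<le> D v v" for v
      using D unfolding is_neg_Laplacian_def set_lebesgue_integral_def
      by (simp add: Bochner_Integration.integral_nonneg)
    have "\<exists>M\<^sub>0\<ge>1. \<exists>S\<^sub>0\<ge>1. \<exists>\<Lambda>\<^sub>1 \<Lambda>\<^sub>2. \<forall>M\<ge>M\<^sub>0. \<forall>S\<ge>S\<^sub>0. P \<gamma> (exp_memory_energy \<eta> \<gamma> D) M S \<Lambda>\<^sub>1 \<Lambda>\<^sub>2"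
    proof (rule main)
      show "0 \<le> \<gamma>" using \<gamma> by simp
      show "exp_memory_energy \<eta> \<gamma> D g t = 2 * \<eta> * (LINT \<tau>:{0..t}|lebesgue. exp (2 * \<gamma> * \<tau>) * Am g \<tau> (g \<tau>))"
        if "L2_loc g" "0 \<le> t" for g t
        by (rule exp_memory_energy_eq(1)[OF mo ex that(1) sym that(2)])
      show "0 \<le> exp_memory_energy \<eta> \<gamma> D g t" if "L2_loc g" "0 \<le> t" for g t
        unfolding exp_memory_energy_eq(2)[OF mo ex that(1) sym that(2)] using eta psd by simp
    qed
    then obtain M\<^sub>1 S\<^sub>1 \<Lambda>\<^sub>1 \<Lambda>\<^sub>2 where "\<forall>M\<ge>M\<^sub>1. \<forall>S\<ge>S\<^sub>1. P \<gamma> (exp_memory_energy \<eta> \<gamma> D) M S \<Lambda>\<^sub>1 \<Lambda>\<^sub>2"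
      by blast
    then show ?thesis
      by (intro exI[of _ "max M\<^sub>0 M\<^sub>1"] exI[of _ "max S\<^sub>0 S\<^sub>1"] exI[of _ \<Lambda>\<^sub>1] exI[of _ \<Lambda>\<^sub>2] conjI) auto
  qed
  show ?thesis
  proof (rule exI[of _ M\<^sub>0], rule conjI[OF MS(1)], rule exI[of _ S\<^sub>0], rule conjI[OF MS(2)], rule conjI)
    from part_i show "\<exists>\<Lambda>\<^sub>1 \<Lambda>\<^sub>2 :: nat \<Rightarrow> real. \<forall>M\<ge>M\<^sub>0. \<forall>S\<ge>S\<^sub>0. 0 \<le> \<Lambda>\<^sub>1 M \<and> 0 \<le> \<Lambda>\<^sub>2 S \<and>
        (\<forall>l\<^sub>1\<ge>\<Lambda>\<^sub>1 M. \<forall>l\<^sub>2\<ge>\<Lambda>\<^sub>2 S. \<exists>D\<^sub>1\<ge>0. \<forall>z\<^sub>0 y\<^sub>0 zV z yV y.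
          weak_solution j A Arc Am \<eta> (\<lambda>h. U M (K M l\<^sub>1 h)) (\<lambda>h. L S l\<^sub>2 (W S h)) z\<^sub>0 y\<^sub>0 zV z yV y \<longrightarrow>
          (\<forall>t\<ge>0. 0 \<le> memory_energy \<eta> Am zV t \<and> 0 \<le> memory_energy \<eta> Am yV t) \<and>
          (\<forall>s t. 0 \<le> s \<and> s \<le> t \<longrightarrow>
            (norm (z t, y t))\<^sup>2 + (memory_energy \<eta> Am zV t + memory_energy \<eta> Am yV t)
            \<le> (1 + D\<^sub>1) *
              ((norm (z s, y s))\<^sup>2 + (memory_energy \<eta> Am zV s + memory_energy \<eta> Am yV s))))"
      unfolding P_def mult_zero_right mult_zero_left exp_zero mult_1 .
  next
    show "\<forall>(bc :: boundary_condition) (\<Omega> :: (real^'d) set) (rep :: 'h \<Rightarrow> real^'d \<Rightarrow> real)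
          (D :: 'v \<Rightarrow>\<^sub>L 'v \<Rightarrow>\<^sub>L real) (\<gamma> :: real).
        polytopal_domain \<Omega> \<and> is_L2_space \<Omega> rep \<and> is_Sobolev_space bc \<Omega> rep j \<and>
        is_neg_Laplacian \<Omega> rep j D \<and> \<gamma> > 0 \<and> is_exponential_memory \<gamma> D Am \<longrightarrow>
        (\<exists>M\<^sub>1\<ge>M\<^sub>0. \<exists>S\<^sub>1\<ge>S\<^sub>0.
          \<exists>\<Lambda>\<^sub>1 \<Lambda>\<^sub>2 :: nat \<Rightarrow> real. \<forall>M\<ge>M\<^sub>1. \<forall>S\<ge>S\<^sub>1. 0 \<le> \<Lambda>\<^sub>1 M \<and> 0 \<le> \<Lambda>\<^sub>2 S \<and>
          (\<forall>l\<^sub>1\<ge>\<Lambda>\<^sub>1 M. \<forall>l\<^sub>2\<ge>\<Lambda>\<^sub>2 S. \<exists>D\<^sub>1\<ge>0. \<forall>z\<^sub>0 y\<^sub>0 zV z yV y.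
            weak_solution j A Arc Am \<eta> (\<lambda>h. U M (K M l\<^sub>1 h)) (\<lambda>h. L S l\<^sub>2 (W S h)) z\<^sub>0 y\<^sub>0 zV z yV y \<longrightarrow>
            (\<forall>t\<ge>0. 0 \<le> exp_memory_energy \<eta> \<gamma> D zV t \<and> 0 \<le> exp_memory_energy \<eta> \<gamma> D yV t) \<and>
            (\<forall>s t. 0 \<le> s \<and> s \<le> t \<longrightarrow>
              exp (2 * \<gamma> * t) * (norm (z t, y t))\<^sup>2
                + (exp_memory_energy \<eta> \<gamma> D zV t + exp_memory_energy \<eta> \<gamma> D yV t)
              \<le> (1 + D\<^sub>1) *
                (exp (2 * \<gamma> * s) * (norm (z s, y s))\<^sup>2
                  + (exp_memory_energy \<eta> \<gamma> D zV s + exp_memory_energy \<eta> \<gamma> D yV s)))))"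
      using part_ii unfolding P_def by blast
  qed
qed

end
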